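(* The problem $\mathrm{PartSynth}(\mathrm{FO}[\sim])$ is decidable; that is, there is an algorithm which, given a finite alphabet $A=A_S\uplus A_E$ of actions and a sentence $\varphi\in\mathrm{FO}[\sim]$ over $A$, decides whether there exist finite disjoint sets of processes $\mathbb{P}_S$ and $\mathbb{P}_E$ (with no shared processes) such that System has a winning strategy for $\varphi$.
   Context: **Data words.** $A$ is a finite alphabet of actions, partitioned into System actions $A_S$ and Environment actions $A_E$. Processes are partitioned between the players: $\mathbb{P}_S$ (System processes) and $\mathbb{P}_E$ (Environment processes) are disjoint finite sets, and there is no shared process. Let $\Sigma_S := A_S\times\mathbb{P}_S$, $\Sigma_E := A_E\times\mathbb{P}_E$, $\Sigma:=\Sigma_S\cup\Sigma_E$. A data word is a finite or infinite sequence $w=(a_0,p_0)(a_1,p_1)\cdots$ over $\Sigma$; each pair $(a_i,p_i)$ in the sequence is called a position. **Logic.** Formulas of $\mathrm{FO}[\sim]$ are first-order formulas (any number of variables; connectives $\neg,\land,\lor,\exists,\forall$) built from the atoms $a(x)$ for $a\in A$, $x=y$, $x\sim y$, $\mathbb{P}_S(x)$, $\mathbb{P}_E(x)$ (and $\mathbb{P}_{SE}(x)$, for shared processes, which is interpreted as the empty set here). A data word is represented as a structure whose domain has one element for each position and one element for each process in $\mathbb{P}_S\cup\mathbb{P}_E$ (including processes on which no action is played). $\mathbb{P}_S$ (resp. $\mathbb{P}_E$) is interpreted as the set of process elements of System (resp. Environment); $a$ is interpreted as the set of positions whose action is $a$; $\sim$ is the equivalence relation such that two positions $(a_i,p_i)$,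 $(a_j,p_j)$ are related iff $p_i=p_j$, and each process element $p$ is related to all positions of the form $(a,p)$. **Strategies.** A strategy for System is a function $\mathcal{S}:\Sigma^*\to\Sigma_S\cup\{\varepsilon\}$. An execution (data word) $w=\sigma_0\sigma_1\cdots$ is $\mathcal{S}$-compatible if (i) for all $0\le i<|w|$, $\sigma_i\in\Sigma_S$ implies $\sigma_i=\mathcal{S}(\sigma_0\cdots\sigma_{i-1})$, and (ii) if $w$ is finite then $\mathcal{S}(w)=\varepsilon$. It is fair for $\mathcal{S}$ if, whenever there are infinitely many $i$ with $\mathcal{S}(\sigma_0\cdots\sigma_{i-1})\neq\varepsilon$, there are infinitely many positions of $w$ in $\Sigma_S$. $\mathcal{S}$ is winning for $\varphi$ if all executions that are $\mathcal{S}$-compatible and fair for $\mathcal{S}$ satisfy $\varphi$. **Problem.** For a logic $\mathcal{L}$, $\mathrm{PartSynth}(\mathcal{L})$ is the problem: given $A=A_S\uplus A_E$ and a sentence $\varphi\in\mathcal{L}$, decide whether System has a winning strategy for $\varphi$ for some arbitrary finite sets $\mathbb{P}_S$ and $\mathbb{P}_E$ (no shared processes). *)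

theory Defs
  imports Main "HOL-Library.Nat_Bijection"
begin

section \<open>Data words\<close>

text \<open>
  Action names and process identities are drawn from the infinite supply \<^typ>\<open>nat\<close>; alphabets and
  sets of processes are arbitrary finite subsets of it. A letter is a pair (action, process).
\<close>

type_synonym letter = "nat \<times> nat"

datatype dword = Fin "letter list" | Inf "nat \<Rightarrow> letter"

fun positions :: "dword \<Rightarrow> nat set" where
  "positions (Fin u) = {..<length u}"
| "positions (Inf f) = UNIV"

fun letter_at :: "dword \<Rightarrow> nat \<Rightarrow> letter" where
  "letter_at (Fin u) i = u ! i"
| "letter_at (Inf f) i = f i"

text \<open>\<open>prefix_of w i\<close> consists of the letters at the positions strictly before \<open>i\<close>.\<close>

fun prefix_of :: "dword \<Rightarrow> nat \<Rightarrow> letter list" where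
  "prefix_of (Fin u) i = take i u"
| "prefix_of (Inf f) i = map f [0..<i]"

definition words_over :: "letter set \<Rightarrow> dword set" where
  "words_over \<Sigma> = {w. \<forall>i\<in>positions w. letter_at w i \<in> \<Sigma>}"


section \<open>The logic\<close>

datatype fm =
    Act nat nat  \<comment> \<open>\<open>Act a x\<close> stands for \<open>a(x)\<close>\<close>
  | Eq nat nat
  | Sim nat nat
  | SysProc nat
  | EnvProc nat
  | SharedProc nat
  | Neg fm
  | Conj fm fm
  | Disj fm fm
  | Exists nat fm
  | Forall nat fm

fun actions :: "fm \<Rightarrow> nat set" where
  "actions (Act a x) = {a}"
| "actions (Eq x y) = {}"
| "actions (Sim x y) = {}"
| "actions (SysProc x) = {}"
| "actions (EnvProc x) = {}"
| "actions (SharedProc x) = {}"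
| "actions (Neg \<phi>) = actions \<phi>"
| "actions (Conj \<phi> \<psi>) = actions \<phi> \<union> actions \<psi>"
| "actions (Disj \<phi> \<psi>) = actions \<phi> \<union> actions \<psi>"
| "actions (Exists x \<phi>) = actions \<phi>"
| "actions (Forall x \<phi>) = actions \<phi>"

fun free_vars :: "fm \<Rightarrow> nat set" where
  "free_vars (Act a x) = {x}"
| "free_vars (Eq x y) = {x, y}"
| "free_vars (Sim x y) = {x, y}"
| "free_vars (SysProc x) = {x}"
| "free_vars (EnvProc x) = {x}"
| "free_vars (SharedProc x) = {x}"
| "free_vars (Neg \<phi>) = free_vars \<phi>"
| "free_vars (Conj \<phi> \<psi>) = free_vars \<phi> \<union> free_vars \<psi>"
| "free_vars (Disj \<phi> \<psi>) = free_vars \<phi> \<union> free_vars \<psi>"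
| "free_vars (Exists x \<phi>) = free_vars \<phi> - {x}"
| "free_vars (Forall x \<phi>) = free_vars \<phi> - {x}"

datatype elem = Pos nat | Proc nat

definition domain :: "nat set \<Rightarrow> nat set \<Rightarrow> dword \<Rightarrow> elem set" where
  "domain PS PE w = Pos ` positions w \<union> Proc ` (PS \<union> PE)"

text \<open>
  The relation \<open>\<sim>\<close> is the kernel of \<open>proc_of w\<close>: positions are related to the positions and to the
  process element carrying the same process, and distinct process elements are unrelated.
\<close>

fun proc_of :: "dword \<Rightarrow> elem \<Rightarrow> nat" where
  "proc_of w (Pos i) = snd (letter_at w i)"
| "proc_of w (Proc p) = p"

fun sat :: "nat set \<Rightarrow> nat set \<Rightarrow> dword \<Rightarrow> (nat \<Rightarrow> elem) \<Rightarrow> fm \<Rightarrow> bool" where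
  "sat PS PE w v (Act a x) \<longleftrightarrow> (\<exists>i\<in>positions w. v x = Pos i \<and> fst (letter_at w i) = a)"
| "sat PS PE w v (Eq x y) \<longleftrightarrow> v x = v y"
| "sat PS PE w v (Sim x y) \<longleftrightarrow> proc_of w (v x) = proc_of w (v y)"
| "sat PS PE w v (SysProc x) \<longleftrightarrow> v x \<in> Proc ` PS"
| "sat PS PE w v (EnvProc x) \<longleftrightarrow> v x \<in> Proc ` PE"
| "sat PS PE w v (SharedProc x) \<longleftrightarrow> False"
| "sat PS PE w v (Neg \<phi>) \<longleftrightarrow> \<not> sat PS PE w v \<phi>"
| "sat PS PE w v (Conj \<phi> \<psi>) \<longleftrightarrow> sat PS PE w v \<phi> \<and> sat PS PE w v \<psi>"
| "sat PS PE w v (Disj \<phi> \<psi>) \<longleftrightarrow> sat PS PE w v \<phi> \<or> sat PS PE w v \<psi>"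
| "sat PS PE w v (Exists x \<phi>) \<longleftrightarrow> (\<exists>e\<in>domain PS PE w. sat PS PE w (v(x := e)) \<phi>)"
| "sat PS PE w v (Forall x \<phi>) \<longleftrightarrow> (\<forall>e\<in>domain PS PE w. sat PS PE w (v(x := e)) \<phi>)"

lemma sat_cong:
  "(\<And>x. x \<in> free_vars \<phi> \<Longrightarrow> v x = v' x) \<Longrightarrow> sat PS PE w v \<phi> \<longleftrightarrow> sat PS PE w v' \<phi>"
proof (induction \<phi> arbitrary: v v')
  case (Exists x \<phi>)
  have "sat PS PE w (v(x := e)) \<phi> \<longleftrightarrow> sat PS PE w (v'(x := e)) \<phi>" for e
    by (rule Exists.IH) (use Exists.prems in auto)
  then show ?case by simp
next
  case (Forall x \<phi>)
  have "sat PS PE w (v(x := e)) \<phi> \<longleftrightarrow> sat PS PE w (v'(x := e)) \<phi>" for e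
    by (rule Forall.IH) (use Forall.prems in auto)
  then show ?case by simp
next
  case (Neg \<phi>)
  have "sat PS PE w v \<phi> \<longleftrightarrow> sat PS PE w v' \<phi>"
    by (rule Neg.IH) (use Neg.prems in auto)
  then show ?case by simp
next
  case (Conj \<phi> \<psi>)
  have "sat PS PE w v \<phi> \<longleftrightarrow> sat PS PE w v' \<phi>" "sat PS PE w v \<psi> \<longleftrightarrow> sat PS PE w v' \<psi>"
    by (rule Conj.IH; use Conj.prems in auto)+
  then show ?case by simp
next
  case (Disj \<phi> \<psi>)
  have "sat PS PE w v \<phi> \<longleftrightarrow> sat PS PE w v' \<phi>" "sat PS PE w v \<psi> \<longleftrightarrow> sat PS PE w v' \<psi>"
    by (rule Disj.IH; use Disj.prems in auto)+
  then show ?case by simp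
qed auto

text \<open>
  By \<open>sat_cong\<close> the valuation is irrelevant for a sentence. It ranges over all of \<^typ>\<open>elem\<close>, not
  just over the domain: the domain may be empty, and then no valuation into it exists.
\<close>

definition models :: "nat set \<Rightarrow> nat set \<Rightarrow> dword \<Rightarrow> fm \<Rightarrow> bool" where
  "models PS PE w \<phi> \<longleftrightarrow> (\<forall>v. sat PS PE w v \<phi>)"


section \<open>Strategies\<close>

text \<open>
  \<^term>\<open>None\<close> encodes \<open>\<epsilon>\<close>. In the definitions below \<open>\<Sigma>S\<close> and \<open>\<Sigma>E\<close> are the sets of System and
  Environment letters.
\<close>

type_synonym strategy = "letter list \<Rightarrow> letter option"

definition is_strategy :: "letter set \<Rightarrow> letter set \<Rightarrow> strategy \<Rightarrow> bool" where
  "is_strategy \<Sigma>S \<Sigma>E S \<longleftrightarrow> (\<forall>u\<in>lists (\<Sigma>S \<union> \<Sigma>E). S u \<in> insert None (Some ` \<Sigma>S))"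

definition compatible :: "letter set \<Rightarrow> strategy \<Rightarrow> dword \<Rightarrow> bool" where
  "compatible \<Sigma>S S w \<longleftrightarrow>
     (\<forall>i\<in>positions w. letter_at w i \<in> \<Sigma>S \<longrightarrow> S (prefix_of w i) = Some (letter_at w i)) \<and>
     (\<forall>u. w = Fin u \<longrightarrow> S u = None)"

definition fair :: "letter set \<Rightarrow> strategy \<Rightarrow> dword \<Rightarrow> bool" where
  "fair \<Sigma>S S w \<longleftrightarrow>
     (infinite {i \<in> positions w. S (prefix_of w i) \<noteq> None} \<longrightarrow>
      infinite {i \<in> positions w. letter_at w i \<in> \<Sigma>S})"

definition winning :: "nat set \<Rightarrow> nat set \<Rightarrow> nat set \<Rightarrow> nat set \<Rightarrow> fm \<Rightarrow> strategy \<Rightarrow> bool" where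
  "winning AS AE PS PE \<phi> S \<longleftrightarrow>
     (\<forall>w\<in>words_over (AS \<times> PS \<union> AE \<times> PE).
        compatible (AS \<times> PS) S w \<and> fair (AS \<times> PS) S w \<longrightarrow> models PS PE w \<phi>)"


section \<open>The synthesis problem\<close>

type_synonym inst = "nat set \<times> nat set \<times> fm"

definition instances :: "inst set" where
  "instances = {(AS, AE, \<phi>). finite AS \<and> finite AE \<and> AS \<inter> AE = {} \<and>
                             actions \<phi> \<subseteq> AS \<union> AE \<and> free_vars \<phi> = {}}"

definition PartSynth :: "inst set" where
  "PartSynth = {(AS, AE, \<phi>) \<in> instances.
     \<exists>PS PE. finite PS \<and> finite PE \<and> PS \<inter> PE = {} \<and>
       (\<exists>S. is_strategy (AS \<times> PS) (AE \<times> PE) S \<and> winning AS AE PS PE \<phi> S)}"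

text \<open>
  The encoding is written out explicitly because decidability only makes sense relative to an
  effective one; the \<open>to_nat\<close> of class \<open>countable\<close> is obtained by a choice operator and would
  not do.
\<close>

fun fm_encode :: "fm \<Rightarrow> nat" where
  "fm_encode (Act a x) = prod_encode (0, prod_encode (a, x))"
| "fm_encode (Eq x y) = prod_encode (1, prod_encode (x, y))"
| "fm_encode (Sim x y) = prod_encode (2, prod_encode (x, y))"
| "fm_encode (SysProc x) = prod_encode (3, x)"
| "fm_encode (EnvProc x) = prod_encode (4, x)"
| "fm_encode (SharedProc x) = prod_encode (5, x)"
| "fm_encode (Neg \<phi>) = prod_encode (6, fm_encode \<phi>)"
| "fm_encode (Conj \<phi> \<psi>) = prod_encode (7, prod_encode (fm_encode \<phi>, fm_encode \<psi>))"
| "fm_encode (Disj \<phi> \<psi>) = prod_encode (8, prod_encode (fm_encode \<phi>, fm_encode \<psi>))"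
| "fm_encode (Exists x \<phi>) = prod_encode (9, prod_encode (x, fm_encode \<phi>))"
| "fm_encode (Forall x \<phi>) = prod_encode (10, prod_encode (x, fm_encode \<phi>))"

lemma fm_encode_inject: "fm_encode \<phi> = fm_encode \<psi> \<longleftrightarrow> \<phi> = \<psi>"
proof (induction \<phi> arbitrary: \<psi>)
  case (Act a x) show ?case by (cases \<psi>) auto
next
  case (Eq x y) show ?case by (cases \<psi>) auto
next
  case (Sim x y) show ?case by (cases \<psi>) auto
next
  case (SysProc x) show ?case by (cases \<psi>) auto
next
  case (EnvProc x) show ?case by (cases \<psi>) auto
next
  case (SharedProc x) show ?case by (cases \<psi>) auto
next
  case (Neg \<phi>) then show ?case by (cases \<psi>) auto
next
  case (Conj \<phi>1 \<phi>2) then show ?case by (cases \<psi>) auto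
next
  case (Disj \<phi>1 \<phi>2) then show ?case by (cases \<psi>) auto
next
  case (Exists x \<phi>) then show ?case by (cases \<psi>) auto
next
  case (Forall x \<phi>) then show ?case by (cases \<psi>) auto
qed

fun encode_inst :: "inst \<Rightarrow> nat" where
  "encode_inst (AS, AE, \<phi>) =
     prod_encode (set_encode AS, prod_encode (set_encode AE, fm_encode \<phi>))"

lemma inj_on_encode_inst: "inj_on encode_inst instances"
  by (auto simp: inj_on_def instances_def fm_encode_inject set_encode_eq)


section \<open>Decidability\<close>

text \<open>
  Partial recursive functions with Kleene's schemes: \<open>eval f xs y\<close> means that \<open>f\<close> converges on the
  arguments \<open>xs\<close> with value \<open>y\<close>. The recursion argument of \<open>Prec\<close> and the search argument of \<open>Mu\<close>
  come first.
\<close>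

datatype recf =
    Zero
  | Succ
  | Proj nat
  | Comp recf "recf list"
  | Prec recf recf
  | Mu recf

inductive eval :: "recf \<Rightarrow> nat list \<Rightarrow> nat \<Rightarrow> bool" where
  eval_Zero: "eval Zero xs 0"
| eval_Succ: "eval Succ [x] (Suc x)"
| eval_Proj: "i < length xs \<Longrightarrow> eval (Proj i) xs (xs ! i)"
| eval_Comp: "list_all2 (\<lambda>g y. eval g xs y) gs ys \<Longrightarrow> eval f ys z \<Longrightarrow> eval (Comp f gs) xs z"
| eval_Prec_0: "eval f xs y \<Longrightarrow> eval (Prec f g) (0 # xs) y"
| eval_Prec_Suc:
    "eval (Prec f g) (n # xs) r \<Longrightarrow> eval g (n # r # xs) y \<Longrightarrow> eval (Prec f g) (Suc n # xs) y"
| eval_Mu: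
    "eval f (n # xs) 0 \<Longrightarrow> (\<forall>m<n. \<exists>k. eval f (m # xs) (Suc k)) \<Longrightarrow> eval (Mu f) xs n"

inductive_cases eval_ZeroE: "eval Zero xs y"
inductive_cases eval_SuccE: "eval Succ xs y"
inductive_cases eval_ProjE: "eval (Proj i) xs y"
inductive_cases eval_CompE: "eval (Comp f gs) xs y"
inductive_cases eval_Prec_0E: "eval (Prec f g) (0 # xs) y"
inductive_cases eval_Prec_SucE: "eval (Prec f g) (Suc n # xs) y"
inductive_cases eval_MuE: "eval (Mu f) xs y"

lemma eval_deterministic: "eval f xs y \<Longrightarrow> eval f xs z \<Longrightarrow> y = z"
proof (induction arbitrary: z rule: eval.induct)
  case (eval_Comp xs gs ys f y)
  from eval_Comp.prems obtain ys' where
    ys': "list_all2 (\<lambda>g y. eval g xs y) gs ys'" "eval f ys' z"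
    by (rule eval_CompE)
  have "ys = ys'"
    using eval_Comp.IH(1) ys'(1) by (auto simp: list_all2_conv_all_nth intro!: nth_equalityI)
  with eval_Comp.IH(2) ys'(2) show ?case by simp
next
  case (eval_Prec_Suc f g n xs r y)
  from eval_Prec_Suc.prems obtain r' where "eval (Prec f g) (n # xs) r'" "eval g (n # r' # xs) z"
    by (rule eval_Prec_SucE)
  with eval_Prec_Suc.IH show ?case by blast
next
  case (eval_Mu f n xs)
  from eval_Mu.prems have z: "eval f (z # xs) 0" "\<forall>m<z. \<exists>k. eval f (m # xs) (Suc k)"
    by (auto elim: eval_MuE)
  have "\<not> n < z" using z(2) eval_Mu.IH(1) by fastforce
  moreover have "\<not> z < n" using z(1) eval_Mu.IH(2) by fastforce
  ultimately show ?case by simp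
qed (blast elim: eval_ZeroE eval_SuccE eval_ProjE eval_Prec_0E)+

definition decidable :: "nat set \<Rightarrow> bool" where
  "decidable L \<longleftrightarrow> (\<exists>f. \<forall>n. eval f [n] (if n \<in> L then 1 else 0))"

end

theory Submission
  imports Defs "HOL-Library.FuncSet" "HOL-Library.Infinite_Set"
begin

text \<open>
  By a local form of Ehrenfeucht--Fraisse equivalence, the truth of a sentence of quantifier depth
  at most \<open>q\<close> in a data word only depends on how many processes of each player have which numbers
  of actions, where all these counts are capped at \<open>q\<close>. Synthesis thereby becomes a game in which
  every process is a token that moves upwards in a finite order of action counts. When Environment
  has many tokens, surplus ones can follow a crowd of other tokens, so that System may assume that
  there are few of them; this bounds the number of rounds, and then a back-and-forth argument bounds
  the number of System tokens that matter. It remains to solve finitely many finite games, which is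
  a property of numbers definable with bounded quantifiers only.
\<close>

section \<open>A calculus of computable functions\<close>

text \<open>The two players cannot be cut down in either order. Copying one System batch to a
  different number of tokens divides the threshold up to which the counts agree by the number of
  locations, so the initial threshold is exponential in the number of rounds. The rounds are bounded
  by the upward steps left to all Environment tokens together, hence only once these tokens are few.
  Environment therefore comes first, by a bound that mentions neither rounds nor System tokens.

  Infinite words disappear because capped counts over a finite alphabet are eventually constant, so
  the configuration of the word is that of a long prefix. Fairness then says just enough: a System
  that keeps proposing a letter with an unsaturated count is eventually heard, and that changes the
  configuration.

  Two kinds of recursion would be awkward for Kleene's schemes and are replaced by guessing a finite
  object below a bound: the winning region becomes a set of configurations closed under single
  letters, and recursion on formulas becomes a table of truth values.\<close>

definition rec_fun :: "nat \<Rightarrow> (nat list \<Rightarrow> nat) \<Rightarrow> bool" where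
  "rec_fun k F \<longleftrightarrow> (\<exists>f. \<forall>xs. length xs = k \<longrightarrow> eval f xs (F xs))"

lemma rec_fun_zero: "rec_fun k (\<lambda>_. 0)"
  unfolding rec_fun_def by (auto intro: eval_Zero)

lemma rec_fun_nth: "i < k \<Longrightarrow> rec_fun k (\<lambda>xs. xs ! i)"
  unfolding rec_fun_def by (auto intro: eval_Proj)

lemma rec_fun_comp1:
  assumes "rec_fun 1 F" "rec_fun k G"
  shows "rec_fun k (\<lambda>xs. F [G xs])"
proof -
  from assms obtain f g where f: "\<And>xs. length xs = 1 \<Longrightarrow> eval f xs (F xs)"
    and g: "\<And>xs. length xs = k \<Longrightarrow> eval g xs (G xs)"
    unfolding rec_fun_def by blast
  have "eval (Comp f [g]) xs (F [G xs])" if "length xs = k" for xs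
    by (rule eval_Comp[where ys = "[G xs]"]) (auto intro: f g that)
  then show ?thesis unfolding rec_fun_def by blast
qed

lemma rec_fun_comp2:
  assumes "rec_fun 2 F" "rec_fun k G" "rec_fun k H"
  shows "rec_fun k (\<lambda>xs. F [G xs, H xs])"
proof -
  from assms obtain f g h where f: "\<And>xs. length xs = 2 \<Longrightarrow> eval f xs (F xs)"
    and g: "\<And>xs. length xs = k \<Longrightarrow> eval g xs (G xs)"
    and h: "\<And>xs. length xs = k \<Longrightarrow> eval h xs (H xs)"
    unfolding rec_fun_def by blast
  have "eval (Comp f [g, h]) xs (F [G xs, H xs])" if "length xs = k" for xs
    by (rule eval_Comp[where ys = "[G xs, H xs]"]) (auto intro: f g h that)
  then show ?thesis unfolding rec_fun_def by blast
qed

lemma rec_fun_Suc: "rec_fun k G \<Longrightarrow> rec_fun k (\<lambda>xs. Suc (G xs))"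
proof -
  have "eval Succ xs (Suc (hd xs))" if "length xs = 1" for xs
    using that by (cases xs) (auto intro: eval_Succ)
  then have "rec_fun 1 (\<lambda>xs. Suc (hd xs))" unfolding rec_fun_def by blast
  then show "rec_fun k G \<Longrightarrow> rec_fun k (\<lambda>xs. Suc (G xs))"
    by (drule_tac rec_fun_comp1) auto
qed

lemma rec_fun_rec_nat:
  assumes "rec_fun k F" "rec_fun (Suc (Suc k)) G"
  shows "rec_fun (Suc k) (\<lambda>xs. rec_nat (F (tl xs)) (\<lambda>n r. G (n # r # tl xs)) (hd xs))"
proof -
  from assms obtain f g where f: "\<And>xs. length xs = k \<Longrightarrow> eval f xs (F xs)"
    and g: "\<And>xs. length xs = Suc (Suc k) \<Longrightarrow> eval g xs (G xs)"
    unfolding rec_fun_def by blast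
  have "eval (Prec f g) (n # ys) (rec_nat (F ys) (\<lambda>n r. G (n # r # ys)) n)" if "length ys = k" for n ys
    using that
  proof (induction n)
    case (Suc n)
    from eval_Prec_Suc[OF Suc.IH[OF Suc.prems] g] Suc.prems show ?case by simp
  qed (simp add: eval_Prec_0 f)
  then have "eval (Prec f g) xs (rec_nat (F (tl xs)) (\<lambda>n r. G (n # r # tl xs)) (hd xs))"
    if "length xs = Suc k" for xs
    using that by (cases xs) auto
  then show ?thesis unfolding rec_fun_def by blast
qed

lemma rec_fun_Least:
  assumes "rec_fun (Suc k) F" and ex: "\<And>xs. length xs = k \<Longrightarrow> \<exists>n. F (n # xs) = 0"
  shows "rec_fun k (\<lambda>xs. LEAST n. F (n # xs) = 0)"
proof -
  from assms obtain f where f: "\<And>xs. length xs = Suc k \<Longrightarrow> eval f xs (F xs)"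
    unfolding rec_fun_def by blast
  have "eval (Mu f) xs (LEAST n. F (n # xs) = 0)" if l: "length xs = k" for xs
  proof (rule eval_Mu)
    have "F ((LEAST n. F (n # xs) = 0) # xs) = 0" by (rule LeastI_ex) (rule ex[OF l])
    then show "eval f ((LEAST n. F (n # xs) = 0) # xs) 0"
      using f[of "(LEAST n. F (n # xs) = 0) # xs"] l by simp
    show "\<forall>m<LEAST n. F (n # xs) = 0. \<exists>k. eval f (m # xs) (Suc k)"
    proof (intro allI impI)
      fix m assume "m < (LEAST n. F (n # xs) = 0)"
      then have "F (m # xs) \<noteq> 0" by (rule not_less_Least)
      then show "\<exists>k. eval f (m # xs) (Suc k)"
        using f[of "m # xs"] l by (metis length_Cons not0_implies_Suc)
    qed
  qed
  then show ?thesis unfolding rec_fun_def by blast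
qed

section \<open>Primitive recursive arithmetic and the inverse of Cantor's pairing\<close>

lemma rec_fun_add: "rec_fun k G \<Longrightarrow> rec_fun k H \<Longrightarrow> rec_fun k (\<lambda>xs. G xs + H xs)"
proof -
  have r: "rec_nat y (\<lambda>n r. Suc r) x = x + y" for x y :: nat by (induction x) auto
  have "rec_fun (Suc 1) (\<lambda>xs. rec_nat (tl xs ! 0) (\<lambda>n r. Suc ((n # r # tl xs) ! 1)) (hd xs))"
    by (intro rec_fun_rec_nat rec_fun_nth rec_fun_Suc) auto
  then have "rec_fun 2 (\<lambda>xs. hd xs + tl xs ! 0)" by (simp add: r numeral_2_eq_2)
  from rec_fun_comp2[OF this] show "rec_fun k G \<Longrightarrow> rec_fun k H \<Longrightarrow> rec_fun k (\<lambda>xs. G xs + H xs)"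
    by simp
qed

lemma rec_fun_diff: "rec_fun k G \<Longrightarrow> rec_fun k H \<Longrightarrow> rec_fun k (\<lambda>xs. G xs - H xs)"
proof -
  \<comment> \<open>A recursion that returns its counter instead of its accumulator is the
    predecessor; iterating it gives truncated subtraction.\<close>
  have "rec_nat 0 (\<lambda>n r. n) x = x - 1" for x :: nat by (cases x) auto
  moreover have "rec_fun (Suc 0) (\<lambda>xs. rec_nat 0 (\<lambda>n r. (n # r # tl xs) ! 0) (hd xs))"
    by (intro rec_fun_rec_nat rec_fun_nth rec_fun_zero) auto
  ultimately have "rec_fun 1 (\<lambda>xs. hd xs - 1)" by simp
  from rec_fun_comp1[OF this] have p: "rec_fun k F \<Longrightarrow> rec_fun k (\<lambda>xs. F xs - 1)" for k F by simp
  have r: "rec_nat y (\<lambda>n r. r - 1) x = y - x" for x y :: nat by (induction x) auto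
  have "rec_fun (Suc 1) (\<lambda>xs. rec_nat (tl xs ! 0) (\<lambda>n r. (n # r # tl xs) ! 1 - 1) (hd xs))"
    by (intro rec_fun_rec_nat rec_fun_nth p) auto
  then have "rec_fun 2 (\<lambda>xs. tl xs ! 0 - hd xs)" by (simp add: r[simplified] numeral_2_eq_2)
  from rec_fun_comp2[OF this] show "rec_fun k G \<Longrightarrow> rec_fun k H \<Longrightarrow> rec_fun k (\<lambda>xs. G xs - H xs)"
    by simp
qed

lemma rec_fun_triangle: "rec_fun k G \<Longrightarrow> rec_fun k (\<lambda>xs. triangle (G xs))"
proof -
  have r: "rec_nat 0 (\<lambda>n r. r + Suc n) x = triangle x" for x :: nat by (induction x) auto
  have "rec_fun (Suc 0)
      (\<lambda>xs. rec_nat 0 (\<lambda>n r. (n # r # tl xs) ! 1 + Suc ((n # r # tl xs) ! 0)) (hd xs))"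
    by (intro rec_fun_rec_nat rec_fun_nth rec_fun_zero rec_fun_add rec_fun_Suc) auto
  then have "rec_fun 1 (\<lambda>xs. triangle (hd xs))" by (simp add: r[simplified])
  from rec_fun_comp1[OF this] show "rec_fun k G \<Longrightarrow> rec_fun k (\<lambda>xs. triangle (G xs))"
    by simp
qed

abbreviation pr :: "nat \<Rightarrow> nat \<Rightarrow> nat" where
  "pr x y \<equiv> prod_encode (x, y)"

definition p1 :: "nat \<Rightarrow> nat" where "p1 n = fst (prod_decode n)"
definition p2 :: "nat \<Rightarrow> nat" where "p2 n = snd (prod_decode n)"

lemma p1_pr [simp]: "p1 (pr x y) = x" and p2_pr [simp]: "p2 (pr x y) = y"
  by (simp_all add: p1_def p2_def)

lemma pr_p1_p2 [simp]: "pr (p1 n) (p2 n) = n"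
  by (simp add: p1_def p2_def)

text \<open>Cantor's enumeration places a pair by its diagonal and its offset there, which is the
  first component. Once the diagonal is computable, both projections follow by subtraction.\<close>

definition diagonal :: "nat \<Rightarrow> nat" where "diagonal n = p1 n + p2 n"

lemma triangle_mono: "i \<le> j \<Longrightarrow> triangle i \<le> triangle j"
  by (induction j rule: dec_induct) auto

lemma diagonal_split: "n = triangle (diagonal n) + p1 n"
  using pr_p1_p2[of n] unfolding prod_encode_def diagonal_def by simp

text \<open>The diagonal is the least \<open>d\<close> with \<open>n < triangle (Suc d)\<close>.
  Truncated subtraction turns this into a zero test, the form of search that \<open>Mu\<close>
  offers.\<close>

lemma diagonal_eq_Least: "diagonal n = (LEAST d. Suc n - triangle (Suc d) = 0)"
proof (rule Least_equality[symmetric])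
  have n: "n = triangle (diagonal n) + p1 n"
    by (rule diagonal_split)
  then show "Suc n - triangle (Suc (diagonal n)) = 0"
    unfolding diagonal_def by simp
  show "diagonal n \<le> y" if "Suc n - triangle (Suc y) = 0" for y
  proof (rule ccontr)
    assume "\<not> diagonal n \<le> y"
    then have "triangle (Suc y) \<le> triangle (diagonal n)" by (intro triangle_mono) auto
    with n that show False by simp
  qed
qed

lemma rec_fun_diagonal: "rec_fun k G \<Longrightarrow> rec_fun k (\<lambda>xs. diagonal (G xs))"
proof -
  have "rec_fun (Suc 1) (\<lambda>xs. Suc (xs ! 1) - triangle (Suc (xs ! 0)))"
    by (intro rec_fun_diff rec_fun_Suc rec_fun_triangle rec_fun_nth) auto
  then have "rec_fun 1 (\<lambda>xs. LEAST n. Suc ((n # xs) ! 1) - triangle (Suc ((n # xs) ! 0)) = 0)"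
  proof (rule rec_fun_Least)
    fix xs :: "nat list"
    show "\<exists>n. Suc ((n # xs) ! 1) - triangle (Suc ((n # xs) ! 0)) = 0"
      by (intro exI[of _ "xs ! 0"]) simp
  qed
  then have "rec_fun 1 (\<lambda>xs. diagonal (xs ! 0))" by (simp add: diagonal_eq_Least)
  from rec_fun_comp1[OF this] show "rec_fun k G \<Longrightarrow> rec_fun k (\<lambda>xs. diagonal (G xs))"
    by simp
qed

lemma rec_fun_pr: "rec_fun k G \<Longrightarrow> rec_fun k H \<Longrightarrow> rec_fun k (\<lambda>xs. pr (G xs) (H xs))"
  unfolding prod_encode_def by (simp add: rec_fun_add rec_fun_triangle)

lemma p1_eq: "p1 n = n - triangle (diagonal n)"
proof -
  have "n = triangle (diagonal n) + p1 n"
    by (rule diagonal_split)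
  then show ?thesis by simp
qed

lemma rec_fun_p1: "rec_fun k G \<Longrightarrow> rec_fun k (\<lambda>xs. p1 (G xs))"
  unfolding p1_eq by (intro rec_fun_diff rec_fun_triangle rec_fun_diagonal)

lemma p2_eq: "p2 n = diagonal n - p1 n"
  by (simp add: diagonal_def)

lemma rec_fun_p2: "rec_fun k G \<Longrightarrow> rec_fun k (\<lambda>xs. p2 (G xs))"
  unfolding p2_eq by (intro rec_fun_diff rec_fun_p1 rec_fun_diagonal)

text \<open>
  From here on all functions are unary: a function of several variables takes their nested pair
  code, so that a closure rule only ever has to look at terms over one variable, and binding a
  further variable means pairing it with the current one.
\<close>

definition computable :: "(nat \<Rightarrow> nat) \<Rightarrow> bool" where
  "computable F \<longleftrightarrow> rec_fun 1 (\<lambda>xs. F (xs ! 0))"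

definition computable_pred :: "(nat \<Rightarrow> bool) \<Rightarrow> bool" where
  "computable_pred P \<longleftrightarrow> computable (\<lambda>x. of_bool (P x))"

lemma computable_comp: "computable F \<Longrightarrow> computable G \<Longrightarrow> computable (\<lambda>x. F (G x))"
  unfolding computable_def by (drule (1) rec_fun_comp1) simp

lemma computable_pred_comp:
  "computable_pred P \<Longrightarrow> computable G \<Longrightarrow> computable_pred (\<lambda>x. P (G x))"
  unfolding computable_pred_def by (rule computable_comp)

section \<open>Closure rules for computable functions and predicates\<close>

named_theorems comp_intros

lemma computable_id [comp_intros]: "computable (\<lambda>x. x)"
  unfolding computable_def by (simp add: rec_fun_nth)

lemma computable_Suc [comp_intros]: "computable G \<Longrightarrow> computable (\<lambda>x. Suc (G x))"
  unfolding computable_def by (rule rec_fun_Suc)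

lemma computable_const [comp_intros]: "computable (\<lambda>x. n)"
proof (induction n)
  case 0 show ?case by (simp add: computable_def rec_fun_zero)
qed (rule computable_Suc)

lemma computable_add [comp_intros]:
  "computable G \<Longrightarrow> computable H \<Longrightarrow> computable (\<lambda>x. G x + H x)"
  unfolding computable_def by (rule rec_fun_add)

lemma computable_diff [comp_intros]:
  "computable G \<Longrightarrow> computable H \<Longrightarrow> computable (\<lambda>x. G x - H x)"
  unfolding computable_def by (rule rec_fun_diff)

lemma computable_pr [comp_intros]:
  "computable G \<Longrightarrow> computable H \<Longrightarrow> computable (\<lambda>x. pr (G x) (H x))"
  unfolding computable_def by (rule rec_fun_pr)

lemma computable_p1 [comp_intros]: "computable G \<Longrightarrow> computable (\<lambda>x. p1 (G x))"
  unfolding computable_def by (rule rec_fun_p1)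

lemma computable_p2 [comp_intros]: "computable G \<Longrightarrow> computable (\<lambda>x. p2 (G x))"
  unfolding computable_def by (rule rec_fun_p2)

lemma computable_rec_nat:
  assumes "computable B" "computable G" "computable (\<lambda>z. H (p1 z) (p1 (p2 z)) (p2 (p2 z)))"
  shows "computable (\<lambda>x. rec_nat (G x) (\<lambda>n r. H n r x) (B x))"
proof -
  have "rec_fun 1 (\<lambda>xs. G (xs ! 0))" using assms(2) by (simp add: computable_def)
  moreover have "rec_fun (Suc (Suc 1)) (\<lambda>ys. H (ys ! 0) (ys ! 1) (ys ! 2))"
    using rec_fun_comp1[OF assms(3)[unfolded computable_def],
      of 3 "\<lambda>ys. pr (ys ! 0) (pr (ys ! 1) (ys ! 2))"]
    by (simp add: rec_fun_pr rec_fun_nth numeral_3_eq_3)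
  ultimately have "rec_fun (Suc 1) (\<lambda>xs. rec_nat (G (tl xs ! 0))
      (\<lambda>n r. H ((n # r # tl xs) ! 0) ((n # r # tl xs) ! 1) ((n # r # tl xs) ! 2)) (hd xs))"
    by (rule rec_fun_rec_nat)
  then have "rec_fun 2 (\<lambda>xs. rec_nat (G (tl xs ! 0)) (\<lambda>n r. H n r (tl xs ! 0)) (hd xs))"
    by (simp add: numeral_2_eq_2)
  from rec_fun_comp2[OF this, of 1 "\<lambda>xs. B (xs ! 0)" "\<lambda>xs. xs ! 0"] assms(1)
  show ?thesis by (simp add: computable_def rec_fun_nth)
qed

lemma computable_mult [comp_intros]:
  assumes "computable G" "computable H"
  shows "computable (\<lambda>x. G x * H x)"
proof -
  have r: "rec_nat 0 (\<lambda>n r. r + y) x = x * y" for x y :: nat by (induction x) auto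
  have "computable (\<lambda>x. rec_nat 0 (\<lambda>n r. r + H x) (G x))"
    by (intro computable_rec_nat comp_intros assms computable_comp[OF assms(2)])
  then show ?thesis by (simp add: r)
qed

lemma computable_power [comp_intros]:
  assumes "computable G" "computable H"
  shows "computable (\<lambda>x. G x ^ H x)"
proof -
  have r: "rec_nat 1 (\<lambda>n r. y * r) x = y ^ x" for x y :: nat by (induction x) auto
  have "computable (\<lambda>x. rec_nat 1 (\<lambda>n r. G x * r) (H x))"
    by (intro computable_rec_nat comp_intros assms computable_comp[OF assms(1)])
  then show ?thesis by (simp only: r)
qed

lemma computable_pred_True [comp_intros]: "computable_pred (\<lambda>_. True)"
  unfolding computable_pred_def by (rule computable_const)

lemma computable_pred_not [comp_intros]:
  assumes "computable_pred P" shows "computable_pred (\<lambda>x. \<not> P x)"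
proof -
  have "computable (\<lambda>x. 1 - of_bool (P x))"
    using assms unfolding computable_pred_def by (intro comp_intros)
  moreover have "1 - of_bool b = (of_bool (\<not> b) :: nat)" for b by simp
  ultimately show ?thesis unfolding computable_pred_def by (simp only:)
qed

lemma computable_pred_conj [comp_intros]:
  "computable_pred P \<Longrightarrow> computable_pred Q \<Longrightarrow> computable_pred (\<lambda>x. P x \<and> Q x)"
  unfolding computable_pred_def of_bool_conj by (rule computable_mult)

lemma computable_pred_disj [comp_intros]:
  assumes "computable_pred P" "computable_pred Q" shows "computable_pred (\<lambda>x. P x \<or> Q x)"
proof -
  have "computable_pred (\<lambda>x. \<not> (\<not> P x \<and> \<not> Q x))" by (intro comp_intros assms)
  then show ?thesis by simp
qed

lemma computable_pred_imp [comp_intros]: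
  assumes "computable_pred P" "computable_pred Q" shows "computable_pred (\<lambda>x. P x \<longrightarrow> Q x)"
proof -
  have "computable_pred (\<lambda>x. \<not> P x \<or> Q x)" by (intro comp_intros assms)
  then show ?thesis by simp
qed

lemma computable_pred_iff [comp_intros]:
  assumes "computable_pred P" "computable_pred Q" shows "computable_pred (\<lambda>x. P x \<longleftrightarrow> Q x)"
proof -
  have "computable_pred (\<lambda>x. (P x \<longrightarrow> Q x) \<and> (Q x \<longrightarrow> P x))" by (intro comp_intros assms)
  then show ?thesis by (simp add: iff_conv_conj_imp)
qed

lemma computable_pred_le [comp_intros]:
  assumes "computable G" "computable H" shows "computable_pred (\<lambda>x. G x \<le> H x)"
proof -
  have "computable (\<lambda>x. 1 - (G x - H x))" by (intro comp_intros assms)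
  moreover have "1 - (i - j) = of_bool (i \<le> j)" for i j :: nat by auto
  ultimately show ?thesis unfolding computable_pred_def by simp
qed

lemma computable_pred_less [comp_intros]:
  "computable G \<Longrightarrow> computable H \<Longrightarrow> computable_pred (\<lambda>x. G x < H x)"
  unfolding Suc_le_eq[symmetric] by (intro comp_intros)

lemma computable_pred_eq [comp_intros]:
  "computable G \<Longrightarrow> computable H \<Longrightarrow> computable_pred (\<lambda>x. G x = H x)"
  unfolding eq_iff by (intro comp_intros)

lemma computable_pred_Ex [comp_intros]:
  assumes B: "computable B" and P: "computable_pred (\<lambda>z. P (p1 z) (p2 z))"
  shows "computable_pred (\<lambda>x. \<exists>i<B x. P i x)"
proof -
  \<comment> \<open>Bounded search as primitive recursion: the accumulator is the truth value found
    so far.\<close>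
  have r: "rec_nat 0 (\<lambda>n r. of_bool (r = 1 \<or> P n x)) b = (of_bool (\<exists>i<b. P i x) :: nat)" for x b
    by (induction b) (auto simp: less_Suc_eq)
  have "computable_pred (\<lambda>z. P (p1 z) (p2 (p2 z)))"
    using computable_pred_comp[OF P, of "\<lambda>z. pr (p1 z) (p2 (p2 z))"]
    by (simp add: comp_intros)
  then have "computable_pred (\<lambda>z. p1 (p2 z) = 1 \<or> P (p1 z) (p2 (p2 z)))"
    by (intro comp_intros)
  then have "computable (\<lambda>x. rec_nat 0 (\<lambda>n r. of_bool (r = 1 \<or> P n x)) (B x))"
    unfolding computable_pred_def by (intro computable_rec_nat comp_intros B)
  then show ?thesis unfolding computable_pred_def r .
qed

lemma computable_pred_All [comp_intros]:
  assumes "computable B" "computable_pred (\<lambda>z. P (p1 z) (p2 z))"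
  shows "computable_pred (\<lambda>x. \<forall>i<B x. P i x)"
proof -
  have "computable_pred (\<lambda>x. \<not> (\<exists>i<B x. \<not> P i x))" by (intro comp_intros assms)
  then show ?thesis by simp
qed

lemma computable_Least:
  assumes "computable_pred (\<lambda>z. P (p1 z) (p2 z))" and "\<And>x. \<exists>i. P i x"
  shows "computable (\<lambda>x. LEAST i. P i x)"
proof -
  have "computable (\<lambda>z. 1 - of_bool (P (p1 z) (p2 z)))"
    using assms(1) unfolding computable_pred_def by (intro comp_intros)
  from rec_fun_comp1[OF this[unfolded computable_def], of 2 "\<lambda>ys. pr (ys ! 0) (ys ! 1)"]
  have "rec_fun (Suc 1) (\<lambda>ys. 1 - of_bool (P (ys ! 0) (ys ! 1)))"
    by (simp add: rec_fun_pr rec_fun_nth numeral_2_eq_2)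
  then have "rec_fun 1 (\<lambda>xs. LEAST n. 1 - of_bool (P ((n # xs) ! 0) ((n # xs) ! 1)) = (0::nat))"
    by (rule rec_fun_Least) (use assms(2) in auto)
  moreover have "(1 - of_bool b = (0::nat)) = b" for b by auto
  ultimately show ?thesis by (simp add: computable_def)
qed

lemma computable_div [comp_intros]:
  assumes "computable G" "computable H" shows "computable (\<lambda>x. G x div H x)"
proof -
  \<comment> \<open>The disjunct \<open>b = 0\<close> makes the search total and yields 0, the value
    of division by zero.\<close>
  have L: "a div b = (LEAST d. b = 0 \<or> a < Suc d * b)" for a b :: nat
  proof (cases "b = 0")
    case False
    then have "(LEAST d. a < Suc d * b) = a div b"
      by (intro Least_equality) (auto simp: dividend_less_div_times div_less_iff_less_mult
        add.commute less_Suc_eq_le[symmetric])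
    with False show ?thesis by simp
  qed simp
  have "\<exists>d. b = 0 \<or> a < Suc d * b" for a b :: nat
    by (intro exI[of _ a]) (cases b, auto)
  then have "computable (\<lambda>x. LEAST d. H x = 0 \<or> G x < Suc d * H x)"
    by (intro computable_Least comp_intros computable_comp[OF assms(1)] computable_comp[OF assms(2)])
  then show ?thesis by (simp only: L)
qed

lemma computable_mod [comp_intros]:
  "computable G \<Longrightarrow> computable H \<Longrightarrow> computable (\<lambda>x. G x mod H x)"
  unfolding modulo_nat_def by (intro comp_intros)

lemma computable_set_decode [comp_intros]:
  assumes "computable G" "computable H" shows "computable_pred (\<lambda>x. G x \<in> set_decode (H x))"
proof -
  have "computable_pred (\<lambda>x. (H x div 2 ^ G x) mod 2 = 1)" by (intro comp_intros assms)
  then show ?thesis by (simp add: set_decode_def odd_iff_mod_2_eq_one)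
qed

lemma set_encode_less: "A \<subseteq> {..<n} \<Longrightarrow> set_encode A < 2 ^ n"
proof -
  assume A: "A \<subseteq> {..<n}"
  moreover from A have "finite A" by (rule finite_subset) simp
  ultimately have "set_encode A \<le> set_encode {..<n}"
    by (intro subset_decode_imp_le) simp
  also have "\<dots> < 2 ^ n"
    unfolding set_encode_def by (induction n) (auto simp: lessThan_Suc)
  finally show ?thesis .
qed

lemma decidable_if_computable_pred:
  assumes "computable_pred (\<lambda>n. n \<in> L)" shows "decidable L"
proof -
  from assms obtain f where "\<forall>xs. length xs = 1 \<longrightarrow> eval f xs (of_bool (xs ! 0 \<in> L))"
    unfolding computable_pred_def computable_def rec_fun_def by blast
  then have "eval f [n] (if n \<in> L then 1 else 0)" for n
    by (auto dest: spec[of _ "[n]"] simp: of_bool_def split: if_splits)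
  then show ?thesis unfolding decidable_def by blast
qed

text \<open>
  Course-of-values recursion without recursion: the values below a bound are tabulated in a set
  code, which is searched for. The measure only serves to show that a locally correct table is
  unique.
\<close>

lemma computable_pred_table:
  assumes bd: "computable bd" and D: "computable_pred (\<lambda>z. D (p1 z) (p2 z))"
    and P: "computable_pred (\<lambda>z. P (p1 z) (p1 (p2 z)) (p2 (p2 z)))"
    and step: "\<And>x y T. y < bd x \<Longrightarrow> D y x \<Longrightarrow>
      (\<And>z. z < bd x \<Longrightarrow> D z x \<Longrightarrow> m z < (m y :: nat) \<Longrightarrow> z \<in> set_decode T \<longleftrightarrow> S z x) \<Longrightarrow>
      P T y x \<longleftrightarrow> S y x"
    and k: "computable k" and kbd: "\<And>x. k x < bd x"
  shows "computable_pred (\<lambda>x. D (k x) x \<and> S (k x) x)"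
proof -
  \<comment> \<open>\<open>D\<close> marks the entries about which \<open>step\<close> speaks, such
    as codes of formulas; elsewhere the table may hold anything.\<close>
  have eq: "D (k x) x \<and> S (k x) x \<longleftrightarrow> D (k x) x \<and>
      (\<exists>T<2 ^ bd x. (\<forall>y<bd x. D y x \<longrightarrow> (y \<in> set_decode T \<longleftrightarrow> P T y x)) \<and>
      k x \<in> set_decode T)" (is "_ \<longleftrightarrow> _ \<and> ?R") for x
  proof (rule conj_cong[OF refl], rule iffI)
    assume kD: "D (k x) x"
    assume S: "S (k x) x"
    define T where "T = set_encode {y. y < bd x \<and> S y x}"
    have T: "set_decode T = {y. y < bd x \<and> S y x}" by (simp add: T_def)
    have "T < 2 ^ bd x" unfolding T_def by (rule set_encode_less) auto
    moreover have "y \<in> set_decode T \<longleftrightarrow> P T y x" if "y < bd x" "D y x" for y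
      using step[OF that, of T] that by (simp add: T)
    ultimately show ?R using S kbd[of x] by (intro exI[of _ T]) (simp add: T)
  next
    assume kD: "D (k x) x" and ?R
    then obtain T where T: "\<And>y. y < bd x \<Longrightarrow> D y x \<Longrightarrow> y \<in> set_decode T \<longleftrightarrow> P T y x"
      and k: "k x \<in> set_decode T" by blast
    have "y \<in> set_decode T \<longleftrightarrow> S y x" if "y < bd x" "D y x" for y
      using that
    proof (induction "m y" arbitrary: y rule: less_induct)
      case less
      then show ?case using T[OF less.prems] step[OF less.prems, of T] by blast
    qed
    with k kbd kD show "S (k x) x" by blast
  qed
  have P': "computable_pred (\<lambda>z. P (f z) (g z) (h z))"
    if "computable f" "computable g" "computable h" for f g h
    using computable_pred_comp[OF P, of "\<lambda>z. pr (f z) (pr (g z) (h z))"] that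
    by (simp add: comp_intros)
  have D': "computable_pred (\<lambda>z. D (f z) (g z))" if "computable f" "computable g" for f g
    using computable_pred_comp[OF D, of "\<lambda>z. pr (f z) (g z)"] that by (simp add: comp_intros)
  show ?thesis unfolding eq
    by (intro comp_intros bd computable_comp[OF bd] computable_comp[OF k] P' D')
qed

section \<open>Counting up to a threshold\<close>

text \<open>Infinite sets have to land at the cap: \<open>card\<close> would send them to 0, and
  infinite words do have infinite cells.\<close>

definition capcard :: "nat \<Rightarrow> 'a set \<Rightarrow> nat" where
  "capcard q A = (if finite A then min q (card A) else q)"

text \<open>The answer of the second player in a back-and-forth game. If \<open>B'\<close> exhausted
  \<open>A'\<close>, the capped count would be \<open>card B < q\<close>, hence exact, and
  \<open>B\<close> would exhaust \<open>A\<close>, leaving no room for \<open>x\<close>. It serves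
  both for elements of a cell and for processes of one colour.\<close>

lemma capcard_fresh:
  assumes eq: "capcard q A = capcard q A'" and "finite B'" "B' \<subseteq> A'" and sub: "B \<subseteq> A"
    and c: "card B = card B'" "card B < q" and ne: "x \<in> A - B"
  shows "A' - B' \<noteq> {}"
proof
  assume "A' - B' = {}"
  with assms have "A' = B'" by blast
  with c eq \<open>finite B'\<close> have "finite A" and "min q (card A) = card B"
    by (auto simp: capcard_def split: if_splits)
  with sub c(2) have "card A = card B" by (auto simp: min_def split: if_splits)
  with \<open>finite A\<close> sub have "B = A" by (metis card_subset_eq)
  with ne show False by simp
qed

section \<open>A local criterion for elementary equivalence\<close>

fun qd :: "fm \<Rightarrow> nat" where
  "qd (Neg \<phi>) = qd \<phi>"
| "qd (Conj \<phi> \<psi>) = max (qd \<phi>) (qd \<psi>)"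
| "qd (Disj \<phi> \<psi>) = max (qd \<phi>) (qd \<psi>)"
| "qd (Exists x \<phi>) = Suc (qd \<phi>)"
| "qd (Forall x \<phi>) = Suc (qd \<phi>)"
| "qd _ = 0"

text \<open>
  \<open>gsat D act own PS PE\<close> evaluates formulas in an arbitrary structure with domain \<open>D\<close>: process
  elements are those without an action, and \<open>own\<close> is the process carried by an element.
\<close>

fun gsat :: "'x set \<Rightarrow> ('x \<Rightarrow> nat option) \<Rightarrow> ('x \<Rightarrow> nat) \<Rightarrow> nat set \<Rightarrow> nat set \<Rightarrow> (nat \<Rightarrow> 'x) \<Rightarrow> fm \<Rightarrow> bool" where
  "gsat D act own PS PE v (Act a x) \<longleftrightarrow> act (v x) = Some a"
| "gsat D act own PS PE v (Eq x y) \<longleftrightarrow> v x = v y"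
| "gsat D act own PS PE v (Sim x y) \<longleftrightarrow> own (v x) = own (v y)"
| "gsat D act own PS PE v (SysProc x) \<longleftrightarrow> act (v x) = None \<and> own (v x) \<in> PS"
| "gsat D act own PS PE v (EnvProc x) \<longleftrightarrow> act (v x) = None \<and> own (v x) \<in> PE"
| "gsat D act own PS PE v (SharedProc x) \<longleftrightarrow> False"
| "gsat D act own PS PE v (Neg \<phi>) \<longleftrightarrow> \<not> gsat D act own PS PE v \<phi>"
| "gsat D act own PS PE v (Conj \<phi> \<psi>) \<longleftrightarrow> gsat D act own PS PE v \<phi> \<and> gsat D act own PS PE v \<psi>"
| "gsat D act own PS PE v (Disj \<phi> \<psi>) \<longleftrightarrow> gsat D act own PS PE v \<phi> \<or> gsat D act own PS PE v \<psi>"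
| "gsat D act own PS PE v (Exists x \<phi>) \<longleftrightarrow> (\<exists>e\<in>D. gsat D act own PS PE (v(x := e)) \<phi>)"
| "gsat D act own PS PE v (Forall x \<phi>) \<longleftrightarrow> (\<forall>e\<in>D. gsat D act own PS PE (v(x := e)) \<phi>)"

text \<open>Elements of one cell are interchangeable, so a class of \<open>\<sim>\<close> is
  determined up to isomorphism by the sizes of its cells.\<close>

definition cell :: "'x set \<Rightarrow> ('x \<Rightarrow> nat option) \<Rightarrow> ('x \<Rightarrow> nat) \<Rightarrow> nat option \<Rightarrow> nat \<Rightarrow> 'x set" where
  "cell D act own u p = {e \<in> D. act e = u \<and> own e = p}"

text \<open>
  The colours \<open>\<kappa>\<close> and \<open>\<kappa>'\<close> of processes stand for the isomorphism types, up to the threshold \<open>q\<close>,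
  of their classes.
\<close>

locale similar_structures =
  fixes q :: nat
    and D :: "'x set" and act own PS PE and \<kappa> :: "nat \<Rightarrow> 't"
    and D' :: "'y set" and act' own' PS' PE' and \<kappa>' :: "nat \<Rightarrow> 't"
  assumes own: "own ` D \<subseteq> PS \<union> PE" and own': "own' ` D' \<subseteq> PS' \<union> PE'"
    and disj: "PS \<inter> PE = {}" and disj': "PS' \<inter> PE' = {}"
    and PS: "\<And>t. capcard q {p \<in> PS. \<kappa> p = t} = capcard q {p \<in> PS'. \<kappa>' p = t}"
    and PE: "\<And>t. capcard q {p \<in> PE. \<kappa> p = t} = capcard q {p \<in> PE'. \<kappa>' p = t}"
    and cells: "\<And>p p' u. p \<in> PS \<union> PE \<Longrightarrow> p' \<in> PS' \<union> PE' \<Longrightarrow> \<kappa> p = \<kappa>' p' \<Longrightarrow>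
      capcard q (cell D act own u p) = capcard q (cell D' act' own' u p')"
begin

text \<open>Equality of colours goes beyond the atoms: it ensures that matched classes offer the
  same supply of further elements, up to \<open>q\<close>. Ownership is tested with
  \<open>PS\<close> alone, as disjointness then settles \<open>PE\<close>.\<close>

definition partial_iso :: "nat set \<Rightarrow> (nat \<Rightarrow> 'x) \<Rightarrow> (nat \<Rightarrow> 'y) \<Rightarrow> bool" where
  "partial_iso X v v' \<longleftrightarrow> finite X \<and>
    (\<forall>x\<in>X. v x \<in> D \<and> v' x \<in> D' \<and> act (v x) = act' (v' x) \<and>
      (own (v x) \<in> PS \<longleftrightarrow> own' (v' x) \<in> PS') \<and> \<kappa> (own (v x)) = \<kappa>' (own' (v' x))) \<and>
    (\<forall>x\<in>X. \<forall>y\<in>X. (v x = v y \<longleftrightarrow> v' x = v' y) \<and> (own (v x) = own (v y) \<longleftrightarrow> own' (v' x) = own' (v' y)))"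

end

text \<open>Both images are the quotient of \<open>X\<close> by the common kernel. This makes the
  elements, or processes, already in use equally many on the two sides.\<close>

lemma card_image_eq_iff:
  assumes "finite X" "\<And>x y. x \<in> X \<Longrightarrow> y \<in> X \<Longrightarrow> f x = f y \<longleftrightarrow> g x = g y"
  shows "card (f ` X) = card (g ` X)"
proof -
  define h where "h z = g (SOME x. x \<in> X \<and> f x = z)" for z
  have h: "h (f x) = g x" if "x \<in> X" for x
  proof -
    have "(SOME y. y \<in> X \<and> f y = f x) \<in> X \<and> f (SOME y. y \<in> X \<and> f y = f x) = f x"
      by (rule someI[of _ x]) (use that in simp)
    with assms(2) that show ?thesis unfolding h_def by blast
  qed
  have "inj_on h (f ` X)" using h assms(2) by (auto simp: inj_on_def)
  moreover have "h ` f ` X = g ` X" using h by (force simp: image_iff)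
  ultimately show ?thesis by (metis card_image)
qed

context similar_structures
begin

lemma swap: "similar_structures q D' act' own' PS' PE' \<kappa>' D act own PS PE \<kappa>"
  using own own' disj disj' PS PE cells by unfold_locales (auto simp: Un_iff)

lemma partial_iso_swap:
  "similar_structures.partial_iso D' act' own' PS' \<kappa>' D act own PS \<kappa> X v' v \<longleftrightarrow> partial_iso X v v'"
  unfolding similar_structures.partial_iso_def[OF swap] partial_iso_def
  by (rule conj_cong[OF refl], rule conj_cong; intro ball_cong refl; auto)

lemma extend_class:
  assumes iso: "partial_iso X v v'" and card: "card X < q" and e: "e \<in> D"
    and new: "\<And>x. x \<in> X \<Longrightarrow> v x \<noteq> e"
    and p': "p' \<in> PS' \<union> PE'" "own e \<in> PS \<longleftrightarrow> p' \<in> PS'" "\<kappa> (own e) = \<kappa>' p'"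
    and same: "\<And>x. x \<in> X \<Longrightarrow> own (v x) = own e \<longleftrightarrow> own' (v' x) = p'"
    and X: "x \<notin> X"
  shows "\<exists>e'\<in>D'. partial_iso (insert x X) (v(x := e)) (v'(x := e'))"
proof -
  \<comment> \<open>The played variables in the cell of \<open>e\<close>; by \<open>same\<close>
    they are also those in the corresponding cell of \<open>p'\<close>.\<close>
  define Z where "Z = {y \<in> X. act (v y) = act e \<and> own (v y) = own e}"
  have fin: "finite X" and XD: "\<And>y. y \<in> X \<Longrightarrow> v y \<in> D \<and> v' y \<in> D' \<and> act (v y) = act' (v' y)"
    and inj: "\<And>y z. y \<in> X \<Longrightarrow> z \<in> X \<Longrightarrow> v y = v z \<longleftrightarrow> v' y = v' z"
    using iso by (auto simp: partial_iso_def)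
  have Z': "Z = {y \<in> X. act' (v' y) = act e \<and> own' (v' y) = p'}"
    unfolding Z_def using XD same by auto
  have ZX: "Z \<subseteq> X" unfolding Z_def by blast
  have "cell D' act' own' (act e) p' - v' ` Z \<noteq> {}"
  proof (rule capcard_fresh)
    show "capcard q (cell D act own (act e) (own e)) = capcard q (cell D' act' own' (act e) p')"
      using own e p' by (intro cells) auto
    show "v ` Z \<subseteq> cell D act own (act e) (own e)" using XD by (auto simp: cell_def Z_def)
    show "v' ` Z \<subseteq> cell D' act' own' (act e) p'" using XD by (auto simp: cell_def Z')
    show "finite (v' ` Z)" using fin ZX finite_subset by blast
    show "card (v ` Z) = card (v' ` Z)"
      using fin ZX inj by (intro card_image_eq_iff) (auto dest: finite_subset)
    show "card (v ` Z) < q"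
      using card card_image_le[of Z v] card_mono[OF fin ZX] fin ZX finite_subset[of Z X] by linarith
    show "e \<in> cell D act own (act e) (own e) - v ` Z" using e new ZX by (auto simp: cell_def)
  qed
  then obtain e' where e': "e' \<in> D'" "act' e' = act e" "own' e' = p'" "e' \<notin> v' ` Z"
    by (auto simp: cell_def)
  have ne: "v' y \<noteq> e'" if "y \<in> X" for y
  proof
    assume "v' y = e'"
    with e'(2,3) that have "y \<in> Z" unfolding Z' by simp
    with \<open>v' y = e'\<close> e'(4) show False by blast
  qed
  have s: "own (v y) = own e \<longleftrightarrow> own' (v' y) = own' e'" if "y \<in> X" for y
    unfolding e'(3) by (rule same[OF that])
  then have s': "own e = own (v y) \<longleftrightarrow> own' e' = own' (v' y)" if "y \<in> X" for y
    using that by metis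
  have n: "v y \<noteq> e" "e \<noteq> v y" "v' y \<noteq> e'" "e' \<noteq> v' y" if "y \<in> X" for y
    using new[OF that] ne[OF that] by blast+
  have x: "y \<noteq> x" if "y \<in> X" for y using that X by auto
  have "act e = act' e' \<and> (own e \<in> PS \<longleftrightarrow> own' e' \<in> PS') \<and> \<kappa> (own e) = \<kappa>' (own' e')"
    using e' p' by simp
  with iso e e'(1) have "partial_iso (insert x X) (v(x := e)) (v'(x := e'))"
    unfolding partial_iso_def by (simp add: s s' n x)
  with e'(1) show ?thesis by blast
qed

text \<open>The answer is forced if \<open>e\<close> has been played, lies in the matched class if
  the class of \<open>e\<close> has been touched, and otherwise needs an untouched process of the
  same owner and colour, which the assumptions \<open>PS\<close> and \<open>PE\<close>
  supply.\<close>

lemma extend: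
  assumes iso: "partial_iso X v v'" and card: "card X < q" and e: "e \<in> D" and X: "x \<notin> X"
  shows "\<exists>e'\<in>D'. partial_iso (insert x X) (v(x := e)) (v'(x := e'))"
proof -
  have fin: "finite X" and XD: "\<And>y. y \<in> X \<Longrightarrow> v y \<in> D \<and> v' y \<in> D'"
    and col: "\<And>y. y \<in> X \<Longrightarrow> (own (v y) \<in> PS \<longleftrightarrow> own' (v' y) \<in> PS') \<and> \<kappa> (own (v y)) = \<kappa>' (own' (v' y))"
    and inj: "\<And>y z. y \<in> X \<Longrightarrow> z \<in> X \<Longrightarrow> own (v y) = own (v z) \<longleftrightarrow> own' (v' y) = own' (v' z)"
    using iso by (auto simp: partial_iso_def)
  consider (old) y where "y \<in> X" "v y = e" | (cls) y where "y \<in> X" "own (v y) = own e" "\<forall>z\<in>X. v z \<noteq> e"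
    | (new) "\<forall>z\<in>X. own (v z) \<noteq> own e" by metis
  then show ?thesis
  proof cases
    case old
    then have "partial_iso (insert x X) (v(x := e)) (v'(x := v' y))"
      using iso X unfolding partial_iso_def by (auto split: if_splits)
    with old XD show ?thesis by blast
  next
    case cls
    show ?thesis
    proof (rule extend_class[OF iso card e _ _ _ _ _ X])
      show "own' (v' y) \<in> PS' \<union> PE'" using own' XD cls(1) by blast
    qed (use cls col inj in \<open>auto, (metis)+\<close>)
  next
    case new
    define R R' where "R = (if own e \<in> PS then PS else PE)" and "R' = (if own e \<in> PS then PS' else PE')"
    have R: "own e \<in> R" "R' \<subseteq> PS' \<union> PE'" using own e by (auto simp: R_def R'_def)
    \<comment> \<open>The variables whose processes compete with \<open>own e\<close>. They occupy
      fewer than \<open>q\<close> processes.\<close>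
    define Z where "Z = {y \<in> X. own (v y) \<in> R \<and> \<kappa> (own (v y)) = \<kappa> (own e)}"
    have Z': "Z = {y \<in> X. own' (v' y) \<in> R' \<and> \<kappa>' (own' (v' y)) = \<kappa> (own e)}"
    proof -
      have "own (v y) \<in> R \<longleftrightarrow> own' (v' y) \<in> R'" if "y \<in> X" for y
        using own own' disj disj' XD[OF that] col[OF that] unfolding R_def R'_def by auto
      with col show ?thesis unfolding Z_def by auto
    qed
    have ZX: "Z \<subseteq> X" unfolding Z_def by blast
    have "{p \<in> R'. \<kappa>' p = \<kappa> (own e)} - (\<lambda>y. own' (v' y)) ` Z \<noteq> {}"
    proof (rule capcard_fresh)
      show "capcard q {p \<in> R. \<kappa> p = \<kappa> (own e)} = capcard q {p \<in> R'. \<kappa>' p = \<kappa> (own e)}"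
        using PS PE by (simp add: R_def R'_def)
      show "(\<lambda>y. own (v y)) ` Z \<subseteq> {p \<in> R. \<kappa> p = \<kappa> (own e)}" by (auto simp: Z_def)
      show "(\<lambda>y. own' (v' y)) ` Z \<subseteq> {p \<in> R'. \<kappa>' p = \<kappa> (own e)}" by (auto simp: Z')
      show "finite ((\<lambda>y. own' (v' y)) ` Z)" using fin ZX finite_subset by blast
      show "card ((\<lambda>y. own (v y)) ` Z) = card ((\<lambda>y. own' (v' y)) ` Z)"
        using fin ZX inj by (intro card_image_eq_iff) (auto dest: finite_subset)
      show "card ((\<lambda>y. own (v y)) ` Z) < q"
        using card card_image_le[of Z "\<lambda>y. own (v y)"] card_mono[OF fin ZX] fin ZX
          finite_subset[of Z X] by linarith
      show "own e \<in> {p \<in> R. \<kappa> p = \<kappa> (own e)} - (\<lambda>y. own (v y)) ` Z"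
        using R new ZX by auto
    qed
    then obtain p' where p': "p' \<in> R'" "\<kappa>' p' = \<kappa> (own e)" "p' \<notin> (\<lambda>y. own' (v' y)) ` Z" by blast
    show ?thesis
    proof (rule extend_class[OF iso card e _ _ _ _ _ X])
      show "p' \<in> PS' \<union> PE'" using p' R by blast
      show "own e \<in> PS \<longleftrightarrow> p' \<in> PS'" using p' disj' unfolding R'_def by (auto split: if_splits)
      show "own (v y) = own e \<longleftrightarrow> own' (v' y) = p'" if "y \<in> X" for y
        using new p' that by (auto simp: Z')
    qed (use new p' in auto)
  qed
qed

lemma partial_iso_subset: "partial_iso X v v' \<Longrightarrow> Y \<subseteq> X \<Longrightarrow> partial_iso Y v v'"
  unfolding partial_iso_def by (blast intro: finite_subset)

text \<open>The bound on \<open>card X + qd \<phi>\<close> trades quantifiers still to come for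
  elements already played, so \<open>extend\<close> always finds fewer than \<open>q\<close> in
  play.\<close>

lemma gsat_iff_aux:
  "partial_iso X v v' \<Longrightarrow> free_vars \<phi> \<subseteq> X \<Longrightarrow> card X + qd \<phi> \<le> q \<Longrightarrow>
    gsat D act own PS PE v \<phi> \<longleftrightarrow> gsat D' act' own' PS' PE' v' \<phi>"
proof (induction \<phi> arbitrary: X v v')
  case (EnvProc x)
  have "own (v x) \<in> PE \<longleftrightarrow> own' (v' x) \<in> PE'" if "own (v x) \<in> PS \<longleftrightarrow> own' (v' x) \<in> PS'"
      "v x \<in> D" "v' x \<in> D'"
    using that own own' disj disj' by auto
  with EnvProc show ?case by (auto simp: partial_iso_def)
next
  case (Exists x \<phi>)
  \<comment> \<open>The old value of \<open>x\<close> is forgotten before a new one is chosen,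
    because \<open>extend\<close> asks for a fresh variable.\<close>
  let ?Y = "X - {x}"
  have Y: "partial_iso ?Y v v'" "card ?Y < q"
    using Exists.prems partial_iso_subset[of X v v' ?Y] card_Diff1_le[of X x] by auto
  interpret sw: similar_structures q D' act' own' PS' PE' \<kappa>' D act own PS PE \<kappa> by (rule swap)
  have IH: "gsat D act own PS PE (v(x := e)) \<phi> \<longleftrightarrow> gsat D' act' own' PS' PE' (v'(x := e')) \<phi>"
    if "partial_iso (insert x ?Y) (v(x := e)) (v'(x := e'))" for e e'
  proof (rule Exists.IH[OF that])
    have "finite X" using Exists.prems(1) by (simp add: partial_iso_def)
    then have "card (insert x ?Y) \<le> Suc (card X)" by (simp add: card_insert_if card_Diff1_le le_SucI)
    with Exists.prems(3) show "card (insert x ?Y) + qd \<phi> \<le> q" by simp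
  qed (use Exists.prems(2) in auto)
  have "\<exists>e'\<in>D'. partial_iso (insert x ?Y) (v(x := e)) (v'(x := e'))" if "e \<in> D" for e
    by (rule extend[OF Y that]) simp
  moreover have "\<exists>e\<in>D. partial_iso (insert x ?Y) (v(x := e)) (v'(x := e'))" if "e' \<in> D'" for e'
    using sw.extend[of ?Y v' v e' x] Y that by (simp add: partial_iso_swap)
  ultimately show ?case using IH by (simp, blast)
next
  case (Forall x \<phi>)
  let ?Y = "X - {x}"
  have Y: "partial_iso ?Y v v'" "card ?Y < q"
    using Forall.prems partial_iso_subset[of X v v' ?Y] card_Diff1_le[of X x] by auto
  interpret sw: similar_structures q D' act' own' PS' PE' \<kappa>' D act own PS PE \<kappa> by (rule swap)
  have IH: "gsat D act own PS PE (v(x := e)) \<phi> \<longleftrightarrow> gsat D' act' own' PS' PE' (v'(x := e')) \<phi>"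
    if "partial_iso (insert x ?Y) (v(x := e)) (v'(x := e'))" for e e'
  proof (rule Forall.IH[OF that])
    have "finite X" using Forall.prems(1) by (simp add: partial_iso_def)
    then have "card (insert x ?Y) \<le> Suc (card X)" by (simp add: card_insert_if card_Diff1_le le_SucI)
    with Forall.prems(3) show "card (insert x ?Y) + qd \<phi> \<le> q" by simp
  qed (use Forall.prems(2) in auto)
  have "\<exists>e'\<in>D'. partial_iso (insert x ?Y) (v(x := e)) (v'(x := e'))" if "e \<in> D" for e
    by (rule extend[OF Y that]) simp
  moreover have "\<exists>e\<in>D. partial_iso (insert x ?Y) (v(x := e)) (v'(x := e'))" if "e' \<in> D'" for e'
    using sw.extend[of ?Y v' v e' x] Y that by (simp add: partial_iso_swap)
  ultimately show ?case using IH by (simp, blast)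
next
  case (Neg \<phi>)
  then show ?case by simp
next
  case (Conj \<phi> \<psi>)
  then show ?case by simp
next
  case (Disj \<phi> \<psi>)
  then show ?case by simp
qed (simp_all add: partial_iso_def)

theorem gsat_iff:
  assumes "free_vars \<phi> = {}" "qd \<phi> \<le> q"
  shows "gsat D act own PS PE v \<phi> \<longleftrightarrow> gsat D' act' own' PS' PE' v' \<phi>"
  by (rule gsat_iff_aux[of "{}"]) (use assms in \<open>auto simp: partial_iso_def\<close>)

end

section \<open>Token games\<close>

lemma capcard_mono_threshold:
  assumes "capcard T A = capcard T B" "K \<le> T" shows "capcard K A = capcard K B"
  using assms by (auto simp: capcard_def min_def split: if_splits)

lemma min_sum_cong:
  fixes f g :: "'a \<Rightarrow> nat"
  assumes "finite I" "\<And>i. i \<in> I \<Longrightarrow> min T (f i) = min T (g i)"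
  shows "min T (sum f I) = min T (sum g I)"
  using assms
proof (induction I rule: finite_induct)
  case (insert x F)
  then have "min T (f x) = min T (g x)" "min T (sum f F) = min T (sum g F)" by auto
  with insert.hyps show ?case by (auto simp: min_def split: if_splits)
qed simp

text \<open>A sum whose terms are known up to \<open>T\<close> is known up to \<open>T\<close>. This
  glues together the moves that \<open>matching_move\<close> builds separately for each starting
  location.\<close>

lemma capcard_fibres_cong:
  assumes fin: "finite A" "finite A'"
    and "\<And>t. capcard T {a \<in> A. f a = t \<and> P a} = capcard T {a \<in> A'. f' a = t \<and> P' a}"
  shows "capcard T {a \<in> A. P a} = capcard T {a \<in> A'. P' a}"
proof -
  let ?I = "f ` A \<union> f' ` A'"
  have split: "card {b \<in> B. Q b} = (\<Sum>t\<in>?I. card {b \<in> B. h b = t \<and> Q b})"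
    if "finite B" "h ` B \<subseteq> ?I" for B :: "'z set" and h Q
  proof -
    have "{b \<in> B. Q b} = (\<Union>t\<in>?I. {b \<in> B. h b = t \<and> Q b})" using that by auto
    then show ?thesis using fin that(1) by (simp add: card_UN_disjoint[symmetric] disjoint_iff)
  qed
  have "min T (\<Sum>t\<in>?I. card {a \<in> A. f a = t \<and> P a}) = min T (\<Sum>t\<in>?I. card {a \<in> A'. f' a = t \<and> P' a})"
    by (rule min_sum_cong) (use assms in \<open>auto simp: capcard_def\<close>)
  moreover have "card {a \<in> A. P a} = (\<Sum>t\<in>?I. card {a \<in> A. f a = t \<and> P a})"
    by (rule split) (use fin in auto)
  moreover have "card {a \<in> A'. P' a} = (\<Sum>t\<in>?I. card {a \<in> A'. f' a = t \<and> P' a})"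
    by (rule split) (use fin in auto)
  ultimately show ?thesis using fin by (simp add: capcard_def)
qed

text \<open>If the sets are equinumerous, \<open>f\<close> is carried along a bijection. Otherwise
  both have at least \<open>card L * T\<close> elements, so by pigeonhole some \<open>m0\<close>
  receives at least \<open>T\<close> elements of \<open>A\<close>. From each location up to
  \<open>T\<close> representatives are embedded into \<open>A'\<close>, which has room for them, and
  the rest of \<open>A'\<close> goes to \<open>m0\<close>. That only locations used by
  \<open>f\<close> are used again is what later makes the copied move an upward one.\<close>

lemma spread:
  fixes A :: "'a set" and A' :: "'b set" and f :: "'a \<Rightarrow> 'l"
  assumes fin: "finite A" "finite A'" "finite L" and L: "L \<noteq> {}" and f: "f ` A \<subseteq> L"
    and card: "capcard (card L * T) A = capcard (card L * T) A'" and T: "0 < T"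
  obtains f' where "f' ` A' \<subseteq> f ` A"
    "\<And>m. capcard T {a \<in> A. f a = m} = capcard T {a \<in> A'. f' a = m}"
proof (cases "card A = card A'")
  case True
  then obtain h where h: "bij_betw h A' A" using fin finite_same_card_bij by metis
  have "card {a \<in> A'. f (h a) = m} = card {a \<in> A. f a = m}" for m
  proof (rule bij_betw_same_card)
    show "bij_betw h {a \<in> A'. f (h a) = m} {a \<in> A. f a = m}"
      using h by (auto simp: bij_betw_def inj_on_def)
  qed
  then show ?thesis using h fin by (intro that[of "f \<circ> h"]) (auto simp: capcard_def bij_betw_def)
next
  case False
  with card fin have big: "card L * T \<le> card A" "card L * T \<le> card A'"
    by (auto simp: capcard_def)
  have "\<exists>m\<in>L. T \<le> card {a \<in> A. f a = m}"
  proof (rule ccontr)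
    assume "\<not> ?thesis"
    then have "card {a \<in> A. f a = m} < T" if "m \<in> L" for m using that by auto
    then have "(\<Sum>m\<in>L. card {a \<in> A. f a = m}) < (\<Sum>m\<in>L. T)"
      using fin L by (intro sum_strict_mono)
    moreover have "(\<Union>m\<in>L. {a \<in> A. f a = m}) = A" using f by auto
    then have "card A = (\<Sum>m\<in>L. card {a \<in> A. f a = m})"
      using fin by (subst card_UN_disjoint[symmetric]) auto
    ultimately show False using big by simp
  qed
  then obtain m0 where m0: "m0 \<in> L" "T \<le> card {a \<in> A. f a = m0}" by blast
  have "\<exists>B\<subseteq>{a \<in> A. f a = m}. card B = min T (card {a \<in> A. f a = m})" for m
    by (meson obtain_subset_with_card_n min.cobounded2)
  then obtain B where B: "\<And>m. B m \<subseteq> {a \<in> A. f a = m}"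
      "\<And>m. card (B m) = min T (card {a \<in> A. f a = m})"
    by metis
  define BB where "BB = (\<Union>m\<in>L. B m)"
  have BBA: "BB \<subseteq> A" using B unfolding BB_def by blast
  have finBB: "finite BB" using BBA fin finite_subset by blast
  have "card BB \<le> (\<Sum>m\<in>L. card (B m))" unfolding BB_def by (rule card_UN_le) (rule fin)
  also have "\<dots> \<le> card L * T" using sum_bounded_above[of L "\<lambda>m. card (B m)" T] B by simp
  finally have "card BB \<le> card A'" using big by simp
  then obtain g where g: "g ` BB \<subseteq> A'" "inj_on g BB" using card_le_inj finBB fin(2) by metis
  \<comment> \<open>\<open>m0\<close> is the default location: its count is at least
    \<open>T\<close> on both sides, so the extra elements are not seen there.\<close>
  define f' where "f' b = (if b \<in> g ` BB then f (inv_into BB g b) else m0)" for b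
  have f'g: "f' (g a) = f a" if "a \<in> BB" for a using that g(2) by (simp add: f'_def)
  have cgB: "card (g ` B m) = card (B m)" if "m \<in> L" for m
    using g(2) that by (intro card_image) (auto simp: BB_def inj_on_def)
  show ?thesis
  proof (rule that[of f'])
    have "\<exists>a\<in>A. f a = m0"
    proof (rule ccontr)
      assume "\<not> ?thesis"
      then have "{a \<in> A. f a = m0} = {}" by blast
      with m0 T show False by (metis card.empty not_le)
    qed
    then have "m0 \<in> f ` A" by blast
    then show sub: "f' ` A' \<subseteq> f ` A" using BBA g(2) unfolding f'_def by auto
    show "capcard T {a \<in> A. f a = m} = capcard T {a \<in> A'. f' a = m}" for m
    proof (cases "m \<in> L")
      case mL: True
      show ?thesis
      proof (cases "m = m0")
        case True
        have "g ` B m0 \<subseteq> {a \<in> A'. f' a = m0}"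
        proof (clarify, rule conjI)
          fix a assume "a \<in> B m0"
          then have "a \<in> BB" "f a = m0" using B(1) m0(1) unfolding BB_def by blast+
          then show "g a \<in> A'" "f' (g a) = m0" using g(1) f'g by auto
        qed
        then have "card (B m0) \<le> card {a \<in> A'. f' a = m0}"
          using cgB[OF m0(1)] card_mono[of "{a \<in> A'. f' a = m0}" "g ` B m0"] fin by simp
        with B(2)[of m0] m0 True fin show ?thesis by (simp add: capcard_def)
      next
        case False
        have "{a \<in> A'. f' a = m} = g ` B m"
        proof (intro equalityI subsetI)
          fix b assume "b \<in> {a \<in> A'. f' a = m}"
          with False have "b \<in> g ` BB" and m: "f' b = m" by (auto simp: f'_def split: if_splits)
          then obtain a m' where a: "b = g a" "m' \<in> L" "a \<in> B m'" unfolding BB_def by blast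
          then have "a \<in> BB" "f a = m'" using B(1) unfolding BB_def by blast+
          with f'g a m show "b \<in> g ` B m" by auto
        next
          fix b assume "b \<in> g ` B m"
          then obtain a where a: "b = g a" "a \<in> B m" by blast
          then have "a \<in> BB" "f a = m" using B(1) mL unfolding BB_def by blast+
          with a g(1) f'g show "b \<in> {a \<in> A'. f' a = m}" by auto
        qed
        moreover have "finite (B m)" using finite_subset[OF B(1)[of m]] fin by simp
        ultimately show ?thesis using cgB[OF mL] B(2)[of m] fin by (simp add: capcard_def)
      qed
    next
      case False
      then have "{a \<in> A. f a = m} = {}" "{a \<in> A'. f' a = m} = {}"
        using f subset_trans[OF sub f] by auto
      then show ?thesis by (simp only: capcard_def finite.emptyI card.empty)
    qed
  qed
qed

definition move :: "'l::order set \<Rightarrow> nat set \<Rightarrow> (nat \<Rightarrow> 'l) \<Rightarrow> (nat \<Rightarrow> 'l) \<Rightarrow> bool" where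
  "move L P c d \<longleftrightarrow> (\<forall>p\<in>P. c p \<le> d p \<and> d p \<in> L) \<and> (\<forall>p. p \<notin> P \<longrightarrow> d p = c p)"

text \<open>Tokens that start together are redistributed by \<open>spread\<close>. The copied move
  goes upwards because each of its targets was reached by a token of \<open>P\<close> from the same
  location. The price is a factor \<open>card L\<close> of the threshold.\<close>

lemma matching_move:
  assumes fin: "finite P" "finite P'" "finite L" and L: "L \<noteq> {}" and T: "0 < T"
    and eq: "\<And>t. capcard (card L * T) {p \<in> P. c p = t} = capcard (card L * T) {p \<in> P'. c' p = t}"
    and mv: "move L P c d"
  obtains d' where "move L P' c' d'" "\<And>t. capcard T {p \<in> P. d p = t} = capcard T {p \<in> P'. d' p = t}"
proof -
  define R where "R t f' \<longleftrightarrow> f' ` {p \<in> P'. c' p = t} \<subseteq> d ` {p \<in> P. c p = t} \<and>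
    (\<forall>m. capcard T {a \<in> {p \<in> P. c p = t}. d a = m} = capcard T {a \<in> {p \<in> P'. c' p = t}. f' a = m})"
    for t f'
  have "\<exists>f'. R t f'" for t
  proof -
    have *: "finite {p \<in> P. c p = t}" "finite {p \<in> P'. c' p = t}" "d ` {p \<in> P. c p = t} \<subseteq> L"
      using fin mv by (auto simp: move_def)
    obtain f'
      where "f' ` {p \<in> P'. c' p = t} \<subseteq> d ` {p \<in> P. c p = t}"
        "\<And>m. capcard T {a \<in> {p \<in> P. c p = t}. d a = m} =
          capcard T {a \<in> {p \<in> P'. c' p = t}. f' a = m}"
      using spread[OF *(1,2) fin(3) L *(3) eq T] by blast
    then have "R t f'" unfolding R_def by (intro conjI allI)
    then show ?thesis by blast
  qed
  then obtain f where "\<And>t. R t (f t)" by metis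
  then have f: "f t ` {p \<in> P'. c' p = t} \<subseteq> d ` {p \<in> P. c p = t}"
    "capcard T {a \<in> {p \<in> P. c p = t}. d a = m} = capcard T {a \<in> {p \<in> P'. c' p = t}. f t a = m}"
    for t m unfolding R_def by simp_all
  define d' where "d' p = (if p \<in> P' then f (c' p) p else c' p)" for p
  show ?thesis
  proof (rule that[of d'])
    have "c' p \<le> d' p \<and> d' p \<in> L" if "p \<in> P'" for p
    proof -
      have "f (c' p) p \<in> d ` {r \<in> P. c r = c' p}" using f(1)[of "c' p"] that by auto
      with mv that show ?thesis by (auto simp: d'_def move_def)
    qed
    then show "move L P' c' d'" by (auto simp: move_def d'_def)
    show "capcard T {p \<in> P. d p = t} = capcard T {p \<in> P'. d' p = t}" for t
    proof (rule capcard_fibres_cong[OF fin(1,2)])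
      show "capcard T {a \<in> P. c a = s \<and> d a = t} = capcard T {a \<in> P'. c' a = s \<and> d' a = t}" for s
      proof -
        have "{a \<in> P'. c' a = s \<and> d' a = t} = {a \<in> {p \<in> P'. c' p = s}. f s a = t}"
          by (auto simp: d'_def)
        moreover have "{a \<in> P. c a = s \<and> d a = t} = {a \<in> {p \<in> P. c p = s}. d a = t}" by auto
        ultimately show ?thesis using f(2)[of s t] by simp
      qed
    qed
  qed
qed

text \<open>
  In a token game every player owns a set of tokens and only ever moves them upwards. A round is a
  batch of moves of System, after which \<open>G\<close> must hold, followed by a nonempty batch of moves of
  Environment; the game ends when Environment stops moving. \<open>G\<close> only sees how many tokens are on
  each location, up to the threshold \<open>K\<close>.
\<close>

locale token_game =
  fixes LS LE :: "'l::order set" and rk :: "'l \<Rightarrow> nat" and K :: nat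
    and G :: "nat set \<Rightarrow> nat set \<Rightarrow> (nat \<Rightarrow> 'l) \<Rightarrow> bool"
  assumes finite_LS: "finite LS" and finite_LE: "finite LE" and LS_nonempty: "LS \<noteq> {}"
    and rk: "x \<in> LE \<Longrightarrow> y \<in> LE \<Longrightarrow> x < y \<Longrightarrow> rk y < rk x" and K: "0 < K"
    and G_cong: "PS \<inter> PE = {} \<Longrightarrow> PS' \<inter> PE' = {} \<Longrightarrow>
      (\<And>t. capcard K {p \<in> PS. c p = t} = capcard K {p \<in> PS'. c' p = t}) \<Longrightarrow>
      (\<And>t. capcard K {p \<in> PE. c p = t} = capcard K {p \<in> PE'. c' p = t}) \<Longrightarrow>
      G PS PE c \<Longrightarrow> G PS' PE' c'"
begin

text \<open>\<open>c\<close> is a position with System to move. \<open>G\<close> is asked after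
  every System batch, since Environment may stop there. A least fixed point is adequate because
  proper Environment moves lower the total rank of finitely many tokens in \<open>LE\<close>, see
  \<open>rk_less_if_move\<close>.\<close>

inductive wins :: "nat set \<Rightarrow> nat set \<Rightarrow> (nat \<Rightarrow> 'l) \<Rightarrow> bool" for PS PE where
  winsI: "move LS PS c d \<Longrightarrow> G PS PE d \<Longrightarrow> (\<And>e. move LE PE d e \<Longrightarrow> e \<noteq> d \<Longrightarrow> wins PS PE e) \<Longrightarrow>
    wins PS PE c"

lemma rk_less_if_move:
  assumes "move LE PE d e" "e \<noteq> d" "finite PE" "d ` PE \<subseteq> LE"
  shows "(\<Sum>p\<in>PE. rk (e p)) < (\<Sum>p\<in>PE. rk (d p))"
proof (rule sum_strict_mono_ex1)
  have *: "d p \<le> e p \<and> d p \<in> LE \<and> e p \<in> LE" if "p \<in> PE" for p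
    using assms that by (auto simp: move_def)
  then show "\<forall>p\<in>PE. rk (e p) \<le> rk (d p)" by (metis rk le_less order_refl)
  from assms(1,2) obtain p where "p \<in> PE" "d p \<noteq> e p" unfolding move_def by (metis ext)
  with * show "\<exists>p\<in>PE. rk (e p) < rk (d p)" by (metis rk le_less)
qed (rule assms(3))

text \<open>\<open>r\<close> bounds the total rank of Environment's tokens, hence the rounds to
  come. Each of at most \<open>Suc r\<close> System batches costs a factor \<open>card LS\<close>,
  and \<open>K\<close> must be left at the end for \<open>G_cong\<close>; this is the origin of the
  threshold. Environment's tokens are matched one to one by \<open>\<pi>\<close>.\<close>

lemma wins_many_system_tokens:
  assumes "wins PS PE c" and "finite PS" "finite PS'" "finite PE" "finite PE'"
    and "PS \<inter> PE = {}" "PS' \<inter> PE' = {}" and "bij_betw \<pi> PE PE'"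
    and "\<forall>p\<in>PE. c' (\<pi> p) = c p" "c ` PE \<subseteq> LE" "(\<Sum>p\<in>PE. rk (c p)) \<le> r"
    and "\<And>t. capcard (card LS ^ Suc r * K) {p \<in> PS. c p = t} =
      capcard (card LS ^ Suc r * K) {p \<in> PS'. c' p = t}"
  shows "wins PS' PE' c'"
  using assms
proof (induction arbitrary: c' r rule: wins.induct)
  case (winsI c d)
  note prems = winsI.prems
  have pos: "0 < card LS" using finite_LS LS_nonempty by (simp add: card_gt_0_iff)
  define T where "T = card LS ^ r * K"
  have "K \<le> T" using pos by (simp add: T_def)
  have "0 < T" using K pos by (simp add: T_def)
  moreover have "card LS ^ Suc r * K = card LS * T" by (simp add: T_def)
  ultimately obtain d' where d': "move LS PS' c' d'"
      "\<And>t. capcard T {p \<in> PS. d p = t} = capcard T {p \<in> PS'. d' p = t}"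
    using matching_move[OF prems(1,2) finite_LS LS_nonempty _ prems(11)[unfolded \<open>card LS ^ Suc r * K = card LS * T\<close>] winsI.hyps(1)]
    by metis
  have dc: "d p = c p" if "p \<in> PE" for p using that prems(5) winsI.hyps(1) by (auto simp: move_def)
  have \<pi>: "\<pi> p \<in> PE'" if "p \<in> PE" for p using that prems(7) by (auto simp: bij_betw_def)
  have dc': "d' (\<pi> p) = d p" if "p \<in> PE" for p
    using that \<pi>[OF that] prems(6,8) d'(1) dc[OF that] by (auto simp: move_def)
  have pull: "capcard K {p \<in> PE. h p = t} = capcard K {p \<in> PE'. h' p = t}"
    if "\<forall>p\<in>PE. h' (\<pi> p) = h p" for h h' t
  proof -
    have "bij_betw \<pi> {p \<in> PE. h p = t} {p \<in> PE'. h' p = t}"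
      using that prems(7) by (auto simp: bij_betw_def inj_on_def)
    from bij_betw_same_card[OF this] show ?thesis using prems(3,4) by (simp add: capcard_def)
  qed
  show ?case
  proof (rule wins.winsI[OF d'(1)])
    show "G PS' PE' d'"
      by (rule G_cong[OF prems(5,6) _ pull winsI.hyps(2)])
        (use d'(2) \<open>K \<le> T\<close> dc' capcard_mono_threshold in blast)+
    fix e' assume e': "move LE PE' d' e'" "e' \<noteq> d'"
    \<comment> \<open>A move of Environment in the copy is pulled back along \<open>\<pi>\<close>,
      where the winning premise answers it.\<close>
    define e where "e p = (if p \<in> PE then e' (\<pi> p) else d p)" for p
    have e: "move LE PE d e" using e'(1) \<pi> dc' by (fastforce simp: move_def e_def)
    from e' obtain p' where "p' \<in> PE'" "e' p' \<noteq> d' p'" unfolding move_def by (metis ext)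
    with prems(7) obtain p where "p \<in> PE" "p' = \<pi> p" by (auto simp: bij_betw_def)
    with \<open>e' p' \<noteq> d' p'\<close> dc' have "e p \<noteq> d p" by (simp add: e_def)
    then have "e \<noteq> d" by blast
    have LE: "d ` PE \<subseteq> LE" using prems(9) dc by auto
    have "(\<Sum>p\<in>PE. rk (e p)) < (\<Sum>p\<in>PE. rk (d p))"
      by (rule rk_less_if_move[OF e \<open>e \<noteq> d\<close> prems(3) LE])
    also have "\<dots> \<le> r" using prems(10) dc by simp
    \<comment> \<open>The drop in rank pays for the lost factor: \<open>T\<close> is exactly the
      threshold that belongs to \<open>r'\<close>.\<close>
    finally obtain r' where r': "r = Suc r'" "(\<Sum>p\<in>PE. rk (e p)) \<le> r'" by (cases r) auto
    show "wins PS' PE' e'"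
    proof (rule winsI.IH[OF e \<open>e \<noteq> d\<close> prems(1-7) _ _ r'(2)])
      show "\<forall>p\<in>PE. e' (\<pi> p) = e p" by (simp add: e_def)
      show "e ` PE \<subseteq> LE" using e by (auto simp: move_def)
      have "{p \<in> PS. e p = t} = {p \<in> PS. d p = t}" "{p \<in> PS'. e' p = t} = {p \<in> PS'. d' p = t}" for t
        using e e'(1) prems(5,6) by (auto simp: move_def)
      then show "capcard (card LS ^ Suc r' * K) {p \<in> PS. e p = t} =
          capcard (card LS ^ Suc r' * K) {p \<in> PS'. e' p = t}" for t
        using d'(2)[of t] by (simp add: T_def r')
    qed
  qed
qed

text \<open>
  Environment simulates the game with fewer tokens by letting its surplus tokens follow the crowd:
  they sit on a location \<open>x\<close> with at least \<open>K\<close> other tokens, and above \<open>x\<close> there are enough tokens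
  for a next such location to exist when \<open>x\<close> is deserted.
\<close>

lemma crowd:
  assumes "finite PE" "e ` PE \<subseteq> LE" "x \<in> LE" "K * Suc (card LE) ^ rk x \<le> card {p \<in> PE. x \<le> e p}"
  obtains y where "y \<in> LE" "x \<le> y" "K \<le> card {p \<in> PE. e p = y}"
    "K * Suc (card LE) ^ rk y \<le> card {p \<in> PE. y \<le> e p}"
proof (cases "K \<le> card {p \<in> PE. e p = x}")
  case True
  with that assms show ?thesis by blast
next
  case False
  have "{p \<in> PE. x \<le> e p} = {p \<in> PE. e p = x} \<union> (\<Union>y\<in>{y \<in> LE. x < y}. {p \<in> PE. e p = y})"
    using assms(2) by auto
  then have "card {p \<in> PE. x \<le> e p} \<le> card {p \<in> PE. e p = x} + card (\<Union>y\<in>{y \<in> LE. x < y}. {p \<in> PE. e p = y})"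
    by (simp only: card_Un_le)
  also have "card (\<Union>y\<in>{y \<in> LE. x < y}. {p \<in> PE. e p = y}) \<le> (\<Sum>y\<in>{y \<in> LE. x < y}. card {p \<in> PE. e p = y})"
    by (rule card_UN_le) (simp add: finite_LE)
  finally have le: "K * Suc (card LE) ^ rk x < K + (\<Sum>y\<in>{y \<in> LE. x < y}. card {p \<in> PE. e p = y})"
    using False assms(4) by linarith
  \<comment> \<open>With fewer than \<open>K\<close> tokens on \<open>x\<close>, the others sit
    strictly above it, and some location there holds the share that belongs to rank
    \<open>rk x - 1\<close>.\<close>
  have "\<exists>y\<in>{y \<in> LE. x < y}. K * Suc (card LE) ^ (rk x - 1) \<le> card {p \<in> PE. e p = y}"
  proof (rule ccontr)
    let ?B = "K * Suc (card LE) ^ (rk x - 1)"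
    assume "\<not> ?thesis"
    then have "card {p \<in> PE. e p = y} \<le> ?B" if "y \<in> {y \<in> LE. x < y}" for y
      using that by force
    then have "(\<Sum>y\<in>{y \<in> LE. x < y}. card {p \<in> PE. e p = y}) \<le> card {y \<in> LE. x < y} * ?B"
      using sum_bounded_above[of "{y \<in> LE. x < y}" _ ?B] by simp
    also have "\<dots> \<le> card LE * ?B" by (intro mult_right_mono card_mono) (auto simp: finite_LE)
    finally have s: "(\<Sum>y\<in>{y \<in> LE. x < y}. card {p \<in> PE. e p = y}) \<le> card LE * ?B" .
    show False
    proof (cases "rk x")
      case 0
      then have "{y \<in> LE. x < y} = {}" using rk[OF assms(3)] by auto
      with le show False by simp
    next
      case (Suc r)
      \<comment> \<open>The recurrence behind the bound: one share \<open>?B\<close> outweighs the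
        tokens left on \<open>x\<close>, and \<open>card LE\<close> shares those on the locations
        above.\<close>
      have "K * Suc (card LE) ^ rk x = ?B + card LE * ?B" by (simp add: Suc algebra_simps)
      moreover have "K \<le> ?B" by simp
      ultimately show False using le s by linarith
    qed
  qed
  then obtain y where y: "y \<in> LE" "x < y" "K * Suc (card LE) ^ (rk x - 1) \<le> card {p \<in> PE. e p = y}"
    by blast
  have "K * Suc (card LE) ^ rk y \<le> K * Suc (card LE) ^ (rk x - 1)"
    using rk[OF assms(3) y(1,2)] by (intro mult_left_mono power_increasing) auto
  also note y(3)
  finally have b: "K * Suc (card LE) ^ rk y \<le> card {p \<in> PE. e p = y}" .
  moreover have "card {p \<in> PE. e p = y} \<le> card {p \<in> PE. y \<le> e p}"
    using assms(1) by (intro card_mono) auto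
  moreover have "K \<le> K * Suc (card LE) ^ rk y" by simp
  ultimately have "K \<le> card {p \<in> PE. e p = y}" "K * Suc (card LE) ^ rk y \<le> card {p \<in> PE. y \<le> e p}"
    by linarith+
  then show ?thesis using y(1,2) by (intro that[of y]) simp_all
qed

lemma wins_fewer_environment_tokens:
  assumes "wins PS PE' c'" and "finite PE'" "PS \<inter> PE' = {}" "PE \<subseteq> PE'"
    and "\<forall>p\<in>PS \<union> PE. c p = c' p" "c ` PE \<subseteq> LE" "\<forall>p\<in>PE' - PE. c' p = x" "x \<in> LE"
    and "K \<le> card {p \<in> PE. c p = x}" "K * Suc (card LE) ^ rk x \<le> card {p \<in> PE. x \<le> c p}"
  shows "wins PS PE c"
  using assms
proof (induction arbitrary: c x rule: wins.induct)
  case (winsI c' d')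
  note prems = winsI.prems
  define d where "d p = (if p \<in> PS then d' p else c p)" for p
  have mv: "move LS PS c d" using winsI.hyps(1) prems(4) by (auto simp: move_def d_def)
  have d'PE: "d' p = c' p" if "p \<in> PE'" for p
    using that winsI.hyps(1) prems(2) by (auto simp: move_def)
  have dPE: "d p = c p" if "p \<in> PE" for p
    using that prems(2,3) by (auto simp: d_def)
  have dd: "d' p = d p" if "p \<in> PE" for p
    using that d'PE dPE prems(3,4) by auto
  have finPE: "finite PE" using prems(1,3) finite_subset by blast
  \<comment> \<open>Surplus tokens sit on \<open>x\<close> only, where at least \<open>K\<close>
    tokens of \<open>PE\<close> already saturate both counts.\<close>
  have "capcard K {p \<in> PE'. d' p = t} = capcard K {p \<in> PE. d p = t}" for t
  proof (cases "t = x")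
    case True
    have "{p \<in> PE. d p = x} \<subseteq> {p \<in> PE'. d' p = x}" using dd prems(3) by auto
    then have "card {p \<in> PE. d p = x} \<le> card {p \<in> PE'. d' p = x}"
      using prems(1) by (intro card_mono) auto
    moreover have "{p \<in> PE. d p = x} = {p \<in> PE. c p = x}" using dPE by auto
    ultimately show ?thesis using True prems(1,8) finPE by (simp add: capcard_def)
  next
    case False
    then have "p \<in> PE" if "p \<in> PE'" "d' p = t" for p
      using that d'PE prems(6) by (metis DiffI)
    then have "p \<in> PE' \<and> d' p = t \<longleftrightarrow> p \<in> PE \<and> d p = t" for p
      using dd[of p] subsetD[OF prems(3), of p] by metis
    then have "{p \<in> PE'. d' p = t} = {p \<in> PE. d p = t}" by simp
    then show ?thesis by simp
  qed
  moreover have "{p \<in> PS. d' p = t} = {p \<in> PS. d p = t}" for t by (auto simp: d_def)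
  ultimately have "G PS PE d"
    by (intro G_cong[OF _ _ _ _ winsI.hyps(2)]) (use prems(2,3) in auto)
  with mv show ?case
  proof (rule wins.winsI)
    fix e assume e: "move LE PE d e" "e \<noteq> d"
    have ePE: "e ` PE \<subseteq> LE" using e(1) by (auto simp: move_def)
    have "card {p \<in> PE. x \<le> c p} \<le> card {p \<in> PE. x \<le> e p}"
      using e(1) dPE finPE by (intro card_mono) (auto simp: move_def intro: order_trans)
    with prems(9) have "K * Suc (card LE) ^ rk x \<le> card {p \<in> PE. x \<le> e p}" by linarith
    from crowd[OF finPE ePE prems(7) this] obtain y where y: "y \<in> LE" "x \<le> y"
      "K \<le> card {p \<in> PE. e p = y}" "K * Suc (card LE) ^ rk y \<le> card {p \<in> PE. y \<le> e p}" .
    \<comment> \<open>Environment's move is repeated in the larger game while the surplus goes to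
      the next crowd \<open>y\<close>. Since \<open>y\<close> may equal \<open>x\<close>, it is a
      token of \<open>PE\<close> that shows the move to be proper.\<close>
    define e' where "e' p = (if p \<in> PE' - PE then y else if p \<in> PE then e p else d' p)" for p
    have "d' p \<le> e' p \<and> e' p \<in> LE" if "p \<in> PE'" for p
    proof (cases "p \<in> PE")
      case True
      with e(1) dd[OF True] show ?thesis by (simp add: move_def e'_def)
    next
      case False
      with that y(1,2) prems(6) d'PE[OF that] show ?thesis by (simp add: e'_def)
    qed
    then have mv': "move LE PE' d' e'" using prems(3) by (auto simp: move_def e'_def)
    from e obtain p where "p \<in> PE" "e p \<noteq> d p" unfolding move_def by (metis ext)
    then have "e' p \<noteq> d' p" using dd by (simp add: e'_def)
    then have ne: "e' \<noteq> d'" by blast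
    have "e p = d p" if "p \<in> PS" for p using that e(1) prems(2,3) by (auto simp: move_def)
    then have "\<forall>p\<in>PS \<union> PE. e p = e' p" using prems(2,3) by (auto simp: e'_def d_def)
    then show "wins PS PE e"
      by (rule winsI.IH[OF mv' ne prems(1-3) _ ePE _ y(1,3,4)]) (simp add: e'_def)
  qed
qed

end

section \<open>From words to configurations\<close>

text \<open>The locations of the token game. The pointwise order on functions makes every uncapped
  action an upward step.\<close>

definition locs :: "nat set \<Rightarrow> nat \<Rightarrow> (nat \<Rightarrow> nat) set" where
  "locs A q = {l. \<forall>a. l a \<le> q \<and> (a \<notin> A \<longrightarrow> l a = 0)}"

text \<open>The number of single increments that are still possible on a process; it plays the role
  of \<open>rk\<close>.\<close>

definition headroom :: "nat set \<Rightarrow> nat \<Rightarrow> (nat \<Rightarrow> nat) \<Rightarrow> nat" where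
  "headroom A q l = (\<Sum>a\<in>A. q - l a)"

lemma card_locs: "finite A \<Longrightarrow> finite (locs A q) \<and> card (locs A q) \<le> Suc q ^ card A"
proof -
  assume A: "finite A"
  let ?F = "PiE A (\<lambda>_. {..q})" and ?h = "\<lambda>f a. if a \<in> A then f a else (0::nat)"
  have "locs A q \<subseteq> ?h ` ?F"
  proof
    fix l assume "l \<in> locs A q"
    then have "l = ?h (restrict l A)" "restrict l A \<in> ?F" by (auto simp: locs_def)
    then show "l \<in> ?h ` ?F" by blast
  qed
  moreover have "finite ?F" "card ?F = Suc q ^ card A" using A by (auto simp: card_PiE intro: finite_PiE)
  ultimately show ?thesis
    by (metis (no_types, lifting) card_image_le card_mono finite_imageI finite_subset order_trans)
qed

lemma headroom_less:
  assumes "finite A" "x \<in> locs A q" "y \<in> locs A q" "x < y"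
  shows "headroom A q y < headroom A q x"
  unfolding headroom_def
proof (rule sum_strict_mono_ex1)
  show "\<forall>a\<in>A. q - y a \<le> q - x a"
    using assms(4) by (auto simp: less_le le_fun_def intro: diff_le_mono2)
  from assms(4) obtain a where a: "x a < y a"
    by (auto simp: less_fun_def le_fun_def not_le)
  with assms(3) have "a \<in> A" "y a \<le> q" by (auto simp: locs_def)
  with a show "\<exists>a\<in>A. q - y a < q - x a" by (intro bexI[of _ a]) auto
qed (rule assms(1))

text \<open>
  The structure of a configuration \<open>c\<close>, where \<open>c p a\<close> is the number of positions with action \<open>a\<close>
  on process \<open>p\<close>: the process element \<open>p\<close> is coded by \<open>pr p 0\<close>, and the \<open>j\<close>-th of these positions by
  \<open>pr p (Suc (pr a j))\<close>.
\<close>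

definition code_act :: "nat \<Rightarrow> nat option" where
  "code_act e = (if p2 e = 0 then None else Some (p1 (p2 e - 1)))"

definition conf_domain :: "nat set \<Rightarrow> nat set \<Rightarrow> (nat \<Rightarrow> nat \<Rightarrow> nat) \<Rightarrow> nat set" where
  "conf_domain PS PE c = {e. p1 e \<in> PS \<union> PE \<and> (p2 e = 0 \<or> p2 (p2 e - 1) < c (p1 e) (p1 (p2 e - 1)))}"

text \<open>For a sentence any valuation serves; the constant 0 is the one denoted by the digit code
  0 later on.\<close>

definition good :: "fm \<Rightarrow> nat set \<Rightarrow> nat set \<Rightarrow> (nat \<Rightarrow> nat \<Rightarrow> nat) \<Rightarrow> bool" where
  "good \<phi> PS PE c \<longleftrightarrow> gsat (conf_domain PS PE c) code_act p1 PS PE (\<lambda>_. 0) \<phi>"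

lemma capcard_cell_conf:
  assumes "p \<in> PS \<union> PE"
  shows "capcard q (cell (conf_domain PS PE c) code_act p1 u p) =
    min q (case u of None \<Rightarrow> 1 | Some a \<Rightarrow> c p a)"
proof (cases u)
  case None
  have "cell (conf_domain PS PE c) code_act p1 u p = {pr p 0}"
  proof (intro equalityI subsetI)
    fix e assume "e \<in> cell (conf_domain PS PE c) code_act p1 u p"
    then have "p1 e = p" "p2 e = 0" using None by (auto simp: cell_def code_act_def split: if_splits)
    with pr_p1_p2[of e] show "e \<in> {pr p 0}" by simp
  qed (use assms None in \<open>auto simp: cell_def conf_domain_def code_act_def\<close>)
  then show ?thesis using None by (simp add: capcard_def)
next
  case (Some a)
  have "cell (conf_domain PS PE c) code_act p1 u p = (\<lambda>j. pr p (Suc (pr a j))) ` {..<c p a}"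
  proof (intro equalityI subsetI)
    fix e assume e: "e \<in> cell (conf_domain PS PE c) code_act p1 u p"
    then have "p1 e = p" "p2 e \<noteq> 0" "p1 (p2 e - 1) = a" "p2 (p2 e - 1) < c p a"
      using Some by (auto simp: cell_def conf_domain_def code_act_def split: if_splits)
    moreover from this have "e = pr p (Suc (pr a (p2 (p2 e - 1))))"
      by (metis Suc_pred' bot_nat_0.not_eq_extremum pr_p1_p2)
    ultimately show "e \<in> (\<lambda>j. pr p (Suc (pr a j))) ` {..<c p a}" by blast
  qed (use assms Some in \<open>auto simp: cell_def conf_domain_def code_act_def\<close>)
  moreover have "inj_on (\<lambda>j. pr p (Suc (pr a j))) {..<c p a}" by (auto simp: inj_on_def)
  ultimately show ?thesis using Some by (simp add: capcard_def card_image)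
qed

lemma p1_conf_domain: "p1 ` conf_domain PS PE c \<subseteq> PS \<union> PE"
  by (auto simp: conf_domain_def)

text \<open>The count vector of a process fixes the sizes of its cells, so it can itself be taken as
  the colour.\<close>

lemma good_cong:
  assumes "free_vars \<phi> = {}" "qd \<phi> \<le> q" "PS \<inter> PE = {}" "PS' \<inter> PE' = {}"
    and "\<And>t. capcard q {p \<in> PS. c p = t} = capcard q {p \<in> PS'. c' p = t}"
    and "\<And>t. capcard q {p \<in> PE. c p = t} = capcard q {p \<in> PE'. c' p = t}"
  shows "good \<phi> PS PE c \<longleftrightarrow> good \<phi> PS' PE' c'"
proof -
  interpret similar_structures q "conf_domain PS PE c" code_act p1 PS PE c
      "conf_domain PS' PE' c'" code_act p1 PS' PE' c'
    by unfold_locales (use assms p1_conf_domain in \<open>simp_all add: capcard_cell_conf split: option.split\<close>)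
  show ?thesis unfolding good_def by (rule gsat_iff) (use assms in auto)
qed

section \<open>Data words and the configurations they reach\<close>

definition counts :: "nat \<Rightarrow> dword \<Rightarrow> nat \<Rightarrow> nat \<Rightarrow> nat" where
  "counts q w p a = capcard q {i \<in> positions w. letter_at w i = (a, p)}"

fun elem_act :: "dword \<Rightarrow> elem \<Rightarrow> nat option" where
  "elem_act w (Pos i) = Some (fst (letter_at w i))"
| "elem_act w (Proc p) = None"

lemma sat_iff_gsat:
  "(\<And>x. x \<in> free_vars \<phi> \<Longrightarrow> v x \<in> domain PS PE w) \<Longrightarrow>
    sat PS PE w v \<phi> \<longleftrightarrow> gsat (domain PS PE w) (elem_act w) (proc_of w) PS PE v \<phi>"
proof (induction \<phi> arbitrary: v)
  case (Act a x)
  then show ?case by (auto simp: domain_def)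
next
  case (SysProc x)
  then show ?case by (auto simp: domain_def)
next
  case (EnvProc x)
  then show ?case by (auto simp: domain_def)
next
  case (Exists x \<phi>)
  have "sat PS PE w (v(x := e)) \<phi> \<longleftrightarrow>
      gsat (domain PS PE w) (elem_act w) (proc_of w) PS PE (v(x := e)) \<phi>"
    if "e \<in> domain PS PE w" for e
    by (rule Exists.IH) (use Exists.prems that in auto)
  then show ?case by simp
next
  case (Forall x \<phi>)
  have "sat PS PE w (v(x := e)) \<phi> \<longleftrightarrow>
      gsat (domain PS PE w) (elem_act w) (proc_of w) PS PE (v(x := e)) \<phi>"
    if "e \<in> domain PS PE w" for e
    by (rule Forall.IH) (use Forall.prems that in auto)
  then show ?case by simp
qed simp_all

text \<open>Both structures have the same processes, so each process is its own colour. The order of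
  the positions is invisible to the logic, and the configuration records the sizes of the cells up
  to \<open>q\<close>.\<close>

lemma models_iff_good:
  assumes closed: "free_vars \<phi> = {}" "qd \<phi> \<le> q" and disj: "PS \<inter> PE = {}"
    and w: "w \<in> words_over (AS \<times> PS \<union> AE \<times> PE)"
  shows "models PS PE w \<phi> \<longleftrightarrow> good \<phi> PS PE (counts q w)"
proof -
  have cells: "capcard q (cell (domain PS PE w) (elem_act w) (proc_of w) u p) =
      min q (case u of None \<Rightarrow> 1 | Some a \<Rightarrow> counts q w p a)" if "p \<in> PS \<union> PE" for u p
  proof (cases u)
    case None
    have "cell (domain PS PE w) (elem_act w) (proc_of w) u p = {Proc p}"
      using that None by (auto simp: cell_def domain_def)
    then show ?thesis using None by (simp add: capcard_def)
  next
    case (Some a)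
    have "cell (domain PS PE w) (elem_act w) (proc_of w) u p =
        Pos ` {i \<in> positions w. letter_at w i = (a, p)}"
      using Some by (auto simp: cell_def domain_def prod_eq_iff)
    moreover have "inj_on Pos X" for X by (auto simp: inj_on_def)
    ultimately show ?thesis using Some
      by (simp add: capcard_def counts_def card_image finite_image_iff)
  qed
  have "snd (letter_at w i) \<in> PS \<union> PE" if "i \<in> positions w" for i
    using w that by (auto simp: words_over_def)
  then have "proc_of w e \<in> PS \<union> PE" if "e \<in> domain PS PE w" for e
    using that by (cases e) (auto simp: domain_def)
  then have own: "proc_of w ` domain PS PE w \<subseteq> PS \<union> PE" by blast
  interpret similar_structures q "domain PS PE w" "elem_act w" "proc_of w" PS PE "\<lambda>p. p"
      "conf_domain PS PE (counts q w)" code_act p1 PS PE "\<lambda>p. p"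
    by unfold_locales (use disj own p1_conf_domain in \<open>simp_all add: cells capcard_cell_conf\<close>)
  have "sat PS PE w v \<phi> \<longleftrightarrow> good \<phi> PS PE (counts q w)" for v
    unfolding good_def using gsat_iff[OF closed] closed(1) by (subst sat_iff_gsat) auto
  then show ?thesis by (simp add: models_def)
qed

text \<open>Initial segments either exhaust the set or come to contain \<open>q\<close> of its
  elements; both freeze the capped count.\<close>

lemma capcard_eventually:
  fixes A :: "nat set"
  shows "eventually (\<lambda>k. capcard q A = min q (card (A \<inter> {..<k}))) sequentially"
proof (cases "finite A")
  case True
  then obtain m where m: "A \<subseteq> {..<m}" using finite_nat_iff_bounded by blast
  have "capcard q A = min q (card (A \<inter> {..<k}))" if "m \<le> k" for k
  proof -
    have "A \<inter> {..<k} = A" using m that by auto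
    then show ?thesis using True by (simp add: capcard_def)
  qed
  then show ?thesis by (auto simp: eventually_sequentially)
next
  case False
  then obtain B where B: "B \<subseteq> A" "finite B" "card B = q" using infinite_arbitrarily_large by blast
  then obtain m where m: "B \<subseteq> {..<m}" using finite_nat_iff_bounded by blast
  have "capcard q A = min q (card (A \<inter> {..<k}))" if "m \<le> k" for k
  proof -
    have "B \<subseteq> A \<inter> {..<k}" using B m that by auto
    then have "q \<le> card (A \<inter> {..<k})" using B card_mono[of "A \<inter> {..<k}" B] by simp
    then show ?thesis using False by (simp add: capcard_def)
  qed
  then show ?thesis by (auto simp: eventually_sequentially)
qed

definition conf :: "nat \<Rightarrow> letter list \<Rightarrow> nat \<Rightarrow> nat \<Rightarrow> nat" where
  "conf q u p a = min q (count_list u (a, p))"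

lemma count_list_eq_card: "count_list u x = card {i. i < length u \<and> u ! i = x}"
  unfolding count_list_eq_length_filter length_filter_conv_card by (rule arg_cong[of _ _ card]) auto

lemma counts_Fin: "counts q (Fin u) = conf q u"
proof (intro ext)
  show "counts q (Fin u) p a = conf q u p a" for p a
    by (simp add: counts_def conf_def capcard_def count_list_eq_card)
qed

text \<open>The counts freeze simultaneously because there are finitely many letters. This reduces
  infinite plays to a finite game.\<close>

lemma counts_Inf_eventually:
  assumes fin: "finite L" and f: "\<And>i. f i \<in> L"
  shows "eventually (\<lambda>k. conf q (map f [0..<k]) = counts q (Inf f)) sequentially"
proof -
  have count: "count_list (map f [0..<k]) l = card ({i. f i = l} \<inter> {..<k})" for k l
  proof -
    have "count_list (map f [0..<k]) l = card {i. i < k \<and> map f [0..<k] ! i = l}"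
      by (simp add: count_list_eq_card)
    also have "{i. i < k \<and> map f [0..<k] ! i = l} = {i. f i = l} \<inter> {..<k}" by auto
    finally show ?thesis .
  qed
  have "eventually (\<lambda>k. \<forall>l\<in>L. capcard q {i. f i = l} = min q (card ({i. f i = l} \<inter> {..<k}))) sequentially"
    by (intro eventually_ball_finite[OF fin] ballI capcard_eventually)
  then show ?thesis
  proof eventually_elim
    case (elim k)
    show ?case
    proof (intro ext)
      fix p a
      show "conf q (map f [0..<k]) p a = counts q (Inf f) p a"
      proof (cases "(a, p) \<in> L")
        case True
        with elim show ?thesis by (simp add: conf_def counts_def count)
      next
        case False
        then have "f i \<noteq> (a, p)" for i using f[of i] by auto
        then show ?thesis by (simp add: conf_def counts_def count capcard_def)
      qed
    qed
  qed
qed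

section \<open>Strategies and token games\<close>

locale synthesis =
  fixes AS AE :: "nat set" and \<phi> :: fm and q :: nat
  assumes finite_AS: "finite AS" and finite_AE: "finite AE" and q: "qd \<phi> \<le> q" "0 < q"
    and closed_fm: "free_vars \<phi> = {}"

sublocale synthesis \<subseteq> token_game "locs AS q" "locs AE q" "headroom AE q" q "good \<phi>"
proof
  show "finite (locs AS q)" "finite (locs AE q)" using card_locs finite_AS finite_AE by blast+
  have "(\<lambda>_. 0) \<in> locs AS q" by (simp add: locs_def)
  then show "locs AS q \<noteq> {}" by blast
  show "0 < q" by (rule q)
  show "headroom AE q y < headroom AE q x" if "x \<in> locs AE q" "y \<in> locs AE q" "x < y" for x y
    using headroom_less[OF finite_AE] that by blast
  show "good \<phi> PS' PE' c'" if "PS \<inter> PE = {}" "PS' \<inter> PE' = {}"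
    "\<And>t. capcard q {p \<in> PS. c p = t} = capcard q {p \<in> PS'. c' p = t}"
    "\<And>t. capcard q {p \<in> PE. c p = t} = capcard q {p \<in> PE'. c' p = t}"
    "good \<phi> PS PE c" for PS PE PS' PE' c c'
    using good_cong[OF closed_fm q(1) that(1-4)] that(5) by blast
qed

lemma words_over_Fin: "Fin u \<in> words_over L \<longleftrightarrow> u \<in> lists L"
  unfolding words_over_def in_lists_conv_set all_set_conv_all_nth by auto

context synthesis
begin

section \<open>From a winning strategy to a won token game\<close>

definition history :: "nat set \<Rightarrow> nat set \<Rightarrow> strategy \<Rightarrow> letter list \<Rightarrow> bool" where
  "history PS PE S u \<longleftrightarrow> u \<in> lists (AS \<times> PS \<union> AE \<times> PE) \<and>
    (\<forall>i<length u. u ! i \<in> AS \<times> PS \<longrightarrow> S (take i u) = Some (u ! i))"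

lemma history_append1:
  "history PS PE S (u @ [l]) \<longleftrightarrow> history PS PE S u \<and> l \<in> AS \<times> PS \<union> AE \<times> PE \<and>
    (l \<in> AS \<times> PS \<longrightarrow> S u = Some l)"
  unfolding history_def by (auto simp: nth_append less_Suc_eq all_conj_distrib imp_conjL[symmetric])

lemma history_append_env:
  assumes "history PS PE S u" "set v \<subseteq> AE \<times> PE" "PS \<inter> PE = {}"
  shows "history PS PE S (u @ v)"
  using assms(2)
proof (induction v rule: rev_induct)
  case (snoc l v)
  then have "history PS PE S ((u @ v) @ [l])"
    unfolding history_append1 using assms(3) by auto
  then show ?case by simp
qed (simp add: assms(1))

definition wins_system :: "nat set \<Rightarrow> nat set \<Rightarrow> bool" where
  "wins_system PS PE \<longleftrightarrow> (\<exists>S. is_strategy (AS \<times> PS) (AE \<times> PE) S \<and> winning AS AE PS PE \<phi> S)"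

text \<open>Environment is kept silent after \<open>u\<close>. If System stops, the word is a finite
  execution; if it never stops, System letters occur infinitely often and the word is fair. Either
  way the final configuration is good, and in the second case a finite prefix already has
  it.\<close>

lemma system_reaches_good:
  assumes S: "is_strategy (AS \<times> PS) (AE \<times> PE) S" "winning AS AE PS PE \<phi> S"
    and fin: "finite PS" "finite PE" and disj: "PS \<inter> PE = {}"
    and u: "history PS PE S u"
  obtains v where "set v \<subseteq> AS \<times> PS" "history PS PE S (u @ v)" "good \<phi> PS PE (conf q (u @ v))"
proof -
  let ?L = "AS \<times> PS \<union> AE \<times> PE"
  have win: "good \<phi> PS PE (counts q w)"
    if "w \<in> words_over ?L" "compatible (AS \<times> PS) S w" "fair (AS \<times> PS) S w" for w
    using S(2) that models_iff_good[OF closed_fm q(1) disj that(1)] by (auto simp: winning_def)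
  have SL: "S v = None \<or> the (S v) \<in> AS \<times> PS" if "v \<in> lists ?L" for v
    using S(1) that by (auto simp: is_strategy_def)
  \<comment> \<open>The run of System alone; \<open>the\<close> is meaningful only as long as the
    strategy proposes a letter.\<close>
  define U where "U = rec_nat [] (\<lambda>_ v. v @ [the (S (u @ v))])"
  have U: "U 0 = []" "U (Suc k) = U k @ [the (S (u @ U k))]" for k by (simp_all add: U_def)
  have run: "history PS PE S (u @ U k) \<and> set (U k) \<subseteq> AS \<times> PS"
    if "\<And>j. j < k \<Longrightarrow> S (u @ U j) \<noteq> None" for k
    using that
  proof (induction k)
    case 0 then show ?case by (simp add: U u)
  next
    case (Suc k)
    then have IH: "history PS PE S (u @ U k)" "set (U k) \<subseteq> AS \<times> PS" by auto
    from IH(1) have "u @ U k \<in> lists ?L" by (simp add: history_def)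
    with SL Suc.prems have "the (S (u @ U k)) \<in> AS \<times> PS" by blast
    then have "history PS PE S ((u @ U k) @ [the (S (u @ U k))])"
      unfolding history_append1 using IH(1) Suc.prems[of k] by auto
    with IH(2) \<open>the (S (u @ U k)) \<in> AS \<times> PS\<close> show ?case by (simp add: U(2))
  qed
  show ?thesis
  proof (cases "\<exists>k. S (u @ U k) = None")
    case True
    define k where "k = (LEAST k. S (u @ U k) = None)"
    have k: "S (u @ U k) = None" unfolding k_def by (rule LeastI_ex) (rule True)
    have "S (u @ U j) \<noteq> None" if "j < k" for j using that not_less_Least unfolding k_def by blast
    with run[of k] have h: "history PS PE S (u @ U k)" "set (U k) \<subseteq> AS \<times> PS" by auto
    have "good \<phi> PS PE (counts q (Fin (u @ U k)))"
    proof (rule win)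
      show "Fin (u @ U k) \<in> words_over ?L"
        using h(1) by (simp add: history_def words_over_Fin)
      show "compatible (AS \<times> PS) S (Fin (u @ U k))"
        using h(1) k by (simp add: compatible_def history_def)
      show "fair (AS \<times> PS) S (Fin (u @ U k))" by (simp add: fair_def)
    qed
    with h show ?thesis by (intro that[of "U k"]) (simp_all add: counts_Fin)
  next
    case False
    then have h: "history PS PE S (u @ U k)" "set (U k) \<subseteq> AS \<times> PS" for k using run[of k] by auto
    define f where "f i = (if i < length u then u ! i else the (S (u @ U (i - length u))))" for i
    have "map f [0..<length u] = u" by (rule nth_equalityI) (auto simp: f_def)
    then have fU: "map f [0..<length u + k] = u @ U k" for k
      by (induction k) (auto simp: U f_def)
    have fL: "f i \<in> ?L" for i
    proof -
      have "set (u @ U (Suc i)) \<subseteq> ?L" using h(1)[of "Suc i"] by (auto simp: history_def)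
      moreover have "f i \<in> set (map f [0..<length u + Suc i])" by (simp del: upt_Suc)
      ultimately show ?thesis unfolding fU by blast
    qed
    have "good \<phi> PS PE (counts q (Inf f))"
    proof (rule win)
      show "Inf f \<in> words_over ?L" using fL by (simp add: words_over_def)
      have "S (map f [0..<i]) = Some (f i)" if "f i \<in> AS \<times> PS" for i
      proof -
        have "history PS PE S (map f [0..<length u + Suc i])" unfolding fU by (rule h)
        moreover have "take i (map f [0..<length u + Suc i]) = map f [0..<i]"
          by (simp add: take_map del: upt_Suc)
        moreover have "i < length (map f [0..<length u + Suc i])"
          "map f [0..<length u + Suc i] ! i = f i" by (simp_all del: upt_Suc)
        ultimately show ?thesis using that unfolding history_def by metis
      qed
      then show "compatible (AS \<times> PS) S (Inf f)" by (simp add: compatible_def)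
      have "{i. f i \<in> AS \<times> PS} \<supseteq> {length u..}"
      proof
        fix i assume "i \<in> {length u..}"
        moreover have "the (S (u @ U (i - length u))) \<in> set (U (Suc (i - length u)))" by (simp add: U)
        ultimately show "i \<in> {i. f i \<in> AS \<times> PS}" using h(2)[of "Suc (i - length u)"] by (auto simp: f_def)
      qed
      then have "infinite {i. f i \<in> AS \<times> PS}" using infinite_Ici infinite_super by blast
      then show "fair (AS \<times> PS) S (Inf f)" by (simp add: fair_def)
    qed
    moreover obtain m where "\<forall>k\<ge>m. conf q (map f [0..<k]) = counts q (Inf f)"
      using counts_Inf_eventually[of ?L f q] fL finite_AS finite_AE fin
      by (auto simp: eventually_sequentially)
    then have "conf q (u @ U m) = counts q (Inf f)" using fU[of m] by (metis le_add2)
    ultimately have "good \<phi> PS PE (conf q (u @ U m))" by simp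
    with h show ?thesis by (intro that[of "U m"])
  qed
qed

lemma conf_append_le: "conf q u p a \<le> conf q (u @ v) p a"
  by (simp add: conf_def)

lemma conf_append_other: "set v \<subseteq> A \<times> P \<Longrightarrow> a \<notin> A \<or> p \<notin> P \<Longrightarrow> conf q (u @ v) p a = conf q u p a"
proof -
  assume "set v \<subseteq> A \<times> P" "a \<notin> A \<or> p \<notin> P"
  then have "(a, p) \<notin> set v" by auto
  then show ?thesis by (simp add: conf_def)
qed

lemma conf_locs:
  assumes "u \<in> lists (AS \<times> PS \<union> AE \<times> PE)" "PS \<inter> PE = {}"
  shows "p \<in> PS \<Longrightarrow> conf q u p \<in> locs AS q" "p \<in> PE \<Longrightarrow> conf q u p \<in> locs AE q"
proof -
  have *: "conf q u p a = 0" if "(a, p) \<notin> AS \<times> PS \<union> AE \<times> PE" for a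
  proof -
    have "(a, p) \<notin> set u" using assms(1) that by auto
    then show ?thesis by (simp add: conf_def)
  qed
  show "p \<in> PS \<Longrightarrow> conf q u p \<in> locs AS q" "p \<in> PE \<Longrightarrow> conf q u p \<in> locs AE q"
    using assms(2) * unfolding locs_def by (auto simp: conf_def)
qed

lemma list_with_counts:
  fixes k :: "'a \<Rightarrow> nat"
  assumes "finite L"
  shows "\<exists>v. set v \<subseteq> L \<and> (\<forall>l\<in>L. count_list v l = k l)"
  using assms
proof (induction L rule: finite_induct)
  case (insert x L)
  then obtain v where v: "set v \<subseteq> L" "\<forall>l\<in>L. count_list v l = k l" by blast
  have r: "count_list (replicate n x) l = (if l = x then n else 0)" for n l
    by (induction n) auto
  have "x \<notin> set v" using v insert.hyps by blast
  then have "set (replicate (k x) x @ v) \<subseteq> insert x L \<and>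
      (\<forall>l\<in>insert x L. count_list (replicate (k x) x @ v) l = k l)"
    using v insert.hyps by (auto simp: r)
  then show ?case by blast
qed simp

text \<open>System's batch comes from \<open>system_reaches_good\<close>. A batch of Environment is
  spelled out as a word over its letters, in any order, since only counts matter. The induction runs
  on Environment's total headroom.\<close>

lemma wins_if_winning_strategy:
  assumes S: "is_strategy (AS \<times> PS) (AE \<times> PE) S" "winning AS AE PS PE \<phi> S"
    and fin: "finite PS" "finite PE" and disj: "PS \<inter> PE = {}"
    and u: "history PS PE S u"
  shows "wins PS PE (conf q u)"
  using u
proof (induction "\<Sum>p\<in>PE. headroom AE q (conf q u p)" arbitrary: u rule: less_induct)
  case (less u)
  obtain v where v: "set v \<subseteq> AS \<times> PS" "history PS PE S (u @ v)" "good \<phi> PS PE (conf q (u @ v))"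
    using system_reaches_good[OF S fin disj less.prems] .
  have L: "u @ v \<in> lists (AS \<times> PS \<union> AE \<times> PE)" using v(2) by (simp add: history_def)
  show ?case
  proof (rule winsI)
    show "move (locs AS q) PS (conf q u) (conf q (u @ v))"
      unfolding move_def le_fun_def
      using conf_locs(1)[OF L disj] conf_append_le conf_append_other[OF v(1)] by auto
    show "good \<phi> PS PE (conf q (u @ v))" by (rule v(3))
    fix e assume e: "move (locs AE q) PE (conf q (u @ v)) e" "e \<noteq> conf q (u @ v)"
    have "finite (AE \<times> PE)" using finite_AE fin by blast
    \<comment> \<open>A count below \<open>q\<close> is exact, so the difference is what is missing;
      at a saturated count \<open>e\<close> is saturated as well and the difference is 0.\<close>
    from list_with_counts[OF this, of "\<lambda>l. e (snd l) (fst l) - conf q (u @ v) (snd l) (fst l)"]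
    obtain x where "set x \<subseteq> AE \<times> PE \<and>
      (\<forall>l\<in>AE \<times> PE. count_list x l = e (snd l) (fst l) - conf q (u @ v) (snd l) (fst l))" ..
    then have x: "set x \<subseteq> AE \<times> PE"
        "\<And>a p. (a, p) \<in> AE \<times> PE \<Longrightarrow> count_list x (a, p) = e p a - conf q (u @ v) p a"
      by auto
    have "conf q (u @ v @ x) p a = e p a" for p a
    proof (cases "(a, p) \<in> AE \<times> PE")
      case True
      then have "conf q (u @ v) p a \<le> e p a" "e p a \<le> q" using e(1) by (auto simp: move_def le_fun_def locs_def)
      with x(2)[OF True] show ?thesis by (auto simp: conf_def min_def split: if_splits)
    next
      case False
      have "conf q (u @ v @ x) p a = conf q (u @ v) p a"
        using conf_append_other[OF x(1), of a p "u @ v"] False by simp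
      also have "\<dots> = e p a"
      proof (cases "p \<in> PE")
        case True
        with False e(1) have "e p a = 0" by (simp add: move_def locs_def)
        moreover have "conf q (u @ v) p a \<le> e p a" using True e(1) by (simp add: move_def le_fun_def)
        ultimately show ?thesis by simp
      qed (use e(1) in \<open>simp add: move_def\<close>)
      finally show ?thesis .
    qed
    then have conf: "conf q (u @ v @ x) = e" by blast
    have "(\<Sum>p\<in>PE. headroom AE q (e p)) < (\<Sum>p\<in>PE. headroom AE q (conf q (u @ v) p))"
      by (rule rk_less_if_move[OF e fin(2)]) (use conf_locs(2)[OF L disj] in blast)
    moreover have "conf q (u @ v) p = conf q u p" if "p \<in> PE" for p
      using conf_append_other[OF v(1), of _ p u] disj that by (intro ext) auto
    moreover have "history PS PE S (u @ v @ x)"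
      using history_append_env[OF v(2) x(1) disj] by simp
    ultimately show "wins PS PE e" using less.hyps[of "u @ v @ x"] by (simp add: conf)
  qed
qed

section \<open>Safe sets of configurations and the strategy they induce\<close>

definition inc :: "(nat \<Rightarrow> nat \<Rightarrow> nat) \<Rightarrow> nat \<Rightarrow> nat \<Rightarrow> nat \<Rightarrow> nat \<Rightarrow> nat" where
  "inc c p a = c(p := (c p)(a := Suc (c p a)))"

text \<open>The game letter by letter. Unlike the inductive \<open>wins\<close>, such a set is a
  certificate that a bounded quantifier can guess. Progress is implicit: counts only rise and are
  capped, so System cannot postpone goodness forever.\<close>

definition safe :: "nat set \<Rightarrow> nat set \<Rightarrow> (nat \<Rightarrow> nat \<Rightarrow> nat) set \<Rightarrow> bool" where
  "safe PS PE X \<longleftrightarrow> (\<forall>c\<in>X. (\<forall>p\<in>PE. \<forall>a\<in>AE. c p a < q \<longrightarrow> inc c p a \<in> X) \<and>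
    (good \<phi> PS PE c \<or> (\<exists>p\<in>PS. \<exists>a\<in>AS. c p a < q \<and> inc c p a \<in> X)))"

text \<open>In a word Environment may act before System has finished its batch. Moves of disjoint
  token sets commute, so the batch from \<open>c\<close> and the System batch answering
  Environment's move combine into a single batch from \<open>e\<close>.\<close>

lemma wins_if_move:
  assumes "wins PS PE c" "move (locs AE q) PE c e" "PS \<inter> PE = {}"
  shows "wins PS PE e"
proof (cases "e = c")
  case False
  from assms(1) obtain d where d: "move (locs AS q) PS c d"
      "\<And>e. move (locs AE q) PE d e \<Longrightarrow> e \<noteq> d \<Longrightarrow> wins PS PE e"
    by (auto elim: wins.cases)
  define d1 where "d1 p = (if p \<in> PE then e p else d p)" for p
  have d1: "move (locs AE q) PE d d1"
    unfolding move_def d1_def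
  proof (intro conjI ballI allI impI)
    fix p assume "p \<in> PE"
    with d(1) assms(3) have "d p = c p" by (auto simp: move_def)
    with \<open>p \<in> PE\<close> assms(2) show "d p \<le> (if p \<in> PE then e p else d p)"
      "(if p \<in> PE then e p else d p) \<in> locs AE q" by (auto simp: move_def)
  qed simp
  obtain p where p: "p \<in> PE" "e p \<noteq> c p" using False assms(2) by (metis ext move_def)
  with d(1) assms(3) have "d p = c p" by (auto simp: move_def)
  with p have "d1 p \<noteq> d p" by (simp add: d1_def)
  then have "d1 \<noteq> d" by blast
  with d(2)[OF d1] obtain d2 where d2: "move (locs AS q) PS d1 d2" "good \<phi> PS PE d2"
      "\<And>e. move (locs AE q) PE d2 e \<Longrightarrow> e \<noteq> d2 \<Longrightarrow> wins PS PE e"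
    by (auto elim: wins.cases)
  have "move (locs AS q) PS e d2"
    unfolding move_def
  proof (intro conjI ballI allI impI)
    fix p assume p: "p \<in> PS"
    then have "p \<notin> PE" using assms(3) by blast
    then have "e p = c p" "d1 p = d p" using assms(2) by (auto simp: move_def d1_def)
    moreover have "c p \<le> d p" "d1 p \<le> d2 p" "d2 p \<in> locs AS q"
      using p d(1) d2(1) by (auto simp: move_def)
    ultimately show "e p \<le> d2 p" "d2 p \<in> locs AS q" by (metis order_trans)+
  next
    fix p assume p: "p \<notin> PS"
    with d2(1) d(1) assms(2) show "d2 p = e p" by (auto simp: move_def d1_def)
  qed
  with d2 show ?thesis by (blast intro: winsI)
qed (use assms in simp)

lemma inc_apply: "inc c p a p' a' = c p' a' + (if p' = p \<and> a' = a then 1 else 0)"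
  by (simp add: inc_def)

text \<open>The winning configurations form the set. From a bad one, System's batch towards a good
  \<open>d\<close> is proper, and one increment of it leaves \<open>d\<close> within reach;
  increments of Environment are covered by \<open>wins_if_move\<close>.\<close>

lemma safe_if_wins:
  assumes "wins PS PE c0" "PS \<inter> PE = {}" "\<forall>p\<in>PS. c0 p \<in> locs AS q" "\<forall>p\<in>PE. c0 p \<in> locs AE q"
  obtains X where "c0 \<in> X" "safe PS PE X"
proof -
  define X where "X = {c. wins PS PE c \<and> (\<forall>p\<in>PS. c p \<in> locs AS q) \<and> (\<forall>p\<in>PE. c p \<in> locs AE q)}"
  have "safe PS PE X"
    unfolding safe_def
  proof (intro ballI conjI impI)
    fix c p a assume c: "c \<in> X" and pa: "p \<in> PE" "a \<in> AE" "c p a < q"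
    have le: "c p' \<le> inc c p a p'" for p' by (simp add: le_fun_def inc_apply)
    have locE: "inc c p a p' \<in> locs AE q" if "p' \<in> PE" for p'
      using c pa that by (auto simp: X_def locs_def inc_apply)
    have locS: "inc c p a p' \<in> locs AS q" if "p' \<in> PS" for p'
      using c pa that assms(2) by (auto simp: X_def locs_def inc_apply)
    have "move (locs AE q) PE c (inc c p a)" using le locE pa by (auto simp: move_def inc_def)
    then show "inc c p a \<in> X" using c wins_if_move assms(2) locE locS unfolding X_def by blast
  next
    fix c assume c: "c \<in> X"
    then obtain d where d: "move (locs AS q) PS c d" "good \<phi> PS PE d"
        "\<And>e. move (locs AE q) PE d e \<Longrightarrow> e \<noteq> d \<Longrightarrow> wins PS PE e"
      by (auto simp: X_def elim: wins.cases)
    show "good \<phi> PS PE c \<or> (\<exists>p\<in>PS. \<exists>a\<in>AS. c p a < q \<and> inc c p a \<in> X)"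
    proof (cases "d = c")
      case False
      then obtain p a where pa: "d p a \<noteq> c p a" by (metis ext)
      with d(1) have p: "p \<in> PS" by (auto simp: move_def)
      with d(1) have "c p a \<le> d p a" "d p \<in> locs AS q" by (auto simp: move_def le_fun_def)
      with pa have a: "a \<in> AS" "c p a < d p a" "c p a < q" by (auto simp: locs_def le_less intro: less_le_trans)
      have le: "inc c p a p' a' \<le> d p' a'" for p' a'
        using d(1) a(2) unfolding inc_apply by (cases "p' \<in> PS") (auto simp: move_def le_fun_def p)
      have "move (locs AS q) PS (inc c p a) d"
        using d(1) le p by (auto simp: move_def le_fun_def inc_def)
      then have "wins PS PE (inc c p a)" using d(2,3) by (rule winsI)
      moreover have "inc c p a p' \<in> locs AS q" if "p' \<in> PS" for p'
        using c a that by (auto simp: X_def locs_def inc_apply)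
      moreover have "inc c p a p' \<in> locs AE q" if "p' \<in> PE" for p'
        using c p that assms(2) by (auto simp: X_def locs_def inc_apply)
      ultimately have "inc c p a \<in> X" by (simp add: X_def)
      with p a show ?thesis by blast
    qed (use d in simp)
  qed
  moreover have "c0 \<in> X" using assms by (simp add: X_def)
  ultimately show ?thesis using that by blast
qed

lemma conf_snoc: "conf q (u @ [(a, p)]) = (if conf q u p a < q then inc (conf q u) p a else conf q u)"
  by (intro ext) (auto simp: conf_def inc_def)

text \<open>System proposes an increment inside \<open>X\<close> as long as the configuration is
  bad. Along an infinite word the configurations freeze; were the limit bad, System would propose
  forever and by fairness be heard again, which would raise a frozen count.\<close>

lemma wins_system_if_safe:
  assumes X: "(\<lambda>_ _. 0) \<in> X" "safe PS PE X" and fin: "finite PS" "finite PE" and disj: "PS \<inter> PE = {}"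
  shows "wins_system PS PE"
proof -
  let ?L = "AS \<times> PS \<union> AE \<times> PE"
  \<comment> \<open>Only unsaturated counts are allowed, so that a letter of System always changes
    the configuration.\<close>
  define R where "R c l \<longleftrightarrow> l \<in> AS \<times> PS \<and> c (snd l) (fst l) < q \<and> inc c (snd l) (fst l) \<in> X" for c l
  define S where "S u = (if conf q u \<in> X \<and> \<not> good \<phi> PS PE (conf q u)
    then Some (SOME l. R (conf q u) l) else None)" for u
  have S: "R (conf q u) l" if "S u = Some l" for u l
  proof -
    from that have u: "conf q u \<in> X" "\<not> good \<phi> PS PE (conf q u)" and l: "l = (SOME l. R (conf q u) l)"
      by (auto simp: S_def split: if_splits)
    from u X(2) obtain p a where "p \<in> PS" "a \<in> AS" "conf q u p a < q" "inc (conf q u) p a \<in> X"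
      by (auto simp: safe_def)
    then have "R (conf q u) (a, p)" by (simp add: R_def)
    then show ?thesis unfolding l by (rule someI)
  qed
  have strat: "is_strategy (AS \<times> PS) (AE \<times> PE) S"
    unfolding is_strategy_def
  proof
    fix u show "S u \<in> insert None (Some ` (AS \<times> PS))"
      using S[of u] unfolding R_def by (cases "S u") auto
  qed
  have hist: "conf q u \<in> X" if "history PS PE S u" for u
    using that
  proof (induction u rule: rev_induct)
    case Nil
    have "conf q [] = (\<lambda>_ _. 0)" by (simp add: conf_def fun_eq_iff)
    with X(1) show ?case by simp
  next
    case (snoc l u)
    obtain a p where l: "l = (a, p)" by (cases l)
    from snoc have u: "conf q u \<in> X" "l \<in> ?L" "l \<in> AS \<times> PS \<longrightarrow> S u = Some l"
      by (auto simp: history_append1)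
    show ?case
    proof (cases "l \<in> AS \<times> PS")
      case True
      with u S have "R (conf q u) l" by blast
      then show ?thesis by (simp add: l conf_snoc R_def)
    next
      case False
      with u l X(2) show ?thesis by (auto simp: conf_snoc safe_def)
    qed
  qed
  have "winning AS AE PS PE \<phi> S"
    unfolding winning_def
  proof (intro ballI impI, elim conjE)
    fix w assume w: "w \<in> words_over ?L" "compatible (AS \<times> PS) S w" "fair (AS \<times> PS) S w"
    have "good \<phi> PS PE (counts q w)"
    proof (cases w)
      case (Fin u)
      then have "history PS PE S u" "S u = None"
        using w(1,2) by (simp_all add: history_def compatible_def words_over_Fin)
      then show ?thesis using hist[of u] Fin by (auto simp: S_def counts_Fin split: if_splits)
    next
      case (Inf f)
      have fL: "f i \<in> ?L" for i using w(1) Inf by (simp add: words_over_def)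
      have comp: "S (map f [0..<i]) = Some (f i)" if "f i \<in> AS \<times> PS" for i
        using w(2) Inf that by (simp add: compatible_def)
      have "history PS PE S (map f [0..<k])" for k
        by (induction k) (use fL comp in \<open>auto simp: history_append1, simp add: history_def\<close>)
      then have confX: "conf q (map f [0..<k]) \<in> X" for k by (rule hist)
      obtain m where m: "\<And>k. k \<ge> m \<Longrightarrow> conf q (map f [0..<k]) = counts q (Inf f)"
        using counts_Inf_eventually[of ?L f q] fL finite_AS finite_AE fin
        by (auto simp: eventually_sequentially)
      show ?thesis
      proof (rule ccontr)
        assume bad: "\<not> ?thesis"
        have "S (map f [0..<k]) \<noteq> None" if "k \<ge> m" for k
          using confX[of k] m[OF that] bad Inf by (simp add: S_def)
        then have "{m..} \<subseteq> {i. S (map f [0..<i]) \<noteq> None}" by auto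
        then have "infinite {i. S (map f [0..<i]) \<noteq> None}" using infinite_Ici infinite_super by blast
        with w(3) Inf have "infinite {i. f i \<in> AS \<times> PS}" by (simp add: fair_def)
        then have "\<exists>k\<ge>m. k \<in> {i. f i \<in> AS \<times> PS}"
          unfolding infinite_nat_iff_unbounded_le by (rule spec)
        then obtain k where k: "k \<ge> m" "f k \<in> AS \<times> PS"
          by (elim exE conjE CollectE)
        obtain a p where ap: "f k = (a, p)" by (cases "f k")
        have "R (conf q (map f [0..<k])) (a, p)" using S comp[OF k(2)] ap by simp
        then have "conf q (map f [0..<Suc k]) p a = Suc (conf q (map f [0..<k]) p a)"
          by (simp add: ap conf_snoc R_def inc_def)
        with m[of k] m[of "Suc k"] k(1) show False by simp
      qed
    qed
    then show "models PS PE w \<phi>" using models_iff_good[OF closed_fm q(1) disj w(1)] by simp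
  qed
  with strat show ?thesis unfolding wins_system_def by blast
qed

end

section \<open>Bounds on the numbers of processes\<close>

definition token_bound :: "nat \<Rightarrow> nat \<Rightarrow> nat" where
  "token_bound n q = q * Suc (Suc q ^ n) ^ (q * n)"

text \<open>Both bounds come from the token lemmas with \<open>K = q\<close>, at most
  \<open>Suc q ^ n\<close> locations and at most \<open>q * n\<close> upward steps per Environment
  token. \<open>token_bound\<close> is the crowd required at the zero location; the exponent here
  bounds the total rank of that many Environment tokens.\<close>

definition system_bound :: "nat \<Rightarrow> nat \<Rightarrow> nat" where
  "system_bound n q = (Suc q ^ n) ^ Suc (token_bound n q * (q * n)) * q"

context synthesis
begin

lemma capcard_zero_fibre:
  "finite A \<Longrightarrow> finite B \<Longrightarrow> min T (card A) = min T (card B) \<Longrightarrow>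
    capcard T {p \<in> A. (\<lambda>_. 0 :: nat) = t} = capcard T {p \<in> B. (\<lambda>_. 0) = t}"
  by (cases "(\<lambda>_. 0) = t") (auto simp: capcard_def)

text \<open>Environment is reduced first, because the System threshold depends on the total rank of
  its tokens. Then both sets are renamed to adjacent intervals.\<close>

lemma wins_bounded:
  assumes w: "wins PS PE (\<lambda>_ _. 0)" and fin: "finite PS" "finite PE" and disj: "PS \<inter> PE = {}"
    and n: "AS \<subseteq> {..<n}" "AE \<subseteq> {..<n}"
  obtains nS nE where "nS \<le> system_bound n q" "nE \<le> token_bound n q"
    "wins {..<nS} {nS..<nS + nE} (\<lambda>_ _. 0)"
proof -
  let ?z = "\<lambda>_. 0 :: nat"
  have cn: "card AS \<le> n" "card AE \<le> n" using n by (auto dest!: card_mono[rotated])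
  have z: "?z \<in> locs AS q" "?z \<in> locs AE q" by (auto simp: locs_def)
  have hz: "headroom AE q ?z \<le> q * n" using cn by (simp add: headroom_def mult.commute)
  have cE: "card (locs AE q) \<le> Suc q ^ n"
    by (rule order_trans[OF conjunct2[OF card_locs[OF finite_AE]] power_increasing[OF cn(2)]]) simp
  have cS: "card (locs AS q) \<le> Suc q ^ n"
    by (rule order_trans[OF conjunct2[OF card_locs[OF finite_AS]] power_increasing[OF cn(1)]]) simp
  define M where "M = q * Suc (card (locs AE q)) ^ headroom AE q ?z"
  have M: "M \<le> token_bound n q"
  proof -
    have "Suc (card (locs AE q)) ^ headroom AE q ?z \<le> Suc (Suc q ^ n) ^ headroom AE q ?z"
      using cE by (intro power_mono) auto
    also have "\<dots> \<le> Suc (Suc q ^ n) ^ (q * n)" using hz by (intro power_increasing) auto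
    finally show ?thesis unfolding M_def token_bound_def by (rule mult_left_mono) simp
  qed
  obtain PE1 where PE1: "PE1 \<subseteq> PE" "card PE1 \<le> M" "wins PS PE1 (\<lambda>_ _. 0)"
  proof (cases "card PE \<le> M")
    case True
    with w that show ?thesis by blast
  next
    case False
    then obtain P where P: "P \<subseteq> PE" "card P = M" by (meson obtain_subset_with_card_n nat_le_linear)
    \<comment> \<open>The \<open>M\<close> tokens kept at the zero location are the initial crowd
      for the surplus.\<close>
    have "wins PS P (\<lambda>_ _. 0)"
    proof (rule wins_fewer_environment_tokens[OF w fin(2) disj P(1), of _ ?z])
      have "{p \<in> P. ?z = ?z} = P" "{p \<in> P. ?z \<le> ?z} = P" by auto
      then show "q \<le> card {p \<in> P. ?z = ?z}"
        "q * Suc (card (locs AE q)) ^ headroom AE q ?z \<le> card {p \<in> P. ?z \<le> ?z}"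
        using P(2) by (simp_all only: M_def) simp_all
    qed (use z in auto)
    with P that show ?thesis by simp
  qed
  define nE where "nE = card PE1"
  define N where "N = card (locs AS q) ^ Suc (M * headroom AE q ?z) * q"
  \<comment> \<open>System tokens beyond the threshold \<open>N\<close> are not seen by
    \<open>wins_many_system_tokens\<close>.\<close>
  define nS where "nS = min (card PS) N"
  have "1 \<le> card (locs AS q)" using finite_LS LS_nonempty by (simp add: Suc_le_eq card_gt_0_iff)
  have "Suc q ^ n \<ge> 1" by simp
  have "card (locs AS q) ^ Suc (M * headroom AE q ?z) \<le> (Suc q ^ n) ^ Suc (M * headroom AE q ?z)"
    using cS by (intro power_mono) auto
  also have "\<dots> \<le> (Suc q ^ n) ^ Suc (token_bound n q * (q * n))"
    using M hz \<open>Suc q ^ n \<ge> 1\<close> by (intro power_increasing) (auto intro: mult_le_mono)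
  finally have "N \<le> system_bound n q" unfolding N_def system_bound_def by (rule mult_right_mono) simp
  then have nS: "nS \<le> system_bound n q" by (simp add: nS_def)
  have nE: "nE \<le> token_bound n q" using PE1(2) M by (simp add: nE_def)
  have finPE1: "finite PE1" using PE1(1) fin(2) finite_subset by blast
  have "card PE1 = card {nS..<nS + nE}" by (simp add: nE_def)
  from finite_same_card_bij[OF finPE1 _ this] obtain \<pi> where \<pi>: "bij_betw \<pi> PE1 {nS..<nS + nE}"
    by auto
  have "wins {..<nS} {nS..<nS + nE} (\<lambda>_ _. 0)"
  proof (rule wins_many_system_tokens[OF PE1(3) fin(1) _ finPE1 _ _ _ \<pi>])
    show "PS \<inter> PE1 = {}" using disj PE1(1) by blast
    show "(\<Sum>p\<in>PE1. headroom AE q ?z) \<le> M * headroom AE q ?z" using PE1(2) by (simp add: mult_le_mono1)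
    have "min N (card PS) = min N (card {..<nS})" by (auto simp: nS_def)
    then show "capcard (card (locs AS q) ^ Suc (M * headroom AE q ?z) * q) {p \<in> PS. ?z = t} =
        capcard (card (locs AS q) ^ Suc (M * headroom AE q ?z) * q) {p \<in> {..<nS}. ?z = t}" for t
      unfolding N_def by (intro capcard_zero_fibre fin(1)) auto
  qed (use z in auto)
  with nS nE that show ?thesis by blast
qed

lemma solvable_iff_bounded_safe:
  assumes n: "AS \<subseteq> {..<n}" "AE \<subseteq> {..<n}"
  shows "(\<exists>PS PE. finite PS \<and> finite PE \<and> PS \<inter> PE = {} \<and> wins_system PS PE) \<longleftrightarrow>
    (\<exists>nS<Suc (system_bound n q). \<exists>nE<Suc (token_bound n q).
      \<exists>X. (\<lambda>_ _. 0) \<in> X \<and> safe {..<nS} {nS..<nS + nE} X)"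
proof
  assume "\<exists>PS PE. finite PS \<and> finite PE \<and> PS \<inter> PE = {} \<and> wins_system PS PE"
  then obtain PS PE S where P: "finite PS" "finite PE" "PS \<inter> PE = {}"
    and S: "is_strategy (AS \<times> PS) (AE \<times> PE) S" "winning AS AE PS PE \<phi> S"
    by (auto simp: wins_system_def)
  have "history PS PE S []" by (simp add: history_def)
  moreover have "conf q [] = (\<lambda>_ _. 0)" by (simp add: conf_def fun_eq_iff)
  ultimately have "wins PS PE (\<lambda>_ _. 0)" using wins_if_winning_strategy[OF S P] by metis
  then obtain nS nE where b: "nS \<le> system_bound n q" "nE \<le> token_bound n q"
    "wins {..<nS} {nS..<nS + nE} (\<lambda>_ _. 0)"
    using wins_bounded[OF _ P n] by blast
  obtain X where "(\<lambda>_ _. 0) \<in> X" "safe {..<nS} {nS..<nS + nE} X"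
    by (rule safe_if_wins[OF b(3)]) (auto simp: locs_def)
  with b(1,2) show "\<exists>nS<Suc (system_bound n q). \<exists>nE<Suc (token_bound n q).
      \<exists>X. (\<lambda>_ _. 0) \<in> X \<and> safe {..<nS} {nS..<nS + nE} X"
    unfolding less_Suc_eq_le by blast
next
  assume "\<exists>nS<Suc (system_bound n q). \<exists>nE<Suc (token_bound n q).
      \<exists>X. (\<lambda>_ _. 0) \<in> X \<and> safe {..<nS} {nS..<nS + nE} X"
  then obtain nS nE X where "(\<lambda>_ _. 0) \<in> X" "safe {..<nS} {nS..<nS + nE} X" by blast
  then have "wins_system {..<nS} {nS..<nS + nE}" by (rule wins_system_if_safe) auto
  then show "\<exists>PS PE. finite PS \<and> finite PE \<and> PS \<inter> PE = {} \<and> wins_system PS PE"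
    by (intro exI[of _ "{..<nS}"] exI[of _ "{nS..<nS + nE}"]) auto
qed

end

section \<open>Digit codes\<close>

text \<open>Digit sequences code configurations, in base \<open>Suc q\<close>, and valuations, in a
  base above all element codes.\<close>

definition dig :: "nat \<Rightarrow> nat \<Rightarrow> nat \<Rightarrow> nat" where
  "dig b v i = v div b ^ i mod b"

lemma dig_less: "0 < b \<Longrightarrow> dig b v i < b"
  by (simp add: dig_def)

lemma dig_0 [simp]: "dig b 0 i = 0"
  by (simp add: dig_def)

lemma dig_eq_0: "v < b ^ n \<Longrightarrow> n \<le> i \<Longrightarrow> dig b v i = 0"
proof (cases "b = 0")
  case False
  assume "v < b ^ n" "n \<le> i"
  with False have "v < b ^ i" using power_increasing[of n i b] by simp
  then show ?thesis by (simp add: dig_def)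
qed (simp add: dig_def power_0_left split: if_splits)

lemma digits_exist:
  assumes "0 < b" "\<And>i. i < n \<Longrightarrow> g i < b"
  shows "\<exists>v<b ^ n. \<forall>i<n. dig b v i = g i"
  using assms(2)
proof (induction n)
  case (Suc n)
  then obtain v where v: "v < b ^ n" "\<forall>i<n. dig b v i = g i" by auto
  define w where "w = v + g n * b ^ n"
  have "w < b ^ n + g n * b ^ n" using v by (simp add: w_def)
  also have "\<dots> \<le> b ^ Suc n" using Suc.prems[of n] mult_le_mono1[of "Suc (g n)" b "b ^ n"] by simp
  finally have "w < b ^ Suc n" .
  moreover have "dig b w i = g i" if "i < Suc n" for i
  proof (cases "i = n")
    case True
    with v Suc.prems[of n] assms(1) show ?thesis by (simp add: dig_def w_def)
  next
    case False
    with that have i: "n = i + Suc (n - Suc i)" "i < n" by auto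
    have "w = v + b ^ i * (b * (g n * b ^ (n - Suc i)))"
      unfolding w_def by (subst (2) i(1)) (simp only: power_add power_Suc mult_ac)
    then have "dig b w i = dig b v i" using assms(1) by (simp add: dig_def)
    with v i show ?thesis by simp
  qed
  ultimately show ?case by blast
qed simp

text \<open>All digits from \<open>n\<close> on vanish, so a bounded test decides equality of
  functions. The left side is written without a conditional to fit the closure rules.\<close>

lemma dig_fun_upd_iff:
  assumes "v < b ^ n" "v' < b ^ n" "x < n"
  shows "(\<forall>i<n. (i = x \<and> dig b v' i = e) \<or> (i \<noteq> x \<and> dig b v' i = dig b v i)) \<longleftrightarrow>
    dig b v' = (dig b v)(x := e)"
proof
  assume *: "\<forall>i<n. (i = x \<and> dig b v' i = e) \<or> (i \<noteq> x \<and> dig b v' i = dig b v i)"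
  show "dig b v' = (dig b v)(x := e)"
  proof
    fix i show "dig b v' i = ((dig b v)(x := e)) i"
      using * assms dig_eq_0[OF assms(1), of i] dig_eq_0[OF assms(2), of i] by (cases "i < n") auto
  qed
next
  assume "dig b v' = (dig b v)(x := e)"
  then show "\<forall>i<n. (i = x \<and> dig b v' i = e) \<or> (i \<noteq> x \<and> dig b v' i = dig b v i)" by simp
qed

lemma dig_fun_upd_exists:
  assumes "v < b ^ n" "x < n" "e < b"
  shows "\<exists>v'<b ^ n. dig b v' = (dig b v)(x := e)"
proof -
  have b: "0 < b" using assms(3) by simp
  have "((dig b v)(x := e)) i < b" for i using dig_less[OF b] assms(3) by simp
  then obtain v' where "v' < b ^ n" "\<forall>i<n. dig b v' i = ((dig b v)(x := e)) i"
    using digits_exist[OF b, of n "(dig b v)(x := e)"] by blast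
  moreover from this have "dig b v' = (dig b v)(x := e)"
    using dig_fun_upd_iff[OF assms(1) _ assms(2), of v' e] by auto
  ultimately show ?thesis by blast
qed

section \<open>Safe sets as numbers\<close>

definition conf_of :: "nat \<Rightarrow> nat \<Rightarrow> nat \<Rightarrow> nat \<Rightarrow> nat" where
  "conf_of q c p a = dig (Suc q) c (pr p a)"

lemma pr_mono: "x \<le> x' \<Longrightarrow> y \<le> y' \<Longrightarrow> pr x y \<le> pr x' y'"
  unfolding prod_encode_def by (auto intro: add_mono triangle_mono)

context synthesis
begin

lemma conf_of_inc_iff:
  "conf_of q c' = inc (conf_of q c) p a \<longleftrightarrow>
    dig (Suc q) c' = (dig (Suc q) c)(pr p a := Suc (dig (Suc q) c (pr p a)))"
proof
  assume L: "conf_of q c' = inc (conf_of q c) p a"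
  show "dig (Suc q) c' = (dig (Suc q) c)(pr p a := Suc (dig (Suc q) c (pr p a)))"
  proof
    fix i
    have "i = pr p a \<longleftrightarrow> p1 i = p \<and> p2 i = a" using pr_p1_p2[of i] by auto
    then show "dig (Suc q) c' i = ((dig (Suc q) c)(pr p a := Suc (dig (Suc q) c (pr p a)))) i"
      using fun_cong[OF fun_cong[OF L], of "p1 i" "p2 i"] by (auto simp: conf_of_def inc_apply)
  qed
next
  assume "dig (Suc q) c' = (dig (Suc q) c)(pr p a := Suc (dig (Suc q) c (pr p a)))"
  then show "conf_of q c' = inc (conf_of q c) p a" by (auto simp: conf_of_def inc_apply fun_eq_iff)
qed

text \<open>\<open>safe\<close> with all its quantifiers bounded: \<open>X\<close> codes a set of
  codes of configurations, and the processes are two adjacent intervals.\<close>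

definition safe_code :: "nat \<Rightarrow> nat \<Rightarrow> nat \<Rightarrow> nat \<Rightarrow> nat \<Rightarrow> bool" where
  "safe_code n nS nE B X \<longleftrightarrow> 0 \<in> set_decode X \<and> (\<forall>c<B. c \<in> set_decode X \<longrightarrow>
    (\<forall>p<nS + nE. \<forall>a<n. nS \<le> p \<and> a \<in> AE \<and> dig (Suc q) c (pr p a) < q \<longrightarrow>
      (\<exists>c'<B. c' \<in> set_decode X \<and> conf_of q c' = inc (conf_of q c) p a)) \<and>
    (good \<phi> {..<nS} {nS..<nS + nE} (conf_of q c) \<or>
      (\<exists>p<nS. \<exists>a<n. a \<in> AS \<and> dig (Suc q) c (pr p a) < q \<and>
        (\<exists>c'<B. c' \<in> set_decode X \<and> conf_of q c' = inc (conf_of q c) p a))))"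

text \<open>\<open>B\<close> has room for every digit \<open>pr p a\<close> that an increment can
  touch, so coded configurations stay coded. Members of a safe set without a code can therefore be
  dropped.\<close>

lemma ex_safe_iff_ex_safe_code:
  assumes n: "AS \<subseteq> {..<n}" "AE \<subseteq> {..<n}" and B: "B = Suc q ^ Suc (pr (nS + nE) n)"
  shows "(\<exists>X. (\<lambda>_ _. 0) \<in> X \<and> safe {..<nS} {nS..<nS + nE} X) \<longleftrightarrow>
    (\<exists>X<2 ^ B. safe_code n nS nE B X)"
proof
  assume "\<exists>X. (\<lambda>_ _. 0) \<in> X \<and> safe {..<nS} {nS..<nS + nE} X"
  then obtain X where X: "(\<lambda>_ _. 0) \<in> X" "safe {..<nS} {nS..<nS + nE} X" by blast
  define Y where "Y = set_encode {c. c < B \<and> conf_of q c \<in> X}"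
  have Y: "set_decode Y = {c. c < B \<and> conf_of q c \<in> X}" by (simp add: Y_def)
  have "Y < 2 ^ B" unfolding Y_def by (rule set_encode_less) auto
  have ex: "\<exists>c'<B. c' \<in> set_decode Y \<and> conf_of q c' = inc (conf_of q c) p a"
    if c: "c < B" "dig (Suc q) c (pr p a) < q" "inc (conf_of q c) p a \<in> X" and pa: "p < nS + nE" "a < n"
    for c p a
  proof -
    have "pr p a < Suc (pr (nS + nE) n)" using pr_mono[of p "nS + nE" a n] pa by simp
    from dig_fun_upd_exists[OF c(1)[unfolded B] this, of "Suc (dig (Suc q) c (pr p a))"] c(2)
    obtain c' where "c' < B" "conf_of q c' = inc (conf_of q c) p a"
      unfolding conf_of_inc_iff B by auto
    with c(3) show ?thesis by (auto simp: Y)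
  qed
  have "safe_code n nS nE B Y"
    unfolding safe_code_def
  proof (intro conjI allI impI)
    have "conf_of q 0 = (\<lambda>_ _. 0)" by (simp add: conf_of_def fun_eq_iff)
    then show "0 \<in> set_decode Y" using X(1) by (simp add: Y B)
    fix c assume c: "c < B" "c \<in> set_decode Y"
    then have cX: "conf_of q c \<in> X" by (simp add: Y)
    show "\<exists>c'<B. c' \<in> set_decode Y \<and> conf_of q c' = inc (conf_of q c) p a"
      if "p < nS + nE" "a < n" "nS \<le> p \<and> a \<in> AE \<and> dig (Suc q) c (pr p a) < q" for p a
      using that X(2) cX by (intro ex c) (auto simp: safe_def conf_of_def)
    show "good \<phi> {..<nS} {nS..<nS + nE} (conf_of q c) \<or>
      (\<exists>p<nS. \<exists>a<n. a \<in> AS \<and> dig (Suc q) c (pr p a) < q \<and>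
        (\<exists>c'<B. c' \<in> set_decode Y \<and> conf_of q c' = inc (conf_of q c) p a))"
    proof (cases "good \<phi> {..<nS} {nS..<nS + nE} (conf_of q c)")
      case False
      with X(2) cX obtain p a where pa: "p < nS" "a \<in> AS" "conf_of q c p a < q" "inc (conf_of q c) p a \<in> X"
        by (auto simp: safe_def)
      then have "a < n" "dig (Suc q) c (pr p a) < q" using n by (auto simp: conf_of_def)
      with pa ex[OF c(1), of p a] show ?thesis by auto
    qed simp
  qed
  with \<open>Y < 2 ^ B\<close> show "\<exists>X<2 ^ B. safe_code n nS nE B X" by blast
next
  assume "\<exists>X<2 ^ B. safe_code n nS nE B X"
  then obtain Y where Y: "safe_code n nS nE B Y" by blast
  define X where "X = conf_of q ` {c. c < B \<and> c \<in> set_decode Y}"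
  have "safe {..<nS} {nS..<nS + nE} X"
    unfolding safe_def
  proof
    fix d assume "d \<in> X"
    then obtain c where c: "d = conf_of q c" "c < B" "c \<in> set_decode Y" by (auto simp: X_def)
    have inX: "inc d p a \<in> X" if "\<exists>c'<B. c' \<in> set_decode Y \<and> conf_of q c' = inc d p a" for p a
      using that unfolding X_def by force
    have "\<forall>p\<in>{nS..<nS + nE}. \<forall>a\<in>AE. d p a < q \<longrightarrow> inc d p a \<in> X"
    proof (intro ballI impI inX)
      fix p a assume "p \<in> {nS..<nS + nE}" "a \<in> AE" "d p a < q"
      moreover from this n have "a < n" by auto
      ultimately show "\<exists>c'<B. c' \<in> set_decode Y \<and> conf_of q c' = inc d p a"
        using Y c unfolding safe_code_def by (auto simp: conf_of_def)
    qed
    moreover have "good \<phi> {..<nS} {nS..<nS + nE} d \<or> (\<exists>p\<in>{..<nS}. \<exists>a\<in>AS. d p a < q \<and> inc d p a \<in> X)"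
    proof (cases "good \<phi> {..<nS} {nS..<nS + nE} d")
      case False
      with Y c(2,3) have "\<exists>p<nS. \<exists>a<n. a \<in> AS \<and> dig (Suc q) c (pr p a) < q \<and>
          (\<exists>c'<B. c' \<in> set_decode Y \<and> conf_of q c' = inc (conf_of q c) p a)"
        unfolding safe_code_def c(1) by blast
      then obtain p a where "p < nS" "a \<in> AS" "d p a < q"
          "\<exists>c'<B. c' \<in> set_decode Y \<and> conf_of q c' = inc d p a"
        unfolding c(1) conf_of_def by blast
      with inX show ?thesis by auto
    qed simp
    ultimately show "(\<forall>p\<in>{nS..<nS + nE}. \<forall>a\<in>AE. d p a < q \<longrightarrow> inc d p a \<in> X) \<and>
      (good \<phi> {..<nS} {nS..<nS + nE} d \<or> (\<exists>p\<in>{..<nS}. \<exists>a\<in>AS. d p a < q \<and> inc d p a \<in> X))" by blast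
  qed
  moreover have "(\<lambda>_ _. 0) \<in> X"
  proof -
    have "conf_of q 0 = (\<lambda>_ _. 0)" by (simp add: conf_of_def fun_eq_iff)
    moreover have "0 \<in> set_decode Y" "0 < B" using Y by (simp_all add: safe_code_def B)
    ultimately show ?thesis unfolding X_def by force
  qed
  ultimately show "\<exists>X. (\<lambda>_ _. 0) \<in> X \<and> safe {..<nS} {nS..<nS + nE} X" by blast
qed

end

section \<open>Computability on codes of formulas\<close>

text \<open>Not every number codes a formula, so codes must be recognised first; the same recursion
  checks the actions.\<close>

definition wf_code :: "nat \<Rightarrow> nat \<Rightarrow> nat \<Rightarrow> bool" where
  "wf_code as ae y \<longleftrightarrow> (\<exists>\<phi>. fm_encode \<phi> = y \<and> actions \<phi> \<subseteq> set_decode as \<union> set_decode ae)"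

text \<open>Nonzero tags make subformulas have smaller codes. The tag 0 belongs to
  \<open>Act\<close>, which has no subformula.\<close>

lemma less_pr: "0 < t \<Longrightarrow> r < pr t r"
  unfolding prod_encode_def using triangle_mono[of "Suc r" "t + r"] by (auto simp: Suc_le_eq intro: less_le_trans)

lemma less_pr_p2: "p1 y \<noteq> 0 \<Longrightarrow> p2 y < y"
  using less_pr[of "p1 y" "p2 y"] by simp

lemma p1_le: "p1 y \<le> y" and p2_le: "p2 y \<le> y"
  using le_prod_encode_1[of "p1 y" "p2 y"] le_prod_encode_2[of "p2 y" "p1 y"] by simp_all

lemma fm_encode_cases:
  "fm_encode \<phi> = y \<longleftrightarrow>
    p1 y = 0 \<and> \<phi> = Act (p1 (p2 y)) (p2 (p2 y)) \<or> p1 y = 1 \<and> \<phi> = Eq (p1 (p2 y)) (p2 (p2 y)) \<or>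
    p1 y = 2 \<and> \<phi> = Sim (p1 (p2 y)) (p2 (p2 y)) \<or> p1 y = 3 \<and> \<phi> = SysProc (p2 y) \<or>
    p1 y = 4 \<and> \<phi> = EnvProc (p2 y) \<or> p1 y = 5 \<and> \<phi> = SharedProc (p2 y) \<or>
    p1 y = 6 \<and> (\<exists>\<psi>. \<phi> = Neg \<psi> \<and> fm_encode \<psi> = p2 y) \<or>
    p1 y = 7 \<and> (\<exists>\<psi> \<chi>. \<phi> = Conj \<psi> \<chi> \<and> fm_encode \<psi> = p1 (p2 y) \<and> fm_encode \<chi> = p2 (p2 y)) \<or>
    p1 y = 8 \<and> (\<exists>\<psi> \<chi>. \<phi> = Disj \<psi> \<chi> \<and> fm_encode \<psi> = p1 (p2 y) \<and> fm_encode \<chi> = p2 (p2 y)) \<or>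
    p1 y = 9 \<and> (\<exists>\<psi>. \<phi> = Exists (p1 (p2 y)) \<psi> \<and> fm_encode \<psi> = p2 (p2 y)) \<or>
    p1 y = 10 \<and> (\<exists>\<psi>. \<phi> = Forall (p1 (p2 y)) \<psi> \<and> fm_encode \<psi> = p2 (p2 y))"
proof -
  have y: "pr x z = y \<longleftrightarrow> x = p1 y \<and> z = p2 y" for x y z using pr_p1_p2[of y] by auto
  show ?thesis by (cases \<phi>) (auto simp: y)
qed

text \<open>One unfolding of \<open>wf_code\<close>, with the answers for subformulas looked up in
  the table \<open>T\<close>.\<close>

definition wf_step :: "nat \<Rightarrow> nat \<Rightarrow> nat \<Rightarrow> nat \<Rightarrow> bool" where
  "wf_step as ae T y \<longleftrightarrow>
    p1 y = 0 \<and> (p1 (p2 y) \<in> set_decode as \<or> p1 (p2 y) \<in> set_decode ae) \<or>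
    p1 y = 1 \<or> p1 y = 2 \<or> p1 y = 3 \<or> p1 y = 4 \<or> p1 y = 5 \<or>
    p1 y = 6 \<and> p2 y \<in> set_decode T \<or>
    (p1 y = 7 \<or> p1 y = 8) \<and> p1 (p2 y) \<in> set_decode T \<and> p2 (p2 y) \<in> set_decode T \<or>
    (p1 y = 9 \<or> p1 y = 10) \<and> p2 (p2 y) \<in> set_decode T"

lemma wf_code_unfold:
  "wf_code as ae y \<longleftrightarrow>
    p1 y = 0 \<and> (p1 (p2 y) \<in> set_decode as \<or> p1 (p2 y) \<in> set_decode ae) \<or>
    p1 y = 1 \<or> p1 y = 2 \<or> p1 y = 3 \<or> p1 y = 4 \<or> p1 y = 5 \<or>
    p1 y = 6 \<and> wf_code as ae (p2 y) \<or>
    (p1 y = 7 \<or> p1 y = 8) \<and> wf_code as ae (p1 (p2 y)) \<and> wf_code as ae (p2 (p2 y)) \<or>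
    (p1 y = 9 \<or> p1 y = 10) \<and> wf_code as ae (p2 (p2 y))"
  (is "_ \<longleftrightarrow> ?R")
proof
  assume "wf_code as ae y"
  then obtain \<phi> where "fm_encode \<phi> = y" "actions \<phi> \<subseteq> set_decode as \<union> set_decode ae"
    by (auto simp: wf_code_def)
  then show ?R unfolding fm_encode_cases[of \<phi> y] wf_code_def by (elim disjE conjE exE) auto
next
  have actions: "fm_encode \<psi> = x \<Longrightarrow> actions \<psi> \<subseteq> set_decode as \<union> set_decode ae \<Longrightarrow> wf_code as ae x" for \<psi> x
    by (auto simp: wf_code_def)
  have e: "pr x z = y \<longleftrightarrow> x = p1 y \<and> z = p2 y" for x y z using pr_p1_p2[of y] by auto
  note intros = actions[of "Act (p1 (p2 y)) (p2 (p2 y))"] actions[of "Eq (p1 (p2 y)) (p2 (p2 y))"]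
    actions[of "Sim (p1 (p2 y)) (p2 (p2 y))"] actions[of "SysProc (p2 y)"] actions[of "EnvProc (p2 y)"]
    actions[of "SharedProc (p2 y)"]
  assume ?R
  then consider "p1 y \<in> {0, 1, 2, 3, 4, 5}" "p1 y = 0 \<longrightarrow> p1 (p2 y) \<in> set_decode as \<or> p1 (p2 y) \<in> set_decode ae"
    | "p1 y = 6" "wf_code as ae (p2 y)"
    | "p1 y = 7 \<or> p1 y = 8" "wf_code as ae (p1 (p2 y))" "wf_code as ae (p2 (p2 y))"
    | "p1 y = 9 \<or> p1 y = 10" "wf_code as ae (p2 (p2 y))" by auto
  then show "wf_code as ae y"
  proof cases
    case 1
    then show ?thesis by (auto intro: intros simp: e)
  next
    case 2
    then obtain \<psi> where "fm_encode \<psi> = p2 y" "actions \<psi> \<subseteq> set_decode as \<union> set_decode ae"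
      by (auto simp: wf_code_def)
    with 2 actions[of "Neg \<psi>" y] show ?thesis by (simp add: e)
  next
    case 3
    then obtain \<psi> \<chi> where "fm_encode \<psi> = p1 (p2 y)" "actions \<psi> \<subseteq> set_decode as \<union> set_decode ae"
      "fm_encode \<chi> = p2 (p2 y)" "actions \<chi> \<subseteq> set_decode as \<union> set_decode ae"
      by (auto simp: wf_code_def)
    with 3 actions[of "Conj \<psi> \<chi>" y] actions[of "Disj \<psi> \<chi>" y] show ?thesis by (auto simp: e)
  next
    case 4
    then obtain \<psi> where "fm_encode \<psi> = p2 (p2 y)" "actions \<psi> \<subseteq> set_decode as \<union> set_decode ae"
      by (auto simp: wf_code_def)
    with 4 actions[of "Exists (p1 (p2 y)) \<psi>" y] actions[of "Forall (p1 (p2 y)) \<psi>" y]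
    show ?thesis by (auto simp: e)
  qed
qed

lemma computable_wf_code [comp_intros]:
  assumes "computable a" "computable b" "computable c"
  shows "computable_pred (\<lambda>x. wf_code (a x) (b x) (c x))"
proof -
  have "computable_pred (\<lambda>x. True \<and> wf_code (p1 x) (p1 (p2 x)) (p2 (p2 x)))"
  proof (rule computable_pred_table[where D = "\<lambda>_ _. True" and k = "\<lambda>x. p2 (p2 x)" and
        S = "\<lambda>y x. wf_code (p1 x) (p1 (p2 x)) y" and P = "\<lambda>T y x. wf_step (p1 x) (p1 (p2 x)) T y" and
        bd = "\<lambda>x. Suc (p2 (p2 x))" and m = "\<lambda>y. y"])
    show "computable (\<lambda>x. Suc (p2 (p2 x)))" "computable_pred (\<lambda>_. True)" "computable (\<lambda>x. p2 (p2 x))"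
      by (intro comp_intros)+
    show "computable_pred (\<lambda>z. wf_step (p1 (p2 (p2 z))) (p1 (p2 (p2 (p2 z)))) (p1 z) (p1 (p2 z)))"
      unfolding wf_step_def by (intro comp_intros)
    fix x y T
    assume "y < Suc (p2 (p2 x))"
      and IH: "\<And>z. z < Suc (p2 (p2 x)) \<Longrightarrow> True \<Longrightarrow> z < y \<Longrightarrow>
        z \<in> set_decode T \<longleftrightarrow> wf_code (p1 x) (p1 (p2 x)) z"
    then have T: "z \<in> set_decode T \<longleftrightarrow> wf_code (p1 x) (p1 (p2 x)) z" if "z < y" for z using that by simp
    have "p1 y \<noteq> 0 \<Longrightarrow> p2 y < y" "p1 y \<noteq> 0 \<Longrightarrow> p1 (p2 y) < y" "p1 y \<noteq> 0 \<Longrightarrow> p2 (p2 y) < y"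
      using less_pr_p2[of y] p1_le[of "p2 y"] p2_le[of "p2 y"] by linarith+
    then show "wf_step (p1 x) (p1 (p2 x)) T y \<longleftrightarrow> wf_code (p1 x) (p1 (p2 x)) y"
      unfolding wf_step_def by (subst wf_code_unfold) (auto simp: T)
  qed simp
  from computable_pred_comp[OF this, of "\<lambda>x. pr (a x) (pr (b x) (c x))"] assms
  show ?thesis by (simp add: comp_intros)
qed

definition free_code :: "nat \<Rightarrow> nat \<Rightarrow> bool" where
  "free_code y v \<longleftrightarrow> (\<exists>\<phi>. fm_encode \<phi> = y \<and> v \<in> free_vars \<phi>)"

definition free_step :: "nat \<Rightarrow> nat \<Rightarrow> nat \<Rightarrow> bool" where
  "free_step T y v \<longleftrightarrow>
    p1 y = 0 \<and> v = p2 (p2 y) \<or> (p1 y = 1 \<or> p1 y = 2) \<and> (v = p1 (p2 y) \<or> v = p2 (p2 y)) \<or>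
    (p1 y = 3 \<or> p1 y = 4 \<or> p1 y = 5) \<and> v = p2 y \<or>
    p1 y = 6 \<and> pr (p2 y) v \<in> set_decode T \<or>
    (p1 y = 7 \<or> p1 y = 8) \<and> (pr (p1 (p2 y)) v \<in> set_decode T \<or> pr (p2 (p2 y)) v \<in> set_decode T) \<or>
    (p1 y = 9 \<or> p1 y = 10) \<and> v \<noteq> p1 (p2 y) \<and> pr (p2 (p2 y)) v \<in> set_decode T"

lemma free_code_fm [simp]: "free_code (fm_encode \<phi>) v \<longleftrightarrow> v \<in> free_vars \<phi>"
  by (auto simp: free_code_def fm_encode_inject)

lemma wf_code_fm [simp]: "wf_code as ae (fm_encode \<phi>) \<longleftrightarrow> actions \<phi> \<subseteq> set_decode as \<union> set_decode ae"
  by (auto simp: wf_code_def fm_encode_inject)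

lemma less_pr_fm:
  "fm_encode \<phi> < fm_encode (Neg \<phi>)"
  "fm_encode \<phi> < fm_encode (Conj \<phi> \<psi>)" "fm_encode \<psi> < fm_encode (Conj \<phi> \<psi>)"
  "fm_encode \<phi> < fm_encode (Disj \<phi> \<psi>)" "fm_encode \<psi> < fm_encode (Disj \<phi> \<psi>)"
  "x < fm_encode (Exists x \<phi>)" "fm_encode \<phi> < fm_encode (Exists x \<phi>)"
  "x < fm_encode (Forall x \<phi>)" "fm_encode \<phi> < fm_encode (Forall x \<phi>)"
  by (auto intro: less_pr le_less_trans[OF le_prod_encode_1 less_pr] le_less_trans[OF le_prod_encode_2 less_pr])

lemma pr_less_mono1: "x < x' \<Longrightarrow> pr x v < pr x' v"
  using pr_mono[of x x' v v] by (simp add: le_less)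

text \<open>The conjunction with \<open>wf_code\<close> is the guard \<open>D\<close> of the table,
  whose equations determine an entry only at codes of formulas.\<close>

lemma computable_free_code [comp_intros]:
  assumes "computable a" "computable b" "computable c" "computable d"
  shows "computable_pred (\<lambda>x. wf_code (a x) (b x) (c x) \<and> free_code (c x) (d x))"
proof -
  have "computable_pred (\<lambda>x. wf_code (p1 x) (p1 (p2 x)) (p1 (p2 (p2 x))) \<and>
    free_code (p1 (p2 (p2 x))) (p2 (p2 (p2 x))))"
  \<comment> \<open>Entries are pairs of a code and a variable. A subformula is looked up with the
    same variable, hence at a smaller entry, so the queried pair itself bounds the table.\<close>
  proof (rule computable_pred_table[where D = "\<lambda>y x. wf_code (p1 x) (p1 (p2 x)) (p1 y)" and
        k = "\<lambda>x. p2 (p2 x)" and S = "\<lambda>y x. free_code (p1 y) (p2 y)" and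
        P = "\<lambda>T y x. free_step T (p1 y) (p2 y)" and
        bd = "\<lambda>x. Suc (p2 (p2 x))" and m = "\<lambda>y. p1 y"])
    show "computable (\<lambda>x. Suc (p2 (p2 x)))" "computable (\<lambda>x. p2 (p2 x))"
      "computable_pred (\<lambda>z. wf_code (p1 (p2 z)) (p1 (p2 (p2 z))) (p1 (p1 z)))"
      by (intro comp_intros)+
    show "computable_pred (\<lambda>z. free_step (p1 z) (p1 (p1 (p2 z))) (p2 (p1 (p2 z))))"
      unfolding free_step_def by (intro comp_intros)
    fix x y T
    assume bd: "y < Suc (p2 (p2 x))" and D: "wf_code (p1 x) (p1 (p2 x)) (p1 y)"
      and IH: "\<And>z. z < Suc (p2 (p2 x)) \<Longrightarrow> wf_code (p1 x) (p1 (p2 x)) (p1 z) \<Longrightarrow> p1 z < p1 y \<Longrightarrow>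
        z \<in> set_decode T \<longleftrightarrow> free_code (p1 z) (p2 z)"
    obtain \<phi> where \<phi>: "p1 y = fm_encode \<phi>" "actions \<phi> \<subseteq> set_decode (p1 x) \<union> set_decode (p1 (p2 x))"
      using D unfolding wf_code_def by metis
    have T: "pr (fm_encode \<psi>) (p2 y) \<in> set_decode T \<longleftrightarrow> p2 y \<in> free_vars \<psi>"
      if "fm_encode \<psi> < fm_encode \<phi>" "actions \<psi> \<subseteq> set_decode (p1 x) \<union> set_decode (p1 (p2 x))" for \<psi>
    proof -
      have "pr (fm_encode \<psi>) (p2 y) < y"
        using pr_less_mono1[OF that(1), of "p2 y"] \<phi>(1) by (metis pr_p1_p2)
      then show ?thesis using IH[of "pr (fm_encode \<psi>) (p2 y)"] that bd \<phi>(1) by simp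
    qed
    have "free_step T (fm_encode \<phi>) (p2 y) \<longleftrightarrow> p2 y \<in> free_vars \<phi>"
    proof (cases \<phi>)
      case (Neg \<psi>)
      then show ?thesis using \<phi>(2) T[of \<psi>] less_pr_fm(1)[of \<psi>] by (simp add: free_step_def)
    next
      case (Conj \<psi> \<chi>)
      then show ?thesis using \<phi>(2) T[of \<psi>] T[of \<chi>] less_pr_fm(2,3)[of \<psi> \<chi>]
        less_pr_fm(3)[of \<chi> \<psi>] by (simp add: free_step_def)
    next
      case (Disj \<psi> \<chi>)
      then show ?thesis using \<phi>(2) T[of \<psi>] T[of \<chi>] less_pr_fm(4)[of \<psi> \<chi>]
        less_pr_fm(5)[of \<chi> \<psi>] by (simp add: free_step_def)
    next
      case (Exists z \<psi>)
      then show ?thesis using \<phi>(2) T[of \<psi>] less_pr_fm(7)[of \<psi> z] by (auto simp: free_step_def)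
    next
      case (Forall z \<psi>)
      then show ?thesis using \<phi>(2) T[of \<psi>] less_pr_fm(9)[of \<psi> z] by (auto simp: free_step_def)
    qed (auto simp: free_step_def)
    then show "free_step T (p1 y) (p2 y) \<longleftrightarrow> free_code (p1 y) (p2 y)"
      unfolding \<phi>(1) free_code_fm .
  qed simp
  from computable_pred_comp[OF this, of "\<lambda>x. pr (a x) (pr (b x) (pr (c x) (d x)))"] assms
  show ?thesis by (simp add: comp_intros)
qed

section \<open>Model checking on codes\<close>

definition dom_code :: "nat \<Rightarrow> nat \<Rightarrow> nat \<Rightarrow> nat \<Rightarrow> bool" where
  "dom_code q np c e \<longleftrightarrow> p1 e < np \<and>
    (p2 e = 0 \<or> p2 (p2 e - 1) < dig (Suc q) c (pr (p1 e) (p1 (p2 e - 1))))"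

lemma dom_code_iff: "dom_code q (nS + nE) c e \<longleftrightarrow> e \<in> conf_domain {..<nS} {nS..<nS + nE} (conf_of q c)"
  by (auto simp: dom_code_def conf_domain_def conf_of_def)

text \<open>It bounds the search for elements and is also the base in which valuations are
  coded.\<close>

definition elem_bound :: "nat \<Rightarrow> nat \<Rightarrow> nat \<Rightarrow> nat" where
  "elem_bound q np c = Suc (pr np (Suc (pr c (Suc q))))"

text \<open>An action that occurs has a nonzero digit at \<open>pr p a\<close>, which forces
  \<open>pr p a \<le> c\<close>; so \<open>c\<close> itself bounds the actions.\<close>

lemma dom_code_less:
  assumes "0 < q" "dom_code q np c e"
  shows "e < elem_bound q np c"
proof -
  have "p2 e \<le> Suc (pr c (Suc q))"
  proof (cases "p2 e")
    case (Suc z)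
    with assms(2) have z: "p2 z < dig (Suc q) c (pr (p1 e) (p1 z))" by (simp add: dom_code_def)
    have "pr (p1 e) (p1 z) \<le> c"
    proof (rule ccontr)
      assume "\<not> ?thesis"
      then have "c < pr (p1 e) (p1 z)" by simp
      also have "\<dots> < Suc q ^ pr (p1 e) (p1 z)" using assms(1) by (intro power_gt_expt) simp
      finally have "dig (Suc q) c (pr (p1 e) (p1 z)) = 0" by (rule dig_eq_0) simp
      with z show False by simp
    qed
    then have "p1 z \<le> c" using le_prod_encode_2[of "p1 z" "p1 e"] by linarith
    moreover have "p2 z \<le> Suc q" using z dig_less[of "Suc q" c "pr (p1 e) (p1 z)"] by simp
    ultimately have "pr (p1 z) (p2 z) \<le> pr c (Suc q)" by (rule pr_mono)
    with Suc show ?thesis by simp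
  qed simp
  moreover have "p1 e \<le> np" using assms(2) by (simp add: dom_code_def)
  ultimately have "pr (p1 e) (p2 e) \<le> pr np (Suc (pr c (Suc q)))" by (intro pr_mono)
  then show ?thesis by (simp add: elem_bound_def)
qed

definition upd_code :: "nat \<Rightarrow> nat \<Rightarrow> nat \<Rightarrow> nat \<Rightarrow> nat \<Rightarrow> nat \<Rightarrow> bool" where
  "upd_code b m v z e v' \<longleftrightarrow>
    (\<forall>i<m. (i = z \<and> dig b v' i = e) \<or> (i \<noteq> z \<and> dig b v' i = dig b v i))"

text \<open>Valuations have \<open>Suc f\<close> digits, where the code \<open>f\<close> of the
  whole formula bounds its variables. An updated valuation is determined as a function, so an
  existential search finds it in the universal case too. Tag 5 is the constantly false
  \<open>SharedProc\<close>.\<close>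

definition sat_step :: "nat \<Rightarrow> nat \<Rightarrow> nat \<Rightarrow> nat \<Rightarrow> nat \<Rightarrow> nat \<Rightarrow> nat \<Rightarrow> nat \<Rightarrow> nat \<Rightarrow> bool" where
  "sat_step q nS nE c f b T y v \<longleftrightarrow>
    p1 y = 0 \<and> p2 (dig b v (p2 (p2 y))) \<noteq> 0 \<and> p1 (p2 (dig b v (p2 (p2 y))) - 1) = p1 (p2 y) \<or>
    p1 y = 1 \<and> dig b v (p1 (p2 y)) = dig b v (p2 (p2 y)) \<or>
    p1 y = 2 \<and> p1 (dig b v (p1 (p2 y))) = p1 (dig b v (p2 (p2 y))) \<or>
    p1 y = 3 \<and> p2 (dig b v (p2 y)) = 0 \<and> p1 (dig b v (p2 y)) < nS \<or>
    p1 y = 4 \<and> p2 (dig b v (p2 y)) = 0 \<and> nS \<le> p1 (dig b v (p2 y)) \<and> p1 (dig b v (p2 y)) < nS + nE \<or>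
    p1 y = 6 \<and> \<not> pr (p2 y) v \<in> set_decode T \<or>
    p1 y = 7 \<and> pr (p1 (p2 y)) v \<in> set_decode T \<and> pr (p2 (p2 y)) v \<in> set_decode T \<or>
    p1 y = 8 \<and> (pr (p1 (p2 y)) v \<in> set_decode T \<or> pr (p2 (p2 y)) v \<in> set_decode T) \<or>
    p1 y = 9 \<and> (\<exists>e<b. dom_code q (nS + nE) c e \<and> (\<exists>v'<b ^ Suc f.
      upd_code b (Suc f) v (p1 (p2 y)) e v' \<and> pr (p2 (p2 y)) v' \<in> set_decode T)) \<or>
    p1 y = 10 \<and> (\<forall>e<b. dom_code q (nS + nE) c e \<longrightarrow> (\<exists>v'<b ^ Suc f.
      upd_code b (Suc f) v (p1 (p2 y)) e v' \<and> pr (p2 (p2 y)) v' \<in> set_decode T))"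

definition good_code :: "nat \<Rightarrow> nat \<Rightarrow> nat \<Rightarrow> nat \<Rightarrow> nat \<Rightarrow> bool" where
  "good_code f q nS nE c \<longleftrightarrow>
    (\<exists>\<phi>. fm_encode \<phi> = f \<and> good \<phi> {..<nS} {nS..<nS + nE} (conf_of q c))"

lemma good_code_fm [simp]:
  "good_code (fm_encode \<phi>) q nS nE c \<longleftrightarrow> good \<phi> {..<nS} {nS..<nS + nE} (conf_of q c)"
  by (auto simp: good_code_def fm_encode_inject)

definition sat_code :: "nat \<Rightarrow> nat \<Rightarrow> nat \<Rightarrow> nat \<Rightarrow> nat \<Rightarrow> nat \<Rightarrow> nat \<Rightarrow> bool" where
  "sat_code q nS nE c b y v \<longleftrightarrow> (\<exists>\<phi>. fm_encode \<phi> = y \<and>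
    gsat (conf_domain {..<nS} {nS..<nS + nE} (conf_of q c)) code_act p1 {..<nS} {nS..<nS + nE} (dig b v) \<phi>)"

lemma sat_code_fm [simp]:
  "sat_code q nS nE c b (fm_encode \<phi>) v \<longleftrightarrow>
    gsat (conf_domain {..<nS} {nS..<nS + nE} (conf_of q c)) code_act p1 {..<nS} {nS..<nS + nE} (dig b v) \<phi>"
  by (auto simp: sat_code_def fm_encode_inject)

lemma sat_step_correct:
  assumes q: "0 < q" and b: "b = elem_bound q (nS + nE) c" and f: "fm_encode \<phi> \<le> f" and v: "v < b ^ Suc f"
    and T: "\<And>\<psi> v. fm_encode \<psi> < fm_encode \<phi> \<Longrightarrow> actions \<psi> \<subseteq> actions \<phi> \<Longrightarrow> v < b ^ Suc f \<Longrightarrow>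
      pr (fm_encode \<psi>) v \<in> set_decode T \<longleftrightarrow> sat_code q nS nE c b (fm_encode \<psi>) v"
  shows "sat_step q nS nE c f b T (fm_encode \<phi>) v \<longleftrightarrow> sat_code q nS nE c b (fm_encode \<phi>) v"
proof -
  let ?D = "conf_domain {..<nS} {nS..<nS + nE} (conf_of q c)"
  let ?sat = "gsat ?D code_act p1 {..<nS} {nS..<nS + nE}"
  have D: "e < b \<and> dom_code q (nS + nE) c e \<longleftrightarrow> e \<in> ?D" for e
    using dom_code_less[OF q] dom_code_iff unfolding b by blast
  \<comment> \<open>The updated valuation again has a code in the range of the table, as
    \<open>z \<le> f\<close> and \<open>e < b\<close>.\<close>
  have upd: "(\<exists>v'<b ^ Suc f. upd_code b (Suc f) v z e v' \<and> pr (fm_encode \<psi>) v' \<in> set_decode T) \<longleftrightarrow>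
      ?sat ((dig b v)(z := e)) \<psi>"
    if "z < Suc f" "e < b" and \<psi>: "fm_encode \<psi> < fm_encode \<phi>" "actions \<psi> \<subseteq> actions \<phi>" for z e \<psi>
  proof -
    have "(\<exists>v'<b ^ Suc f. upd_code b (Suc f) v z e v' \<and> pr (fm_encode \<psi>) v' \<in> set_decode T) \<longleftrightarrow>
        (\<exists>v'<b ^ Suc f. dig b v' = (dig b v)(z := e) \<and> ?sat (dig b v') \<psi>)"
      using T[OF \<psi>] dig_fun_upd_iff[OF v _ that(1)] unfolding upd_code_def sat_code_fm by blast
    also have "\<dots> \<longleftrightarrow> ?sat ((dig b v)(z := e)) \<psi>"
      using dig_fun_upd_exists[OF v that(1,2)] by metis
    finally show ?thesis .
  qed
  have bex: "(\<exists>e<b. dom_code q (nS + nE) c e \<and> Q e) \<longleftrightarrow> (\<exists>e\<in>?D. R e)"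
    and ball: "(\<forall>e<b. dom_code q (nS + nE) c e \<longrightarrow> Q e) \<longleftrightarrow> (\<forall>e\<in>?D. R e)"
    if "\<And>e. e < b \<Longrightarrow> Q e \<longleftrightarrow> R e" for Q R
    using D that by blast+
  have "sat_step q nS nE c f b T (fm_encode \<phi>) v \<longleftrightarrow> ?sat (dig b v) \<phi>"
  proof (cases \<phi>)
    case (Neg \<psi>)
    then show ?thesis using T[of \<psi> v] v less_pr_fm(1)[of \<psi>] by (simp add: sat_step_def)
  next
    case (Conj \<psi> \<chi>)
    then show ?thesis using T[of \<psi> v] T[of \<chi> v] v less_pr_fm(2)[of \<psi> \<chi>] less_pr_fm(3)[of \<chi> \<psi>]
      by (simp add: sat_step_def)
  next
    case (Disj \<psi> \<chi>)
    then show ?thesis using T[of \<psi> v] T[of \<chi> v] v less_pr_fm(4)[of \<psi> \<chi>] less_pr_fm(5)[of \<chi> \<psi>]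
      by (simp add: sat_step_def)
  next
    case (Exists z \<psi>)
    have "z < Suc f" using less_pr_fm(6)[of z \<psi>] f Exists by simp
    then have "(\<exists>e<b. dom_code q (nS + nE) c e \<and> (\<exists>v'<b ^ Suc f.
        upd_code b (Suc f) v z e v' \<and> pr (fm_encode \<psi>) v' \<in> set_decode T)) \<longleftrightarrow>
        (\<exists>e\<in>?D. ?sat ((dig b v)(z := e)) \<psi>)"
      using upd[OF \<open>z < Suc f\<close> _ less_pr_fm(7)[of \<psi> z, folded Exists]] Exists by (intro bex) simp
    then show ?thesis unfolding Exists by (simp add: sat_step_def)
  next
    case (Forall z \<psi>)
    have "z < Suc f" using less_pr_fm(8)[of z \<psi>] f Forall by simp
    then have "(\<forall>e<b. dom_code q (nS + nE) c e \<longrightarrow> (\<exists>v'<b ^ Suc f.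
        upd_code b (Suc f) v z e v' \<and> pr (fm_encode \<psi>) v' \<in> set_decode T)) \<longleftrightarrow>
        (\<forall>e\<in>?D. ?sat ((dig b v)(z := e)) \<psi>)"
      using upd[OF \<open>z < Suc f\<close> _ less_pr_fm(9)[of \<psi> z, folded Forall]] Forall by (intro ball) simp
    then show ?thesis unfolding Forall by (simp add: sat_step_def)
  qed (auto simp: sat_step_def code_act_def)
  then show ?thesis unfolding sat_code_fm .
qed

text \<open>The threshold has the form \<open>Suc (q x)\<close> because
  \<open>sat_step_correct\<close> needs it to be positive.\<close>

lemma computable_good_code [comp_intros]:
  assumes "computable a" "computable a'" "computable f" "computable q" "computable nS" "computable nE" "computable c"
  shows "computable_pred (\<lambda>x. wf_code (a x) (a' x) (f x) \<and> good_code (f x) (Suc (q x)) (nS x) (nE x) (c x))"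
proof -
  define xa where "xa x = p1 x" for x
  define xb where "xb x = p1 (p2 x)" for x
  define xf where "xf x = p1 (p2 (p2 x))" for x
  define xq where "xq x = Suc (p1 (p2 (p2 (p2 x))))" for x
  define xS where "xS x = p1 (p2 (p2 (p2 (p2 x))))" for x
  define xE where "xE x = p1 (p2 (p2 (p2 (p2 (p2 x)))))" for x
  define xc where "xc x = p2 (p2 (p2 (p2 (p2 (p2 x)))))" for x
  define eb where "eb x = elem_bound (xq x) (xS x + xE x) (xc x)" for x
  note defs = eb_def elem_bound_def xa_def xb_def xf_def xq_def xS_def xE_def xc_def
  have eb: "0 < eb x" for x by (simp add: eb_def elem_bound_def)
  have "computable_pred (\<lambda>x. (wf_code (xa x) (xb x) (p1 (pr (xf x) 0)) \<and> p1 (pr (xf x) 0) \<le> xf x \<and>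
      p2 (pr (xf x) 0) < eb x ^ Suc (xf x)) \<and>
    sat_code (xq x) (xS x) (xE x) (xc x) (eb x) (p1 (pr (xf x) 0)) (p2 (pr (xf x) 0)))"
  \<comment> \<open>Here the second component may grow when a quantifier is unfolded. The table
    therefore covers all valuation codes, and only the formula code serves as measure.\<close>
  proof (rule computable_pred_table[where
        D = "\<lambda>y x. wf_code (xa x) (xb x) (p1 y) \<and> p1 y \<le> xf x \<and> p2 y < eb x ^ Suc (xf x)" and
        k = "\<lambda>x. pr (xf x) 0" and
        S = "\<lambda>y x. sat_code (xq x) (xS x) (xE x) (xc x) (eb x) (p1 y) (p2 y)" and
        P = "\<lambda>T y x. sat_step (xq x) (xS x) (xE x) (xc x) (xf x) (eb x) T (p1 y) (p2 y)" and
        bd = "\<lambda>x. Suc (pr (xf x) (eb x ^ Suc (xf x)))" and m = "\<lambda>y. p1 y"])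
    show "computable (\<lambda>x. Suc (pr (xf x) (eb x ^ Suc (xf x))))" "computable (\<lambda>x. pr (xf x) 0)"
      "computable_pred (\<lambda>z. wf_code (xa (p2 z)) (xb (p2 z)) (p1 (p1 z)) \<and> p1 (p1 z) \<le> xf (p2 z) \<and>
        p2 (p1 z) < eb (p2 z) ^ Suc (xf (p2 z)))"
      unfolding defs by (intro comp_intros)+
    show "computable_pred (\<lambda>z. sat_step (xq (p2 (p2 z))) (xS (p2 (p2 z))) (xE (p2 (p2 z))) (xc (p2 (p2 z)))
        (xf (p2 (p2 z))) (eb (p2 (p2 z))) (p1 z) (p1 (p1 (p2 z))) (p2 (p1 (p2 z))))"
      unfolding defs sat_step_def upd_code_def dom_code_def dig_def by (intro comp_intros)
    show "pr (xf x) 0 < Suc (pr (xf x) (eb x ^ Suc (xf x)))" for x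
      using pr_mono[of "xf x" "xf x" 0 "eb x ^ Suc (xf x)"] by simp
    fix x y T
    assume "y < Suc (pr (xf x) (eb x ^ Suc (xf x)))"
      and D: "wf_code (xa x) (xb x) (p1 y) \<and> p1 y \<le> xf x \<and> p2 y < eb x ^ Suc (xf x)"
      and IH: "\<And>z. z < Suc (pr (xf x) (eb x ^ Suc (xf x))) \<Longrightarrow>
        wf_code (xa x) (xb x) (p1 z) \<and> p1 z \<le> xf x \<and> p2 z < eb x ^ Suc (xf x) \<Longrightarrow> p1 z < p1 y \<Longrightarrow>
        z \<in> set_decode T \<longleftrightarrow> sat_code (xq x) (xS x) (xE x) (xc x) (eb x) (p1 z) (p2 z)"
    obtain \<phi> where \<phi>: "p1 y = fm_encode \<phi>" "actions \<phi> \<subseteq> set_decode (xa x) \<union> set_decode (xb x)"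
      using D unfolding wf_code_def by metis
    show "sat_step (xq x) (xS x) (xE x) (xc x) (xf x) (eb x) T (p1 y) (p2 y) \<longleftrightarrow>
        sat_code (xq x) (xS x) (xE x) (xc x) (eb x) (p1 y) (p2 y)"
      unfolding \<phi>(1)
    proof (rule sat_step_correct)
      show "0 < xq x" by (simp add: xq_def)
      show "eb x = elem_bound (xq x) (xS x + xE x) (xc x)" by (rule eb_def)
      show "fm_encode \<phi> \<le> xf x" "p2 y < eb x ^ Suc (xf x)" using D \<phi>(1) by simp_all
      fix \<psi> v
      assume \<psi>: "fm_encode \<psi> < fm_encode \<phi>" "actions \<psi> \<subseteq> actions \<phi>" and v: "v < eb x ^ Suc (xf x)"
      have le: "fm_encode \<psi> \<le> xf x" using \<psi>(1) D \<phi>(1) by simp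
      have "pr (fm_encode \<psi>) v < Suc (pr (xf x) (eb x ^ Suc (xf x)))"
        using pr_mono[OF le, of v "eb x ^ Suc (xf x)"] v by simp
      from IH[OF this] \<psi> \<phi> v le
      show "pr (fm_encode \<psi>) v \<in> set_decode T \<longleftrightarrow> sat_code (xq x) (xS x) (xE x) (xc x) (eb x) (fm_encode \<psi>) v"
        by (simp add: subset_trans)
    qed
  qed
  then have *: "computable_pred (\<lambda>x. wf_code (xa x) (xb x) (xf x) \<and>
      sat_code (xq x) (xS x) (xE x) (xc x) (eb x) (xf x) 0)"
    using eb by simp
  \<comment> \<open>The table is queried at valuation code 0, which denotes the constant valuation
    in \<open>good_def\<close>.\<close>
  moreover have "sat_code q nS nE c b y 0 \<longleftrightarrow> good_code y q nS nE c" for q nS nE c b y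
  proof -
    have "dig b 0 = (\<lambda>_. 0)" by (simp add: fun_eq_iff)
    then show ?thesis by (simp add: sat_code_def good_code_def good_def)
  qed
  ultimately have "computable_pred (\<lambda>x. wf_code (xa x) (xb x) (xf x) \<and>
      good_code (xf x) (xq x) (xS x) (xE x) (xc x))" by simp
  from computable_pred_comp[OF this, of "\<lambda>x. pr (a x) (pr (a' x) (pr (f x) (pr (q x) (pr (nS x) (pr (nE x) (c x))))))"]
    assms
  show ?thesis by (simp add: comp_intros xa_def xb_def xf_def xq_def xS_def xE_def xc_def)
qed

section \<open>The decision procedure\<close>

text \<open>All constants are read off from the input: \<open>n\<close> bounds the code of the
  formula, hence its quantifier depth, and exceeds every action of the alphabets, and
  \<open>Suc n\<close> is a positive threshold. \<open>free_code\<close> and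
  \<open>good_code\<close> are accompanied by \<open>wf_code\<close> because the closure rules treat
  them in that conjunction.\<close>

definition accepts :: "nat \<Rightarrow> bool" where
  "accepts n \<longleftrightarrow> (let as = p1 n; ae = p1 (p2 n); f = p2 (p2 n); q = Suc n in
    wf_code as ae f \<and> \<not> (\<exists>v<Suc f. wf_code as ae f \<and> free_code f v) \<and>
    \<not> (\<exists>a<n. a \<in> set_decode as \<and> a \<in> set_decode ae) \<and>
    (\<exists>nS<Suc (system_bound n q). \<exists>nE<Suc (token_bound n q).
      \<exists>X<2 ^ (Suc q ^ Suc (pr (nS + nE) n)). 0 \<in> set_decode X \<and>
      (\<forall>c<Suc q ^ Suc (pr (nS + nE) n). c \<in> set_decode X \<longrightarrow>
        (\<forall>p<nS + nE. \<forall>a<n. nS \<le> p \<and> a \<in> set_decode ae \<and> dig (Suc q) c (pr p a) < q \<longrightarrow>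
          (\<exists>c'<Suc q ^ Suc (pr (nS + nE) n). c' \<in> set_decode X \<and>
            upd_code (Suc q) (Suc (pr (nS + nE) n)) c (pr p a) (Suc (dig (Suc q) c (pr p a))) c')) \<and>
        ((wf_code as ae f \<and> good_code f (Suc n) nS nE c) \<or>
          (\<exists>p<nS. \<exists>a<n. a \<in> set_decode as \<and> dig (Suc q) c (pr p a) < q \<and>
          (\<exists>c'<Suc q ^ Suc (pr (nS + nE) n). c' \<in> set_decode X \<and>
            upd_code (Suc q) (Suc (pr (nS + nE) n)) c (pr p a) (Suc (dig (Suc q) c (pr p a))) c'))))))"

lemma computable_accepts: "computable_pred accepts"
  unfolding accepts_def Let_def system_bound_def token_bound_def upd_code_def dig_def
  by (intro comp_intros)

lemma qd_le_fm_encode: "qd \<phi> \<le> fm_encode \<phi>"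
proof (induction \<phi>)
  case (Neg \<phi>)
  then show ?case using less_pr_fm(1)[of \<phi>] by (simp del: fm_encode.simps)
next
  case (Conj \<phi> \<psi>)
  then show ?case using less_pr_fm(2)[of \<phi> \<psi>] less_pr_fm(3)[of \<psi> \<phi>] by (simp del: fm_encode.simps)
next
  case (Disj \<phi> \<psi>)
  then show ?case using less_pr_fm(4)[of \<phi> \<psi>] less_pr_fm(5)[of \<psi> \<phi>] by (simp del: fm_encode.simps)
next
  case (Exists x \<phi>)
  then show ?case using less_pr_fm(7)[of \<phi> x] by (simp del: fm_encode.simps)
next
  case (Forall x \<phi>)
  then show ?case using less_pr_fm(9)[of \<phi> x] by (simp del: fm_encode.simps)
qed simp_all

lemma free_vars_le_fm_encode: "v \<in> free_vars \<phi> \<Longrightarrow> v \<le> fm_encode \<phi>"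
proof (induction \<phi>)
  case (Neg \<phi>)
  then show ?case using less_pr_fm(1)[of \<phi>] by (auto simp del: fm_encode.simps)
next
  case (Conj \<phi> \<psi>)
  then show ?case using less_pr_fm(2)[of \<phi> \<psi>] less_pr_fm(3)[of \<psi> \<phi>] by (auto simp del: fm_encode.simps)
next
  case (Disj \<phi> \<psi>)
  then show ?case using less_pr_fm(4)[of \<phi> \<psi>] less_pr_fm(5)[of \<psi> \<phi>] by (auto simp del: fm_encode.simps)
next
  case (Exists x \<phi>)
  then show ?case using less_pr_fm(7)[of \<phi> x] by (auto simp del: fm_encode.simps)
next
  case (Forall x \<phi>)
  then show ?case using less_pr_fm(9)[of \<phi> x] by (auto simp del: fm_encode.simps)
qed (auto intro: order_trans[OF le_prod_encode_1 le_prod_encode_2] order_trans[OF le_prod_encode_2 le_prod_encode_2] le_prod_encode_2)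

lemma less_if_in_set_decode: "a \<in> set_decode x \<Longrightarrow> a < x"
proof (rule ccontr)
  assume "a \<in> set_decode x" "\<not> a < x"
  moreover have "a < 2 ^ a" by (rule less_exp)
  ultimately show False by (simp add: set_decode_def)
qed

lemma accepts_iff: "accepts n \<longleftrightarrow> n \<in> encode_inst ` PartSynth"
proof -
  define AS AE where "AS = set_decode (p1 n)" and "AE = set_decode (p1 (p2 n))"
  have le: "p1 n \<le> n" "p1 (p2 n) \<le> n" "p2 (p2 n) \<le> n"
    using p1_le[of n] p1_le[of "p2 n"] p2_le[of "p2 n"] p2_le[of n] by linarith+
  have sub: "AS \<subseteq> {..<n}" "AE \<subseteq> {..<n}"
    using le less_if_in_set_decode unfolding AS_def AE_def by (auto intro: less_le_trans)
  have n: "n = encode_inst (AS, AE, \<phi>)" if "fm_encode \<phi> = p2 (p2 n)" for \<phi>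
    by (simp add: AS_def AE_def that)
  \<comment> \<open>Decoded sets are finite, so a formula code belonging to no instance can only
    fail the tests on actions, free variables or disjointness, which precede the search.\<close>
  have core: "accepts n \<longleftrightarrow> (AS, AE, \<phi>) \<in> PartSynth" if \<phi>: "fm_encode \<phi> = p2 (p2 n)" for \<phi>
  proof (cases "(AS, AE, \<phi>) \<in> instances")
    case True
    then have inst: "AS \<inter> AE = {}" "actions \<phi> \<subseteq> AS \<union> AE" "free_vars \<phi> = {}"
      by (auto simp: instances_def)
    interpret synthesis AS AE \<phi> "Suc n"
      using inst qd_le_fm_encode[of \<phi>] \<phi> le by unfold_locales (auto simp: AS_def AE_def)
    have wf: "wf_code (p1 n) (p1 (p2 n)) (p2 (p2 n))"
      using inst(2) unfolding AS_def AE_def \<phi>[symmetric] wf_code_fm .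
    have "(AS, AE, \<phi>) \<in> PartSynth \<longleftrightarrow> (\<exists>PS PE. finite PS \<and> finite PE \<and> PS \<inter> PE = {} \<and> wins_system PS PE)"
      using True by (auto simp: PartSynth_def wins_system_def)
    also have "\<dots> \<longleftrightarrow> (\<exists>nS<Suc (system_bound n (Suc n)). \<exists>nE<Suc (token_bound n (Suc n)).
        \<exists>X<2 ^ (Suc (Suc n) ^ Suc (pr (nS + nE) n)). safe_code n nS nE (Suc (Suc n) ^ Suc (pr (nS + nE) n)) X)"
      unfolding solvable_iff_bounded_safe[OF sub] using ex_safe_iff_ex_safe_code[OF sub refl] by simp
    also have "\<dots> \<longleftrightarrow> accepts n"
    proof -
      have upd: "upd_code (Suc (Suc n)) (Suc (pr np n)) c (pr p a) (Suc (dig (Suc (Suc n)) c (pr p a))) c' \<longleftrightarrow>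
          conf_of (Suc n) c' = inc (conf_of (Suc n) c) p a"
        if "c < Suc (Suc n) ^ Suc (pr np n)" "c' < Suc (Suc n) ^ Suc (pr np n)" "p < np" "a < n" for np c c' p a
        unfolding upd_code_def conf_of_inc_iff
        using pr_mono[of p np a n] that by (intro dig_fun_upd_iff) auto
      have f: "\<not> (\<exists>v<Suc (p2 (p2 n)). wf_code (p1 n) (p1 (p2 n)) (p2 (p2 n)) \<and> free_code (p2 (p2 n)) v)"
        using inst(3) unfolding \<phi>[symmetric] by simp
      have d: "\<not> (\<exists>a<n. a \<in> set_decode (p1 n) \<and> a \<in> set_decode (p1 (p2 n)))"
        using inst(1) unfolding AS_def AE_def by blast
      have g: "good_code (p2 (p2 n)) (Suc n) nS nE c \<longleftrightarrow>
          good \<phi> {..<nS} {nS..<nS + nE} (conf_of (Suc n) c)" for nS nE c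
        unfolding \<phi>[symmetric] by simp
      show ?thesis
        unfolding accepts_def Let_def safe_code_def g AS_def[symmetric] AE_def[symmetric]
        using wf f d upd by (simp add: AS_def[symmetric] AE_def[symmetric] cong: conj_cong)
    qed
    finally show ?thesis by simp
  next
    case False
    then have "\<not> actions \<phi> \<subseteq> AS \<union> AE \<or> AS \<inter> AE \<noteq> {} \<or> free_vars \<phi> \<noteq> {}"
      by (auto simp: instances_def AS_def AE_def)
    moreover have "AS \<inter> AE \<noteq> {} \<Longrightarrow> \<exists>a<n. a \<in> AS \<and> a \<in> AE" using sub by blast
    moreover have "free_vars \<phi> \<noteq> {} \<Longrightarrow> \<exists>v<Suc (p2 (p2 n)). free_code (p2 (p2 n)) v"
      using free_vars_le_fm_encode[of _ \<phi>] unfolding \<phi>[symmetric] less_Suc_eq_le by auto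
    moreover have "wf_code (p1 n) (p1 (p2 n)) (p2 (p2 n)) \<longleftrightarrow> actions \<phi> \<subseteq> AS \<union> AE"
      unfolding \<phi>[symmetric] AS_def AE_def by simp
    ultimately have "\<not> accepts n" unfolding accepts_def Let_def AS_def AE_def by blast
    with False show ?thesis by (auto simp: PartSynth_def)
  qed
  show ?thesis
  proof
    assume "accepts n"
    then obtain \<phi> where \<phi>: "fm_encode \<phi> = p2 (p2 n)" by (auto simp: accepts_def Let_def wf_code_def)
    with \<open>accepts n\<close> core n show "n \<in> encode_inst ` PartSynth" by blast
  next
    assume "n \<in> encode_inst ` PartSynth"
    then obtain S E \<phi> where i: "n = encode_inst (S, E, \<phi>)" "(S, E, \<phi>) \<in> PartSynth" by auto
    then have "finite S" "finite E" by (auto simp: PartSynth_def instances_def)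
    with i(1) have "AS = S" "AE = E" "fm_encode \<phi> = p2 (p2 n)" by (simp_all add: AS_def AE_def)
    with core i(2) show "accepts n" by blast
  qed
qed

theorem theorem2: "decidable (encode_inst ` PartSynth)"
proof (rule decidable_if_computable_pred)
  have "accepts = (\<lambda>n. n \<in> encode_inst ` PartSynth)" by (simp add: fun_eq_iff accepts_iff)
  with computable_accepts show "computable_pred (\<lambda>n. n \<in> encode_inst ` PartSynth)" by simp
qed

end
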